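(* Let $(\mathcal E,\mathcal C)$ be an admissible form on $X$ of martingale dimension one, let $B\subset X$ be finite, let $(\mathcal E,\mathcal C)$ be complete (with respect to a fixed point $p\in X\setminus B$), and let $b\in\ker\partial^\ast$ be minimal energy-dominant. Endow $\widetilde H_\pm:=\ell(B)\oplus\ker\partial^\bot$ with the scalar product $$\langle(\mathring F_1,F_1^\bot),(\mathring F_2,F_2^\bot)\rangle_{\widetilde H_\pm}=\sum_{q\in B}\mathring F_1(q)\mathring F_2(q)+\langle F_1^\bot,F_2^\bot\rangle_{L^2(X,\nu_b)},$$ let $H_\pm:=\widetilde H_\pm\ominus\operatorname{span}\{(\mathbf 1,-\mathbf 1)\}$ (orthogonal complement), and let $P_\pm$ be the orthogonal projection of $\widetilde H_\pm$ onto $H_\pm$. For $f\in\mathcal D(\partial_B^\bot)$ with canonical representation $f=g+\star_b^{-1}\partial u+w$ and $z=\partial_B^\bot f-\star_b^{-1}\partial g$ set $$G_-f:=\tfrac1{\sqrt2}P_\pm\big(g|_B+n_B(fb),\,w+z\big),\qquad G_+f:=\tfrac1{\sqrt2}P_\pm\big(g|_B-n_B(fb),\,w-z\big).$$ Then $(H_\pm,H_\pm,G_-,G_+)$ is a boundary quadruple for the operator $(-\star_b^{-1}\partial_B,\mathcal C_B)$ on $L^2(X,\nu_b)$.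
   Context: **Admissible forms.** $(X,\varrho)$ is a locally compact separable metric space, $C_c(X)$ the space of continuous compactly supported real functions with norm $\|\cdot\|_{\sup}$. An admissible form is a pair $(\mathcal E,\mathcal C)$, $\mathcal C\subset C_c(X)$ a subalgebra, $\mathcal E:\mathcal C\times\mathcal C\to\mathbb R$ nonnegative definite symmetric bilinear, $\mathcal E(f):=\mathcal E(f,f)$, such that: (1) $\mathcal C$ is dense in $C_c(X)$; (2) $\mathcal C$ is separable for the seminorm $\mathcal E^{1/2}$; (3) $u\in\mathcal C$ implies $(u\wedge1)\vee0\in\mathcal C$ and $\mathcal E((u\wedge1)\vee0)\le\mathcal E(u)$; (4) for $f\in\mathcal C$ the functional $g\mapsto\mathcal E(fg,f)-\frac12\mathcal E(f^2,g)$ is positive on $\mathcal C$ and bounded w.r.t. $\|\cdot\|_{\sup}$; (5) $\mathcal E(f,g)=0$ whenever $g$ is constant on a neighborhood of $\operatorname{supp}f$. **First order structure.** For $f_1,f_2\in\mathcal C$, $\nu_{f_1,f_2}$ is the unique finite signed Radon measure with $\int g\,d\nu_{f_1,f_2}=\frac12\{\mathcal E(f_1g,f_2)+\mathcal E(f_1,f_2g)-\mathcal E(f_1f_2,g)\}$, $g\in\mathcal C$; $\nu_f:=\nu_{f,f}$. Put $d_uf(x,y)=f(x)-f(y)$, $\overline g(x,y)=\frac12(g(x)+g(y))$. $\mathcal H$ is the Hilbert space obtained from the span of all $\overline g\,d_uf$ ($g\in C_c(X)$, $f\in\mathcal C$) with the nonnegative definite form $\langle\overline g_1d_uf_1,\overline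 g_2d_uf_2\rangle_{\mathcal H}=\int g_1g_2\,d\nu_{f_1,f_2}$ by factoring out null elements and completing. $\partial f$ is the class of $d_uf$, $g\,\partial f$ the class of $\overline g\,d_uf$; this extends to a bounded action of $C_c(X)$ on $\mathcal H$. One has $\|\partial f\|_{\mathcal H}^2=\mathcal E(f)$ and $\partial(fg)=f\partial g+g\partial f$. For $v,w\in\mathcal H$, $\nu_{v,w}$ is the finite signed measure determined by bilinear continuous extension of $\nu_{g_1\partial f_1,g_2\partial f_2}=g_1g_2\nu_{f_1,f_2}$; $\nu_v:=\nu_{v,v}\ge0$, $\nu_{v,w}(X)=\langle v,w\rangle_{\mathcal H}$. The map $g\mapsto gv$ extends to an isometry $L^2(X,\nu_v)\to\mathcal H$. $\mathcal C$ is normed by $\|f\|_{\mathcal C}=\mathcal E(f)^{1/2}+\|f\|_{\sup}$, with dual $\mathcal C^\ast$. **Energy dominance, martingale dimension.** A $\sigma$-finite Borel measure $\nu$ is energy-dominant if $\nu_f\ll\nu$ for all $f\in\mathcal C$; minimal if moreover $\nu\ll\nu'$ for every energy-dominant $\nu'$. $v\in\mathcal H$ is minimal energy-dominant if $\nu_v$ is. For a minimal energy-dominant $\nu$, the pointwise index is the ($\nu$-a.e. unique) minimal Borel function $p(\cdot):X\to\mathbb N\cup\{\infty\}$ with $\operatorname{rank}\big(\frac{d\nu_{f_i,f_j}}{d\nu}(x)\big)_{i,j=1}^N\le p(x)$ for $\nu$-a.e. $x$, for all $N$ and $f_1,\dots,f_N\in\mathcal C$. The martingale dimension is $\nu\text{-}\operatorname{ess\,sup}p(\cdot)$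 (independent of $\nu$). **Duality and operators.** If the martingale dimension is one and $b$ is minimal energy-dominant, $\star_b:L^2(X,\nu_b)\to\mathcal H$, $\star_bg:=gb$, is an isometric isomorphism. $\mathcal C_B:=\{f\in\mathcal C:f|_B\equiv0\}$, $\partial_B:=\partial|_{\mathcal C_B}$. For $v\in\mathcal H$, $v\in\ker\partial_B^\ast$ (resp. $v\in\ker\partial^\ast$) means $\langle v,\partial\varphi\rangle_{\mathcal H}=0$ for all $\varphi\in\mathcal C_B$ (resp. $\varphi\in\mathcal C$). $(\partial^\ast,\mathcal D(\partial^\ast))$ and $(\partial_B^\ast,\mathcal D(\partial_B^\ast))$ are the adjoints (from $\mathcal H$ to $L^2(X,\nu_b)$) of the densely defined operators $(\partial,\mathcal C)$, $(\partial_B,\mathcal C_B)$ from $L^2(X,\nu_b)$ to $\mathcal H$. $\mathcal D(\partial^\bot):=\star_b^{-1}\mathcal D(\partial^\ast)$, $\partial^\bot f:=-\partial^\ast\star_bf$; $\mathcal D(\partial_B^\bot):=\star_b^{-1}\mathcal D(\partial_B^\ast)$, $\partial_B^\bot f:=-\partial_B^\ast\star_bf$. For $b\in\ker\partial_B^\ast$ the operator $(-\star_b^{-1}\partial_B,\mathcal C_B)$ is skew-symmetric on $L^2(X,\nu_b)$ and $(\star_b^{-1}\partial_B)^\ast=-\partial_B^\bot$. **Completeness.** The form is complete with respect to $p\in X\setminus B$ if $\mathbf 1\in\mathcal C$, $\ker\partial=\mathbb R$ (constants), $\mathcal C_p:=\{f\in\mathcal C:f(p)=0\}$ is a Hilbert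 space with scalar product $\mathcal E$, and $\|f\|_{\sup}\le c_p\mathcal E(f)^{1/2}$ for $f\in\mathcal C_p$ with some $c_p>0$. Then $X$ is compact, energy measures have no atoms (so finite $B$ are null sets for minimal energy-dominant measures), and $\mathcal H=\partial(\mathcal C)\oplus\ker\partial^\ast$ orthogonally. **Laplacian, normal parts, Neumann problem** (with $\nu=\nu_b$). $u\in\mathcal C$ is in $\mathcal D(\Delta_B)$ with $\Delta_Bu=f\in L^2(X,\nu)$ if $\mathcal E(u,\varphi)=-\int_Xf\varphi\,d\nu$ for all $\varphi\in\mathcal C_B$. For $B\ne\emptyset$ and $v\in\mathcal D(\partial_B^\ast)$ the normal part $n_Bv\in\mathcal C^\ast$ is $n_Bv(\varphi):=\langle v,\partial\varphi\rangle_{\mathcal H}-\int_X(\partial_B^\ast v)\varphi\,d\nu$, $\varphi\in\mathcal C$; for $B=\emptyset$, $n_Bv:=0$. For finite $B$, $n_Bv$ is identified with the function $n_Bv(q):=n_Bv(\psi_q)$ in the space $\ell(B)$ of real functions on $B$, where $\psi_q\in\mathcal C$ is the function with $\psi_q(q)=1$, $\psi_q=0$ on $B\setminus\{q\}$ and $\mathcal E(\psi_q,\varphi)=0$ for all $\varphi\in\mathcal C_B$; then $n_Bv(\varphi)=\sum_{q\in B}\varphi(q)n_Bv(q)$. $(du)_B:=n_B\partial u$ for $u\in\mathcal D(\Delta_B)$. For $f\in L^2(X,\nu)$ and $G\in\mathcal C^\ast$ vanishing on $\mathcal C_B$, $u\in\mathcal C$ is a weak solution of $\Delta_Bu=f$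 on $X\setminus B$, $(du)_B=G$ on $B$, if $\mathcal E(u,\varphi)=G(\varphi)-\int_Xf\varphi\,d\nu$ for all $\varphi\in\mathcal C$ (for $B=\emptyset$: the Poisson equation $\Delta u=f$, $G=0$). **Canonical representation** of $f\in\mathcal D(\partial_B^\bot)$: $f=g+\star_b^{-1}\partial u+w$ with $g\in\mathcal C$ such that $z:=\partial_B^\bot f-\star_b^{-1}\partial g\in\ker\partial^\bot$, $w\in\ker\partial^\bot$, and $u$ a weak solution of $\Delta_Bu=z$ on $X\setminus B$, $(du)_B=n_B(fb)-n_Bb(g\,\cdot)$ on $B$. Every $f\in\mathcal D(\partial_B^\bot)$ has one; any two are related by $\widetilde g=g+c$, $\partial\widetilde u=\partial u-c\,\partial h$, $\widetilde w=w-c\star_b^{-1}v$ with $c\in\mathbb R$, where $b=\partial h+v$, $h\in\mathcal C$, $v\in\ker\partial^\ast$. (For $b\in\ker\partial^\ast$: $\partial h=0$, $\star_b^{-1}v=\mathbf 1$; consequently $G_\pm$ are well defined.) **Boundary quadruple.** For a densely defined skew-symmetric operator $A_0$ on a real Hilbert space $H$ put $\hat A:=(-A_0)^\ast$. A boundary quadruple $(H_-,H_+,G_-,G_+)$ for $A_0$ consists of pre-Hilbert spaces $H_-,H_+$ and linear maps $G_\mp:\mathcal D(\hat A)\to H_\mp$ with: $\langle\hat Af_1,f_2\rangle_H+\langle f_1,\hat Af_2\rangle_H=\langle G_+f_1,G_+f_2\rangle_{H_+}-\langle G_-f_1,G_-f_2\rangle_{H_-}$ for all $f_1,f_2\in\mathcal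 D(\hat A)$; $\ker G_++\ker G_-=\mathcal D(\hat A)$; and $G_-(\mathcal D(\hat A))=H_-$, $G_+(\mathcal D(\hat A))=H_+$. **Convention.** $\ell(\emptyset):=\{0\}$; a trivial summand in $\widetilde H_\pm$ is omitted everywhere (for $B=\emptyset$: $\widetilde H_\pm=\ker\partial^\bot$, $H_\pm=\ker\partial^\bot\ominus\mathbb R$, and the first components are dropped). *)

theory Defs
  imports
    "Jordan_Normal_Form.DL_Rank"
    "HOL-Analysis.Analysis"
    "HOL-Analysis.Finite_Function_Topology"
begin

section \<open>Finite signed Borel measures\<close>

text \<open>A finite signed Borel measure is a real-valued set function of which only the values on
  Borel sets matter.  Integrals are taken via the Jordan decomposition.\<close>

definition signed_measure :: "('a::topological_space set \<Rightarrow> real) \<Rightarrow> bool" where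
  "signed_measure \<sigma> \<longleftrightarrow>
     (\<forall>A::nat \<Rightarrow> 'a set. range A \<subseteq> sets borel \<longrightarrow> disjoint_family A \<longrightarrow>
        (\<lambda>n. \<sigma> (A n)) sums \<sigma> (\<Union>n. A n))"

definition positive_variation :: "('a::topological_space set \<Rightarrow> real) \<Rightarrow> 'a measure" where
  "positive_variation \<sigma> =
     measure_of UNIV (sets borel) (\<lambda>A. SUP E\<in>{E \<in> sets borel. E \<subseteq> A}. ennreal (\<sigma> E))"

definition signed_integral :: "('a::topological_space set \<Rightarrow> real) \<Rightarrow> ('a \<Rightarrow> real) \<Rightarrow> real" where
  "signed_integral \<sigma> g =
     (\<integral>x. g x \<partial>positive_variation \<sigma>) - (\<integral>x. g x \<partial>positive_variation (\<lambda>A. - \<sigma> A))"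

text \<open>Only meant for nonnegative \<open>\<sigma>\<close>.\<close>

definition as_measure :: "('a::topological_space set \<Rightarrow> real) \<Rightarrow> 'a measure" where
  "as_measure \<sigma> = measure_of UNIV (sets borel) (\<lambda>A. ennreal (\<sigma> A))"

definition signed_RN_deriv :: "'a::topological_space measure \<Rightarrow> ('a set \<Rightarrow> real) \<Rightarrow> 'a \<Rightarrow> real" where
  "signed_RN_deriv M \<sigma> =
     (SOME h. integrable M h \<and> (\<forall>A\<in>sets borel. set_lebesgue_integral M A h = \<sigma> A))"

section \<open>Admissible forms\<close>

definition Cc :: "('a::topological_space \<Rightarrow> real) set" where
  "Cc = {f. continuous_on UNIV f \<and> compact (closure {x. f x \<noteq> 0})}"

definition sup_norm :: "('a \<Rightarrow> real) \<Rightarrow> real" where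
  "sup_norm f = (SUP x. \<bar>f x\<bar>)"

definition subalgebra_Cc :: "('a::topological_space \<Rightarrow> real) set \<Rightarrow> bool" where
  "subalgebra_Cc C \<longleftrightarrow> C \<subseteq> Cc \<and> (\<lambda>x. 0) \<in> C \<and>
     (\<forall>f\<in>C. \<forall>g\<in>C. (\<lambda>x. f x + g x) \<in> C \<and> (\<lambda>x. f x * g x) \<in> C) \<and>
     (\<forall>f\<in>C. \<forall>c. (\<lambda>x. c * f x) \<in> C)"

definition nonneg_symmetric_form ::
  "(('a \<Rightarrow> real) \<Rightarrow> ('a \<Rightarrow> real) \<Rightarrow> real) \<Rightarrow> ('a \<Rightarrow> real) set \<Rightarrow> bool" where
  "nonneg_symmetric_form E C \<longleftrightarrow>
     (\<forall>f\<in>C. \<forall>g\<in>C. E f g = E g f) \<and>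
     (\<forall>f\<in>C. \<forall>g\<in>C. \<forall>h\<in>C. E (\<lambda>x. f x + g x) h = E f h + E g h) \<and>
     (\<forall>f\<in>C. \<forall>h\<in>C. \<forall>c. E (\<lambda>x. c * f x) h = c * E f h) \<and>
     (\<forall>f\<in>C. 0 \<le> E f f)"

definition admissible_form ::
  "(('a::topological_space \<Rightarrow> real) \<Rightarrow> ('a \<Rightarrow> real) \<Rightarrow> real) \<Rightarrow> ('a \<Rightarrow> real) set \<Rightarrow> bool" where
  "admissible_form E C \<longleftrightarrow> subalgebra_Cc C \<and> nonneg_symmetric_form E C \<and>
     (\<forall>f\<in>Cc. \<forall>\<epsilon>>0. \<exists>g\<in>C. sup_norm (\<lambda>x. f x - g x) < \<epsilon>) \<and>
     (\<exists>Q\<subseteq>C. countable Q \<and>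
        (\<forall>f\<in>C. \<forall>\<epsilon>>0. \<exists>g\<in>Q. sqrt (E (\<lambda>x. f x - g x) (\<lambda>x. f x - g x)) < \<epsilon>)) \<and>
     (\<forall>u\<in>C. (\<lambda>x. max (min (u x) 1) 0) \<in> C \<and>
        E (\<lambda>x. max (min (u x) 1) 0) (\<lambda>x. max (min (u x) 1) 0) \<le> E u u) \<and>
     (\<forall>f\<in>C. (\<forall>g\<in>C. (\<forall>x. 0 \<le> g x) \<longrightarrow>
                0 \<le> E (\<lambda>x. f x * g x) f - 1/2 * E (\<lambda>x. f x * f x) g) \<and>
            (\<exists>K. \<forall>g\<in>C. \<bar>E (\<lambda>x. f x * g x) f - 1/2 * E (\<lambda>x. f x * f x) g\<bar> \<le> K * sup_norm g)) \<and>
     (\<forall>f\<in>C. \<forall>g\<in>C.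
        (\<exists>U c. open U \<and> closure {x. f x \<noteq> 0} \<subseteq> U \<and> (\<forall>x\<in>U. g x = c)) \<longrightarrow> E f g = 0)"

section \<open>First order structure\<close>

text \<open>On a locally compact separable metric space every finite signed Borel measure is Radon, so
  these conditions determine \<open>\<nu> f1 f2\<close> on the Borel sets.\<close>

definition energy_measures ::
  "(('a::topological_space \<Rightarrow> real) \<Rightarrow> ('a \<Rightarrow> real) \<Rightarrow> real) \<Rightarrow> ('a \<Rightarrow> real) set \<Rightarrow>
   (('a \<Rightarrow> real) \<Rightarrow> ('a \<Rightarrow> real) \<Rightarrow> 'a set \<Rightarrow> real) \<Rightarrow> bool" where
  "energy_measures E C \<nu> \<longleftrightarrow>
     (\<forall>f1\<in>C. \<forall>f2\<in>C. signed_measure (\<nu> f1 f2) \<and>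
        (\<forall>g\<in>C. signed_integral (\<nu> f1 f2) g =
           1/2 * (E (\<lambda>x. f1 x * g x) f2 + E f1 (\<lambda>x. f2 x * g x) - E (\<lambda>x. f1 x * f2 x) g)))"

definition universal_deriv :: "('a \<Rightarrow> real) \<Rightarrow> 'a \<times> 'a \<Rightarrow> real" where
  "universal_deriv f = (\<lambda>(x, y). f x - f y)"

definition mean_ext :: "('a \<Rightarrow> real) \<Rightarrow> 'a \<times> 'a \<Rightarrow> real" where
  "mean_ext g = (\<lambda>(x, y). 1/2 * (g x + g y))"

definition simple_field :: "('a \<Rightarrow> real) \<Rightarrow> ('a \<Rightarrow> real) \<Rightarrow> 'a \<times> 'a \<Rightarrow> real" where
  "simple_field g f = (\<lambda>z. mean_ext g z * universal_deriv f z)"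

text \<open>The coefficient \<open>1\<close> is admitted besides \<open>C\<^sub>c\<close> so that \<open>universal_deriv f\<close> itself lies in
  the span.  It is the limit of \<open>mean_ext g\<^sub>n\<close> times \<open>universal_deriv f\<close> for \<open>g\<^sub>n\<close> in \<open>C\<^sub>c\<close>
  increasing to \<open>1\<close>, so the completion does not change; for compact spaces nothing is added.\<close>

definition coefficients :: "('a::topological_space \<Rightarrow> real) set" where
  "coefficients = insert (\<lambda>x. 1) Cc"

definition field_span :: "('a::topological_space \<Rightarrow> real) set \<Rightarrow> ('a \<times> 'a \<Rightarrow> real) set" where
  "field_span C = {F. \<exists>n (c::nat \<Rightarrow> real) g f. (\<forall>i<n. g i \<in> coefficients \<and> f i \<in> C) \<and>
      F = (\<lambda>z. \<Sum>i<n. c i * simple_field (g i) (f i) z)}"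

text \<open>The type \<open>'h\<close> is the Hilbert space of the first order structure: \<open>\<iota>\<close> maps an element of the
  span to its class.  Factoring out null elements and completing is expressed by \<open>\<iota>\<close> being linear,
  transporting the given form to the inner product, and having dense range; this determines
  \<open>('h, \<iota>)\<close> up to a unique isometric isomorphism.\<close>

definition first_order_space ::
  "('a::topological_space \<Rightarrow> real) set \<Rightarrow> (('a \<Rightarrow> real) \<Rightarrow> ('a \<Rightarrow> real) \<Rightarrow> 'a set \<Rightarrow> real) \<Rightarrow>
   (('a \<times> 'a \<Rightarrow> real) \<Rightarrow> 'h::{real_inner, complete_space}) \<Rightarrow> bool" where
  "first_order_space C \<nu> \<iota> \<longleftrightarrow>
     (\<forall>F\<in>field_span C. \<forall>G\<in>field_span C. \<iota> (\<lambda>z. F z + G z) = \<iota> F + \<iota> G) \<and>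
     (\<forall>F\<in>field_span C. \<forall>c. \<iota> (\<lambda>z. c * F z) = c *\<^sub>R \<iota> F) \<and>
     (\<forall>g1\<in>coefficients. \<forall>g2\<in>coefficients. \<forall>f1\<in>C. \<forall>f2\<in>C.
        inner (\<iota> (simple_field g1 f1)) (\<iota> (simple_field g2 f2)) =
          signed_integral (\<nu> f1 f2) (\<lambda>x. g1 x * g2 x)) \<and>
     closure (\<iota> ` field_span C) = UNIV"

definition gradient :: "(('a \<times> 'a \<Rightarrow> real) \<Rightarrow> 'h) \<Rightarrow> ('a \<Rightarrow> real) \<Rightarrow> 'h" where
  "gradient \<iota> f = \<iota> (universal_deriv f)"

definition action ::
  "('a::topological_space \<Rightarrow> real) set \<Rightarrow> (('a \<times> 'a \<Rightarrow> real) \<Rightarrow> 'h::real_inner) \<Rightarrow>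
   ('a \<Rightarrow> real) \<Rightarrow> 'h \<Rightarrow> 'h" where
  "action C \<iota> g = (THE T. bounded_linear T \<and>
     (\<forall>g1\<in>coefficients. \<forall>f\<in>C. T (\<iota> (simple_field g1 f)) = \<iota> (simple_field (\<lambda>x. g x * g1 x) f)))"

definition field_energy_measure ::
  "('a::topological_space \<Rightarrow> real) set \<Rightarrow> (('a \<Rightarrow> real) \<Rightarrow> ('a \<Rightarrow> real) \<Rightarrow> 'a set \<Rightarrow> real) \<Rightarrow>
   (('a \<times> 'a \<Rightarrow> real) \<Rightarrow> 'h::real_inner) \<Rightarrow> 'h \<Rightarrow> 'h \<Rightarrow> 'a set \<Rightarrow> real" where
  "field_energy_measure C \<nu> \<iota> v w A =
     (THE \<beta>. bounded_bilinear \<beta> \<and>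
        (\<forall>g1\<in>coefficients. \<forall>g2\<in>coefficients. \<forall>f1\<in>C. \<forall>f2\<in>C.
           \<beta> (\<iota> (simple_field g1 f1)) (\<iota> (simple_field g2 f2)) =
             signed_integral (\<nu> f1 f2) (\<lambda>x. indicator A x * (g1 x * g2 x)))) v w"

section \<open>Energy dominance and martingale dimension\<close>

definition energy_dominant ::
  "('a::topological_space \<Rightarrow> real) set \<Rightarrow> (('a \<Rightarrow> real) \<Rightarrow> ('a \<Rightarrow> real) \<Rightarrow> 'a set \<Rightarrow> real) \<Rightarrow>
   'a measure \<Rightarrow> bool" where
  "energy_dominant C \<nu> M \<longleftrightarrow> sets M = sets borel \<and> sigma_finite_measure M \<and>
     (\<forall>f\<in>C. absolutely_continuous M (as_measure (\<nu> f f)))"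

definition minimal_energy_dominant ::
  "('a::topological_space \<Rightarrow> real) set \<Rightarrow> (('a \<Rightarrow> real) \<Rightarrow> ('a \<Rightarrow> real) \<Rightarrow> 'a set \<Rightarrow> real) \<Rightarrow>
   'a measure \<Rightarrow> bool" where
  "minimal_energy_dominant C \<nu> M \<longleftrightarrow> energy_dominant C \<nu> M \<and>
     (\<forall>M'. energy_dominant C \<nu> M' \<longrightarrow> absolutely_continuous M' M)"

definition gram_rank ::
  "(('a::topological_space \<Rightarrow> real) \<Rightarrow> ('a \<Rightarrow> real) \<Rightarrow> 'a set \<Rightarrow> real) \<Rightarrow> 'a measure \<Rightarrow>
   nat \<Rightarrow> (nat \<Rightarrow> 'a \<Rightarrow> real) \<Rightarrow> 'a \<Rightarrow> nat" where
  "gram_rank \<nu> M N f x =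
     vec_space.rank N (Matrix.mat N N (\<lambda>(i, j). signed_RN_deriv M (\<nu> (f i) (f j)) x))"

definition index_bound ::
  "('a::topological_space \<Rightarrow> real) set \<Rightarrow> (('a \<Rightarrow> real) \<Rightarrow> ('a \<Rightarrow> real) \<Rightarrow> 'a set \<Rightarrow> real) \<Rightarrow>
   'a measure \<Rightarrow> ('a \<Rightarrow> enat) \<Rightarrow> bool" where
  "index_bound C \<nu> M p \<longleftrightarrow> p \<in> measurable M (count_space UNIV) \<and>
     (\<forall>N f. (\<forall>i<N. f i \<in> C) \<longrightarrow> (AE x in M. enat (gram_rank \<nu> M N f x) \<le> p x))"

definition pointwise_index ::
  "('a::topological_space \<Rightarrow> real) set \<Rightarrow> (('a \<Rightarrow> real) \<Rightarrow> ('a \<Rightarrow> real) \<Rightarrow> 'a set \<Rightarrow> real) \<Rightarrow>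
   'a measure \<Rightarrow> ('a \<Rightarrow> enat) \<Rightarrow> bool" where
  "pointwise_index C \<nu> M p \<longleftrightarrow> index_bound C \<nu> M p \<and>
     (\<forall>q. index_bound C \<nu> M q \<longrightarrow> (AE x in M. p x \<le> q x))"

text \<open>The library's \<open>esssup\<close> requires a dense order, so the essential supremum is written out.\<close>

definition has_martingale_dimension ::
  "('a::topological_space \<Rightarrow> real) set \<Rightarrow> (('a \<Rightarrow> real) \<Rightarrow> ('a \<Rightarrow> real) \<Rightarrow> 'a set \<Rightarrow> real) \<Rightarrow>
   enat \<Rightarrow> bool" where
  "has_martingale_dimension C \<nu> d \<longleftrightarrow>
     (\<exists>M p. minimal_energy_dominant C \<nu> M \<and> pointwise_index C \<nu> M p \<and>
        d = Inf {m. AE x in M. p x \<le> m})"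

section \<open>Completeness\<close>

definition complete_form ::
  "(('a::topological_space \<Rightarrow> real) \<Rightarrow> ('a \<Rightarrow> real) \<Rightarrow> real) \<Rightarrow> ('a \<Rightarrow> real) set \<Rightarrow>
   (('a \<times> 'a \<Rightarrow> real) \<Rightarrow> 'h::real_inner) \<Rightarrow> 'a \<Rightarrow> bool" where
  "complete_form E C \<iota> p \<longleftrightarrow>
     (\<lambda>x. 1) \<in> C \<and>
     {f \<in> C. gradient \<iota> f = 0} = range (\<lambda>c x. c) \<and>
     (\<forall>f\<in>C. f p = 0 \<longrightarrow> E f f = 0 \<longrightarrow> f = (\<lambda>x. 0)) \<and>
     (\<forall>u. (\<forall>n. u n \<in> C \<and> u n p = 0) \<longrightarrow>
        (\<forall>\<epsilon>>0. \<exists>N::nat. \<forall>m\<ge>N. \<forall>n\<ge>N. E (\<lambda>x. u m x - u n x) (\<lambda>x. u m x - u n x) < \<epsilon>) \<longrightarrow>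
        (\<exists>f\<in>C. f p = 0 \<and> (\<lambda>n. E (\<lambda>x. u n x - f x) (\<lambda>x. u n x - f x)) \<longlonglongrightarrow> 0)) \<and>
     (\<exists>c>0. \<forall>f\<in>C. f p = 0 \<longrightarrow> sup_norm f \<le> c * sqrt (E f f))"

section \<open>Unbounded operators and boundary quadruples\<close>

text \<open>An operator is represented by its graph.\<close>

definition op_apply :: "('u \<times> 'v) set \<Rightarrow> 'u \<Rightarrow> 'v" where
  "op_apply T x = (THE y. (x, y) \<in> T)"

definition adjoint_op :: "('u::real_inner \<times> 'v::real_inner) set \<Rightarrow> ('v \<times> 'u) set" where
  "adjoint_op T = {(y, z). \<forall>(x, x')\<in>T. inner x' y = inner x z}"

definition densely_defined_op :: "('u::real_inner \<times> 'v::real_inner) set \<Rightarrow> bool" where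
  "densely_defined_op T \<longleftrightarrow>
     single_valued T \<and> Real_Vector_Spaces.subspace T \<and> closure (Domain T) = UNIV"

definition skew_symmetric_op :: "('u::real_inner \<times> 'u) set \<Rightarrow> bool" where
  "skew_symmetric_op T \<longleftrightarrow> (\<forall>(x, x')\<in>T. \<forall>(y, y')\<in>T. inner x' y = - inner x y')"

definition pre_hilbert :: "'v::real_vector set \<Rightarrow> ('v \<Rightarrow> 'v \<Rightarrow> real) \<Rightarrow> bool" where
  "pre_hilbert V ip \<longleftrightarrow> Real_Vector_Spaces.subspace V \<and>
     (\<forall>x\<in>V. \<forall>y\<in>V. ip x y = ip y x) \<and>
     (\<forall>x\<in>V. \<forall>y\<in>V. \<forall>z\<in>V. ip (x + y) z = ip x z + ip y z) \<and>
     (\<forall>x\<in>V. \<forall>z\<in>V. \<forall>c. ip (c *\<^sub>R x) z = c * ip x z) \<and>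
     (\<forall>x\<in>V. x \<noteq> 0 \<longrightarrow> 0 < ip x x)"

definition linear_between :: "'u::real_vector set \<Rightarrow> ('u \<Rightarrow> 'v::real_vector) \<Rightarrow> bool" where
  "linear_between V G \<longleftrightarrow> (\<forall>x\<in>V. \<forall>y\<in>V. G (x + y) = G x + G y) \<and> (\<forall>x\<in>V. \<forall>c. G (c *\<^sub>R x) = c *\<^sub>R G x)"

definition hat_op :: "('u::real_inner \<times> 'u) set \<Rightarrow> ('u \<times> 'u) set" where
  "hat_op A0 = adjoint_op ((\<lambda>(x, y). (x, - y)) ` A0)"

definition boundary_quadruple ::
  "('u::{real_inner, complete_space} \<times> 'u) set \<Rightarrow>
   'm::real_vector set \<Rightarrow> ('m \<Rightarrow> 'm \<Rightarrow> real) \<Rightarrow> 'p::real_vector set \<Rightarrow> ('p \<Rightarrow> 'p \<Rightarrow> real) \<Rightarrow>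
   ('u \<Rightarrow> 'm) \<Rightarrow> ('u \<Rightarrow> 'p) \<Rightarrow> bool" where
  "boundary_quadruple A0 Hm ipm Hp ipp Gm Gp \<longleftrightarrow>
     densely_defined_op A0 \<and> skew_symmetric_op A0 \<and>
     pre_hilbert Hm ipm \<and> pre_hilbert Hp ipp \<and>
     linear_between (Domain (hat_op A0)) Gm \<and> linear_between (Domain (hat_op A0)) Gp \<and>
     (\<forall>f1\<in>Domain (hat_op A0). \<forall>f2\<in>Domain (hat_op A0).
        inner (op_apply (hat_op A0) f1) f2 + inner f1 (op_apply (hat_op A0) f2) =
          ipp (Gp f1) (Gp f2) - ipm (Gm f1) (Gm f2)) \<and>
     {x + y | x y. x \<in> Domain (hat_op A0) \<and> Gp x = 0 \<and> y \<in> Domain (hat_op A0) \<and> Gm y = 0} =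
       Domain (hat_op A0) \<and>
     Gm ` Domain (hat_op A0) = Hm \<and> Gp ` Domain (hat_op A0) = Hp"

section \<open>The space of square integrable functions and the duality map\<close>

definition L2_functions :: "'a measure \<Rightarrow> ('a \<Rightarrow> real) set" where
  "L2_functions M = {f \<in> borel_measurable M. integrable M (\<lambda>x. f x * f x)}"

text \<open>The type \<open>'l\<close> is the Hilbert space of square integrable functions modulo equality almost
  everywhere; \<open>cls\<close> maps a function to its class.\<close>

definition L2_space ::
  "'a measure \<Rightarrow> (('a \<Rightarrow> real) \<Rightarrow> 'l::{real_inner, complete_space}) \<Rightarrow> bool" where
  "L2_space M cls \<longleftrightarrow>
     (\<forall>f\<in>L2_functions M. \<forall>g\<in>L2_functions M. cls (\<lambda>x. f x + g x) = cls f + cls g) \<and>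
     (\<forall>f\<in>L2_functions M. \<forall>c. cls (\<lambda>x. c * f x) = c *\<^sub>R cls f) \<and>
     (\<forall>f\<in>L2_functions M. \<forall>g\<in>L2_functions M. inner (cls f) (cls g) = (\<integral>x. f x * g x \<partial>M)) \<and>
     cls ` L2_functions M = UNIV"

definition star ::
  "('a::topological_space \<Rightarrow> real) set \<Rightarrow> (('a \<times> 'a \<Rightarrow> real) \<Rightarrow> 'h::real_inner) \<Rightarrow>
   (('a \<Rightarrow> real) \<Rightarrow> 'l::real_inner) \<Rightarrow> 'h \<Rightarrow> 'l \<Rightarrow> 'h" where
  "star C \<iota> cls b = (THE S. bounded_linear S \<and> (\<forall>F. norm (S F) = norm F) \<and>
     (\<forall>g\<in>Cc. S (cls g) = action C \<iota> g b))"

definition adjoint_kernel :: "('a \<Rightarrow> real) set \<Rightarrow> (('a \<Rightarrow> real) \<Rightarrow> 'h::real_inner) \<Rightarrow> 'h set" where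
  "adjoint_kernel C D = {v. \<forall>\<phi>\<in>C. inner v (D \<phi>) = 0}"

section \<open>Normal parts, canonical representation and boundary maps\<close>

text \<open>\<open>D\<close> is the gradient, \<open>S\<close> the duality map of \<open>b\<close> and \<open>cls\<close> the class map of the underlying
  space of square integrable functions.  The space of real functions on the finite set \<open>B\<close> is
  represented by the finitely supported functions with keys in \<open>B\<close>.\<close>

locale boundary_setting =
  fixes E :: "('a \<Rightarrow> real) \<Rightarrow> ('a \<Rightarrow> real) \<Rightarrow> real"
    and C :: "('a \<Rightarrow> real) set"
    and D :: "('a \<Rightarrow> real) \<Rightarrow> 'h::{real_inner, complete_space}"
    and cls :: "('a \<Rightarrow> real) \<Rightarrow> 'l::{real_inner, complete_space}"
    and S :: "'l \<Rightarrow> 'h"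
    and b :: 'h
    and B :: "'a set"
begin

definition S_inv :: "'h \<Rightarrow> 'l" where
  "S_inv = inv_into UNIV S"

definition CB :: "('a \<Rightarrow> real) set" where
  "CB = {f \<in> C. \<forall>x\<in>B. f x = 0}"

definition A0 :: "('l \<times> 'l) set" where
  "A0 = {(cls f, - S_inv (D f)) | f. f \<in> CB}"

definition adjB :: "('h \<times> 'l) set" where
  "adjB = adjoint_op {(cls f, D f) | f. f \<in> CB}"

definition dom_perp :: "'l set" where
  "dom_perp = {f. S f \<in> Domain adjB}"

definition perp :: "'l \<Rightarrow> 'l" where
  "perp f = - op_apply adjB (S f)"

definition ker_perp :: "'l set" where
  "ker_perp = {f. S f \<in> adjoint_kernel C D}"

definition normal_part :: "'h \<Rightarrow> ('a \<Rightarrow> real) \<Rightarrow> real" where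
  "normal_part v \<phi> =
     (if B = {} then 0 else inner v (D \<phi>) - inner (op_apply adjB v) (cls \<phi>))"

definition \<psi> :: "'a \<Rightarrow> 'a \<Rightarrow> real" where
  "\<psi> q = (THE f. f \<in> C \<and> f q = 1 \<and> (\<forall>x\<in>B - {q}. f x = 0) \<and> (\<forall>\<phi>\<in>CB. E f \<phi> = 0))"

definition on_B :: "('a \<Rightarrow> real) \<Rightarrow> ('a, real) poly_mapping" where
  "on_B F = Abs_poly_mapping (\<lambda>q. if q \<in> B then F q else 0)"

definition normal_values :: "'h \<Rightarrow> ('a, real) poly_mapping" where
  "normal_values v = on_B (\<lambda>q. normal_part v (\<psi> q))"

definition weak_solution :: "'l \<Rightarrow> (('a \<Rightarrow> real) \<Rightarrow> real) \<Rightarrow> ('a \<Rightarrow> real) \<Rightarrow> bool" where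
  "weak_solution f G u \<longleftrightarrow> u \<in> C \<and> (\<forall>\<phi>\<in>C. E u \<phi> = G \<phi> - inner f (cls \<phi>))"

definition z_part :: "'l \<Rightarrow> ('a \<Rightarrow> real) \<Rightarrow> 'l" where
  "z_part f g = perp f - S_inv (D g)"

definition canonical_rep :: "'l \<Rightarrow> ('a \<Rightarrow> real) \<Rightarrow> ('a \<Rightarrow> real) \<Rightarrow> 'l \<Rightarrow> bool" where
  "canonical_rep f g u w \<longleftrightarrow>
     f \<in> dom_perp \<and> f = cls g + S_inv (D u) + w \<and>
     g \<in> C \<and> z_part f g \<in> ker_perp \<and> w \<in> ker_perp \<and>
     weak_solution (z_part f g)
       (\<lambda>\<phi>. normal_part (S f) \<phi> - normal_part b (\<lambda>x. g x * \<phi> x)) u"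

definition H_tilde :: "(('a, real) poly_mapping \<times> 'l) set" where
  "H_tilde = {(F, h). Poly_Mapping.keys F \<subseteq> B \<and> h \<in> ker_perp}"

definition ip :: "('a, real) poly_mapping \<times> 'l \<Rightarrow> ('a, real) poly_mapping \<times> 'l \<Rightarrow> real" where
  "ip F1 F2 = (\<Sum>q\<in>B. Poly_Mapping.lookup (fst F1) q * Poly_Mapping.lookup (fst F2) q)
     + inner (snd F1) (snd F2)"

definition H :: "(('a, real) poly_mapping \<times> 'l) set" where
  "H = {F \<in> H_tilde. \<forall>K\<in>Real_Vector_Spaces.span {(on_B (\<lambda>q. 1), - cls (\<lambda>x. 1))}. ip F K = 0}"

definition P :: "('a, real) poly_mapping \<times> 'l \<Rightarrow> ('a, real) poly_mapping \<times> 'l" where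
  "P F = (THE K. K \<in> H \<and> (\<forall>L\<in>H. ip (F - K) L = 0))"

text \<open>These are proper definite descriptions: the values do not depend on the choice of the
  canonical representation.\<close>

definition G_minus :: "'l \<Rightarrow> ('a, real) poly_mapping \<times> 'l" where
  "G_minus f = (THE F. \<exists>g u w. canonical_rep f g u w \<and>
     F = (1 / sqrt 2) *\<^sub>R P (on_B g + normal_values (S f), w + z_part f g))"

definition G_plus :: "'l \<Rightarrow> ('a, real) poly_mapping \<times> 'l" where
  "G_plus f = (THE F. \<exists>g u w. canonical_rep f g u w \<and>
     F = (1 / sqrt 2) *\<^sub>R P (on_B g - normal_values (S f), w - z_part f g))"

end

end

theory Submission
  imports Defs "Jordan_Normal_Form.DL_Rank_Submatrix"
begin

text \<open>Bounded Borel functions are the closure of the bounded continuous ones under bounded pointwise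
  limits, and by induction along this closure the energy measures of vector fields arise as bounded
  bilinear forms on \<open>H\<close>.  In dimension one the Gram matrices of densities have rank one, so a field
  orthogonal to all \<open>\<phi> b\<close> vanishes and \<open>\<star>\<^sub>b\<close> is onto.  Completeness makes \<open>\<partial>(C)\<close> closed; applied
  to \<open>f (1 - f\<^sup>2)\<^sup>n\<close> this shows that energy measures do not charge points, whence \<open>C\<^sub>B\<close> is dense
  in \<open>L\<^sup>2\<close>.

  For \<open>f = g + \<partial>u + w\<close> in canonical representation one has \<open>\<partial>\<^sub>B\<^sup>\<bottom> f = \<partial>g + z\<close>, where \<open>w\<close> and \<open>z\<close> are
  orthogonal to all gradients, and integrating by parts gives
  \<open>\<langle>\<partial>\<^sub>B\<^sup>\<bottom> f, f\<rangle> = \<langle>g, n\<rangle> + \<langle>w, z\<rangle>\<close> with the normal part \<open>n\<close>; polarising the products as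
  differences of squares gives the boundary form.  Testing with constants yields \<open>\<Sum> n = \<langle>z, 1\<rangle>\<close>, so
  the projection along \<open>(1, -1)\<close> does not change this difference.  Conversely, given \<open>g\<close>, \<open>n\<close>, \<open>w\<close>
  and \<open>z\<close> subject to that relation, the Riesz theorem in the Hilbert space \<open>\<partial>(C)\<close> solves the Neumann
  problem for \<open>u\<close>, so \<open>G\<^sub>-\<close> and \<open>G\<^sub>+\<close> are jointly onto.\<close>

section \<open>Finite signed measures\<close>

text \<open>The spaces \<open>'h\<close> and \<open>'l\<close> are known only through the maps
  \<open>\<iota>\<close> and \<open>cls\<close>, and the action, the energy measures of fields and
  the map \<open>star\<close> are definite descriptions on them. Each has to be constructed by
  bounded extension from a dense set and shown to be unique before anything can be said about it.
  The obstacle is positivity: in the Hilbert space only squares of continuous integrands are visibly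
  nonnegative, so bounds for indicators have to be carried there through pointwise limits. Measures
  are therefore handled as functionals of the integrand.

  The functions f (1 - f^2)^n are chosen because only sums and products are available for computing
  gradients; their derivatives in f stay bounded by 3 for all n.

  Dimension one enters through a single minor: for densities \<gamma> with respect to a minimal
  energy-dominant measure, \<gamma>(v,v) \<gamma>(b,b) = \<gamma>(v,b)^2, and \<gamma>(b,b) vanishes
  almost nowhere since b is energy-dominant.\<close>

lemma signed_measure_sums:
  assumes "signed_measure \<sigma>" "\<And>n::nat. A n \<in> sets borel" "disjoint_family A"
  shows "(\<lambda>n. \<sigma> (A n)) sums \<sigma> (\<Union>n. A n)"
  using assms unfolding signed_measure_def by blast

text \<open>The constant sequence of empty sets is disjoint, and a constant series converges only if
  its term is 0.\<close>

lemma signed_measure_empty: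
  assumes "signed_measure \<sigma>"
  shows "\<sigma> {} = 0"
proof -
  have "(\<lambda>n::nat. \<sigma> {}) sums \<sigma> (\<Union>n::nat. {})"
    by (rule signed_measure_sums[OF assms]) (auto simp: disjoint_family_on_def)
  then have "(\<lambda>n::nat. \<sigma> {}) \<longlonglongrightarrow> 0"
    by (intro summable_LIMSEQ_zero) (rule sums_summable)
  then show ?thesis
    by (simp add: LIMSEQ_const_iff)
qed

lemma signed_measure_Un:
  assumes "signed_measure \<sigma>" "A \<in> sets borel" "A' \<in> sets borel" "A \<inter> A' = {}"
  shows "\<sigma> (A \<union> A') = \<sigma> A + \<sigma> A'"
proof -
  have "(\<lambda>n. \<sigma> (binaryset A A' n)) sums \<sigma> (\<Union>n. binaryset A A' n)"
    using assms by (intro signed_measure_sums) (auto simp: disjoint_family_on_def binaryset_def)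
  moreover have "(\<lambda>n. \<sigma> (binaryset A A' n)) sums (\<sigma> A + \<sigma> A')"
    by (rule binaryset_sums[of \<sigma>]) (rule signed_measure_empty[OF assms(1)])
  ultimately show ?thesis
    by (metis UN_binaryset_eq sums_unique2)
qed

lemma signed_measure_Diff:
  assumes "signed_measure \<sigma>" "A \<in> sets borel" "A' \<in> sets borel" "A' \<subseteq> A"
  shows "\<sigma> (A - A') = \<sigma> A - \<sigma> A'"
proof -
  have "\<sigma> (A' \<union> (A - A')) = \<sigma> A' + \<sigma> (A - A')"
    using assms by (intro signed_measure_Un) auto
  then show ?thesis
    using assms(4) by (simp add: Un_absorb1)
qed

lemma signed_measure_uminus:
  assumes "signed_measure \<sigma>"
  shows "signed_measure (\<lambda>A. - \<sigma> A)"
  using assms unfolding signed_measure_def by (auto intro: sums_minus)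

text \<open>If \<open>\<sigma>\<close> were unbounded above, one could choose a decreasing sequence of sets along which
  \<open>\<bar>\<sigma>\<bar>\<close> tends to infinity, contradicting continuity from above.\<close>

lemma signed_measure_bounded_above:
  assumes \<sigma>: "signed_measure \<sigma>"
  shows "\<exists>K. \<forall>A\<in>sets borel. \<sigma> A \<le> K"
proof (rule ccontr)
  assume contr: "\<not> ?thesis"
  define ub where "ub A \<longleftrightarrow> (\<exists>K. \<forall>E\<in>sets borel. E \<subseteq> A \<longrightarrow> \<sigma> E \<le> K)" for A
  have step: "\<exists>A'\<subseteq>A. A' \<in> sets borel \<and> \<not> ub A' \<and> \<bar>\<sigma> A'\<bar> \<ge> real n"
    if A: "A \<in> sets borel" "\<not> ub A" for A n
  proof -
    \<comment> \<open>The surplus |\<sigma>(A)| gives both \<open>E\<close> and \<open>A - E\<close>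
      an absolute value of at least \<open>n\<close>, so whichever of them fails \<open>ub\<close>
      can be kept.\<close>
    have "\<not> (\<forall>E\<in>sets borel. E \<subseteq> A \<longrightarrow> \<sigma> E \<le> real n + \<bar>\<sigma> A\<bar>)"
      using A(2) unfolding ub_def by simp
    then obtain E where E: "E \<in> sets borel" "E \<subseteq> A" "\<sigma> E > real n + \<bar>\<sigma> A\<bar>"
      by (auto simp: not_le)
    have d: "\<sigma> (A - E) = \<sigma> A - \<sigma> E"
      by (rule signed_measure_Diff[OF \<sigma> A(1) E(1,2)])
    show ?thesis
    proof (cases "ub E")
      case False
      then show ?thesis using E by (intro exI[of _ E]) auto
    next
      case True
      have "\<not> ub (A - E)"
      proof
        assume "ub (A - E)"
        with True obtain K1 K2 where K: "\<forall>F\<in>sets borel. F \<subseteq> E \<longrightarrow> \<sigma> F \<le> K1"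
          "\<forall>F\<in>sets borel. F \<subseteq> A - E \<longrightarrow> \<sigma> F \<le> K2" unfolding ub_def by blast
        have "\<sigma> F \<le> K1 + K2" if F: "F \<in> sets borel" "F \<subseteq> A" for F
        proof -
          have "\<sigma> ((F \<inter> E) \<union> (F - E)) = \<sigma> (F \<inter> E) + \<sigma> (F - E)"
            using F E by (intro signed_measure_Un[OF \<sigma>]) auto
          moreover have "\<sigma> (F \<inter> E) \<le> K1" "\<sigma> (F - E) \<le> K2" using K(1)[rule_format, of "F \<inter> E"] K(2)[rule_format, of "F - E"] F E(1) by auto
          moreover have "(F \<inter> E) \<union> (F - E) = F" by auto
          ultimately show ?thesis by simp
        qed
        then have "ub A" unfolding ub_def by (intro exI[of _ "K1 + K2"]) simp
        with A(2) show False by simp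
      qed
      then show ?thesis using E(1,3) A(1) d by (intro exI[of _ "A - E"]) simp
    qed
  qed
  have "\<exists>A. \<forall>n::nat. (A n \<in> sets borel \<and> \<not> ub (A n)) \<and> (A (Suc n) \<subseteq> A n \<and> \<bar>\<sigma> (A (Suc n))\<bar> \<ge> real n)"
  proof (rule dependent_nat_choice)
    show "\<exists>A. A \<in> sets borel \<and> \<not> ub A"
    proof (intro exI conjI)
      show "UNIV \<in> sets borel" by simp
      show "\<not> ub UNIV" using contr unfolding ub_def by simp
    qed
  next
    fix A :: "'a set" and n :: nat
    assume "A \<in> sets borel \<and> \<not> ub A"
    then obtain A' where "A' \<subseteq> A" "A' \<in> sets borel" "\<not> ub A'" "\<bar>\<sigma> A'\<bar> \<ge> real n"
      using step[of A n] by blast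
    then show "\<exists>A'. (A' \<in> sets borel \<and> \<not> ub A') \<and> A' \<subseteq> A \<and> \<bar>\<sigma> A'\<bar> \<ge> real n"
      by (intro exI[of _ A']) simp
  qed
  then obtain A where A: "\<And>n. A n \<in> sets borel" "\<And>n. A (Suc n) \<subseteq> A n"
    "\<And>n. \<bar>\<sigma> (A (Suc n))\<bar> \<ge> real n" by metis
  have dec: "A n \<subseteq> A m" if "m \<le> n" for m n
    using that by (rule lift_Suc_antimono_le[of A, OF A(2)])
  \<comment> \<open>Additivity over the disjoint shells \<open>A n - A (Suc n)\<close> telescopes,
    so \<open>\<sigma> (A n)\<close> would have to converge.\<close>
  have disj: "disjoint_family (\<lambda>n. A n - A (Suc n))"
    unfolding disjoint_family_on_def
  proof (intro ballI impI)
    fix m n :: nat assume "m \<noteq> n"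
    then consider "Suc m \<le> n" | "Suc n \<le> m" by linarith
    then show "(A m - A (Suc m)) \<inter> (A n - A (Suc n)) = {}"
      using dec[of "Suc m" n] dec[of "Suc n" m] by cases auto
  qed
  have "summable (\<lambda>n. \<sigma> (A n - A (Suc n)))"
    using signed_measure_sums[OF \<sigma> _ disj] A(1) by (auto simp: sums_iff)
  then have "summable (\<lambda>n. \<sigma> (A n) - \<sigma> (A (Suc n)))"
    using signed_measure_Diff[OF \<sigma> A(1) A(1) A(2)] by simp
  then have "convergent (\<lambda>n. \<Sum>i<n. \<sigma> (A i) - \<sigma> (A (Suc i)))"
    by (simp add: summable_iff_convergent)
  moreover have "(\<Sum>i<n. \<sigma> (A i) - \<sigma> (A (Suc i))) = \<sigma> (A 0) - \<sigma> (A n)" for n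
    by (induction n) auto
  ultimately have "convergent (\<lambda>n. \<sigma> (A 0) - \<sigma> (A n))" by simp
  then have "Bseq (\<lambda>n. \<sigma> (A 0) - \<sigma> (A n))" by (rule convergent_imp_Bseq)
  then obtain K where K: "\<And>n. \<bar>\<sigma> (A 0) - \<sigma> (A n)\<bar> \<le> K" unfolding Bseq_def by auto
  obtain n :: nat where "real n > K + \<bar>\<sigma> (A 0)\<bar>" using reals_Archimedean2 by blast
  then show False using K[of "Suc n"] A(3)[of n] by linarith
qed

text \<open>A subset of the union splits along the pieces, which bounds its upper variation by the
  sum. Conversely, subsets of disjoint pieces unite to a competitor for the union, which gives
  superadditivity. Boundedness above keeps every supremum real.\<close>

lemma upper_variation_sums:
  assumes \<sigma>: "signed_measure \<sigma>"
  defines "P \<equiv> \<lambda>A. SUP E\<in>{E \<in> sets borel. E \<subseteq> A}. \<sigma> E"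
  assumes A: "\<And>n::nat. A n \<in> sets borel" "disjoint_family A"
  shows "(\<lambda>n. P (A n)) sums P (\<Union>n. A n)"
proof -
  obtain K where "\<forall>E\<in>sets borel. \<sigma> E \<le> K"
    using signed_measure_bounded_above[OF \<sigma>] by (rule exE)
  then have K: "\<And>E. E \<in> sets borel \<Longrightarrow> \<sigma> E \<le> K" by simp
  have bdd: "bdd_above (\<sigma> ` {E \<in> sets borel. E \<subseteq> F})" for F
    using K by (intro bdd_aboveI2[of _ _ K]) auto
  have up: "\<sigma> E \<le> P F" if "E \<in> sets borel" "E \<subseteq> F" for E F
    unfolding P_def by (rule cSUP_upper[OF _ bdd]) (use that in auto)
  have least: "P F \<le> c" if "\<And>E. E \<in> sets borel \<Longrightarrow> E \<subseteq> F \<Longrightarrow> \<sigma> E \<le> c" for F c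
    unfolding P_def by (rule cSUP_least) (use that in auto)
  have nonneg: "0 \<le> P F" for F
    using up[of "{}" F] signed_measure_empty[OF \<sigma>] by auto
  have mono: "P F \<le> P F'" if "F \<subseteq> F'" for F F'
    by (rule least, rule up) (use that in auto)
  have add: "P F + P F' \<le> P (F \<union> F')" if "F \<inter> F' = {}" for F F'
  proof -
    have "P F \<le> P (F \<union> F') - P F'"
    proof (rule least)
      fix E assume E: "E \<in> sets borel" "E \<subseteq> F"
      have "P F' \<le> P (F \<union> F') - \<sigma> E"
      proof (rule least)
        fix E' assume E': "E' \<in> sets borel" "E' \<subseteq> F'"
        have "\<sigma> (E \<union> E') = \<sigma> E + \<sigma> E'"
          using E E' that by (intro signed_measure_Un[OF \<sigma>]) auto
        moreover have "\<sigma> (E \<union> E') \<le> P (F \<union> F')" using E E' by (intro up) auto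
        ultimately show "\<sigma> E' \<le> P (F \<union> F') - \<sigma> E" by simp
      qed
      then show "\<sigma> E \<le> P (F \<union> F') - P F'" by simp
    qed
    then show ?thesis by simp
  qed
  have partial: "(\<Sum>i<n. P (A i)) \<le> P (\<Union>i<n. A i)" for n
  proof (induction n)
    case 0
    then show ?case using nonneg by simp
  next
    case (Suc n)
    have "A i \<inter> A n = {}" if "i < n" for i
      using disjoint_family_onD[OF A(2), of i n] that by simp
    then have "(\<Union>i<n. A i) \<inter> A n = {}" by auto
    then have "P (\<Union>i<n. A i) + P (A n) \<le> P ((\<Union>i<n. A i) \<union> A n)" by (rule add)
    moreover have "(\<Union>i<n. A i) \<union> A n = (\<Union>i<Suc n. A i)" by (auto simp: less_Suc_eq)
    ultimately show ?case using Suc by simp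
  qed
  have le: "(\<Sum>i<n. P (A i)) \<le> P (\<Union>n. A n)" for n
    by (rule order_trans[OF partial mono]) auto
  have summ: "summable (\<lambda>n. P (A n))"
    using nonneg le by (intro summableI_nonneg_bounded) auto
  have "P (\<Union>n. A n) \<le> (suminf (\<lambda>n. P (A n)))"
  proof (rule least)
    fix E assume E: "E \<in> sets borel" "E \<subseteq> (\<Union>n. A n)"
    have "(\<lambda>n. \<sigma> (E \<inter> A n)) sums \<sigma> (\<Union>n. E \<inter> A n)"
      using E(1) A by (intro signed_measure_sums[OF \<sigma>]) (auto simp: disjoint_family_on_def)
    moreover have "(\<Union>n. E \<inter> A n) = E" using E by auto
    ultimately have s: "(\<lambda>n. \<sigma> (E \<inter> A n)) sums \<sigma> E" by simp
    then have "\<sigma> E = (suminf (\<lambda>n. \<sigma> (E \<inter> A n)))" by (simp add: sums_iff)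
    also have "\<dots> \<le> (suminf (\<lambda>n. P (A n)))"
      using s summ E(1) A(1) by (intro suminf_le) (auto simp: sums_iff intro!: up)
    finally show "\<sigma> E \<le> (suminf (\<lambda>n. P (A n)))" .
  qed
  moreover have "(suminf (\<lambda>n. P (A n))) \<le> P (\<Union>n. A n)"
    using summ le by (intro suminf_le_const) auto
  ultimately show ?thesis using summ by (simp add: sums_iff)
qed

text \<open>The definition takes its supremum over \<open>ennreal (\<sigma> E)\<close>, where
  negative values become 0. The empty set contributes 0 to the real supremum as well, so the two
  agree, and boundedness above makes the measure finite.\<close>

lemma positive_variation:
  assumes \<sigma>: "signed_measure \<sigma>"
  shows "sets (positive_variation \<sigma>) = sets borel"
    and "finite_measure (positive_variation \<sigma>)"
    and "A \<in> sets borel \<Longrightarrow>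
      measure (positive_variation \<sigma>) A = (SUP E\<in>{E \<in> sets borel. E \<subseteq> A}. \<sigma> E)"
proof -
  define P where "P = (\<lambda>A. SUP E\<in>{E \<in> sets borel. E \<subseteq> A}. \<sigma> E)"
  obtain K where "\<forall>E\<in>sets borel. \<sigma> E \<le> K"
    using signed_measure_bounded_above[OF \<sigma>] by (rule exE)
  then have K: "\<And>E. E \<in> sets borel \<Longrightarrow> \<sigma> E \<le> K" by simp
  have bdd: "bdd_above (\<sigma> ` {E \<in> sets borel. E \<subseteq> F})" for F
    using K by (intro bdd_aboveI2[of _ _ K]) auto
  have up: "\<sigma> E \<le> P F" if "E \<in> sets borel" "E \<subseteq> F" for E F
    unfolding P_def by (rule cSUP_upper[OF _ bdd]) (use that in auto)
  have nonneg: "0 \<le> P F" for F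
    using up[of "{}" F] signed_measure_empty[OF \<sigma>] by auto
  have eP: "(SUP E\<in>{E \<in> sets borel. E \<subseteq> F}. ennreal (\<sigma> E)) = ennreal (P F)" for F
  proof (rule antisym)
    show "(SUP E\<in>{E \<in> sets borel. E \<subseteq> F}. ennreal (\<sigma> E)) \<le> ennreal (P F)"
      by (rule SUP_least) (auto intro!: ennreal_leI up)
    let ?s = "SUP E\<in>{E \<in> sets borel. E \<subseteq> F}. ennreal (\<sigma> E)"
    have "?s \<le> ennreal K" by (rule SUP_least) (auto intro!: ennreal_leI K)
    then have top: "?s < top_class.top" using ennreal_less_top order_le_less_trans by blast
    have "P F \<le> enn2real ?s"
      unfolding P_def
    proof (rule cSUP_least)
      fix E assume E: "E \<in> {E \<in> sets borel. E \<subseteq> F}"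
      have "ennreal (\<sigma> E) \<le> ?s" using E by (rule SUP_upper)
      also have "\<dots> = ennreal (enn2real ?s)" using top by (simp add: less_top)
      finally show "\<sigma> E \<le> enn2real ?s"
        by (cases "0 \<le> \<sigma> E") (auto simp: ennreal_le_iff not_le less_imp_le intro!: order_trans[OF less_imp_le enn2real_nonneg])
    qed auto
    then have "ennreal (P F) \<le> ennreal (enn2real ?s)" by (rule ennreal_leI)
    also have "\<dots> = ?s" using top by (simp add: less_top)
    finally show "ennreal (P F) \<le> ?s" .
  qed
  have sigma: "sigma_sets UNIV (sets borel) = (sets borel :: 'a set set)"
    using sets.sigma_sets_eq[of "borel :: 'a measure"] by simp
  show sets: "sets (positive_variation \<sigma>) = sets borel"
    unfolding positive_variation_def by (simp add: sets_measure_of sigma)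
  have em: "emeasure (positive_variation \<sigma>) A = ennreal (P A)" if "A \<in> sets borel" for A
    unfolding eP[symmetric]
  proof (rule emeasure_measure_of[OF positive_variation_def])
    show "countably_additive (sets (positive_variation \<sigma>))
        (\<lambda>F. SUP E\<in>{E \<in> sets borel. E \<subseteq> F}. ennreal (\<sigma> E))"
      unfolding countably_additive_def sets eP
    proof (intro allI impI)
      fix A :: "nat \<Rightarrow> 'a set" assume A: "range A \<subseteq> sets borel" "disjoint_family A"
      have "(\<lambda>n. P (A n)) sums P (\<Union>n. A n)"
        unfolding P_def by (rule upper_variation_sums[OF \<sigma>]) (use A in auto)
      then show "(suminf (\<lambda>i. ennreal (P (A i)))) = ennreal (P (\<Union>n. A n))"
        by (intro suminf_ennreal_eq nonneg)
    qed
    show "positive (sets (positive_variation \<sigma>))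
        (\<lambda>F. SUP E\<in>{E \<in> sets borel. E \<subseteq> F}. ennreal (\<sigma> E))"
      by (simp add: positive_def signed_measure_empty[OF \<sigma>])
  qed (use that sets in auto)
  show "finite_measure (positive_variation \<sigma>)"
    by (rule finite_measureI) (simp add: em sets_eq_imp_space_eq[OF sets])
  show "A \<in> sets borel \<Longrightarrow>
      measure (positive_variation \<sigma>) A = (SUP E\<in>{E \<in> sets borel. E \<subseteq> A}. \<sigma> E)"
    using em nonneg by (simp add: measure_def P_def)
qed

text \<open>Passing from \<open>E\<close> to \<open>A - E\<close> turns \<sigma>(E) into \<sigma>(A)
  - \<sigma>(E), so it exchanges the suprema for \<open>\<sigma>\<close> and its negative up to the
  constant \<sigma>(A).\<close>

lemma jordan_decomposition:
  assumes \<sigma>: "signed_measure \<sigma>" and A: "A \<in> sets borel"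
  shows "\<sigma> A = measure (positive_variation \<sigma>) A - measure (positive_variation (\<lambda>A. - \<sigma> A)) A"
proof -
  have bdd: "bdd_above (\<tau> ` {E \<in> sets borel. E \<subseteq> A})" if "signed_measure \<tau>" for \<tau> :: "'a set \<Rightarrow> real"
  proof -
    obtain K where "\<forall>E\<in>sets borel. \<tau> E \<le> K"
      using signed_measure_bounded_above[OF \<open>signed_measure \<tau>\<close>] by (rule exE)
    then show ?thesis by (intro bdd_aboveI2[of _ _ K]) auto
  qed
  let ?P = "SUP E\<in>{E \<in> sets borel. E \<subseteq> A}. \<sigma> E"
  let ?N = "SUP E\<in>{E \<in> sets borel. E \<subseteq> A}. - \<sigma> E"
  have "?P \<le> \<sigma> A + ?N"
  proof (rule cSUP_least)
    fix E assume E: "E \<in> {E \<in> sets borel. E \<subseteq> A}"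
    have "- \<sigma> (A - E) \<le> ?N"
      by (rule cSUP_upper[OF _ bdd[OF signed_measure_uminus[OF \<sigma>]]]) (use E A in auto)
    then show "\<sigma> E \<le> \<sigma> A + ?N"
      using signed_measure_Diff[OF \<sigma> A, of E] E by auto
  qed auto
  moreover have "?N \<le> ?P - \<sigma> A"
  proof (rule cSUP_least)
    fix E assume E: "E \<in> {E \<in> sets borel. E \<subseteq> A}"
    have "\<sigma> (A - E) \<le> ?P"
      by (rule cSUP_upper[OF _ bdd[OF \<sigma>]]) (use E A in auto)
    then show "- \<sigma> E \<le> ?P - \<sigma> A"
      using signed_measure_Diff[OF \<sigma> A, of E] E by auto
  qed auto
  ultimately show ?thesis
    using positive_variation(3)[OF \<sigma> A] positive_variation(3)[OF signed_measure_uminus[OF \<sigma>] A] by simp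
qed

section \<open>Functionals on bounded Borel functions\<close>

definition bounded_borel :: "('a::topological_space \<Rightarrow> real) set" where
  "bounded_borel = {f \<in> borel_measurable borel. \<exists>K. \<forall>x. \<bar>f x\<bar> \<le> K}"

lemma bounded_borelI:
  "f \<in> borel_measurable borel \<Longrightarrow> (\<And>x. \<bar>f x\<bar> \<le> K) \<Longrightarrow> f \<in> bounded_borel"
  unfolding bounded_borel_def by blast

lemma bounded_borelE:
  assumes "f \<in> bounded_borel"
  obtains K where "f \<in> borel_measurable borel" "\<And>x. \<bar>f x\<bar> \<le> K"
proof -
  from assms have "f \<in> borel_measurable borel" "\<exists>K. \<forall>x. \<bar>f x\<bar> \<le> K"
    unfolding bounded_borel_def by simp_all
  then obtain K where K: "\<forall>x. \<bar>f x\<bar> \<le> K" by auto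
  show thesis by (rule that[of K]) (use K \<open>f \<in> borel_measurable borel\<close> in auto)
qed

lemma bounded_borel_measurable: "f \<in> bounded_borel \<Longrightarrow> f \<in> borel_measurable borel"
  unfolding bounded_borel_def by blast

lemma bounded_borel_const [intro]: "(\<lambda>x. c) \<in> bounded_borel"
  by (rule bounded_borelI[of _ "\<bar>c\<bar>"]) auto

lemma bounded_borel_indicator [intro]: "A \<in> sets borel \<Longrightarrow> indicator A \<in> bounded_borel"
  by (rule bounded_borelI[of _ 1]) (auto simp: indicator_def)

lemma bounded_borel_add [intro]:
  assumes "f \<in> bounded_borel" "g \<in> bounded_borel"
  shows "(\<lambda>x. f x + g x) \<in> bounded_borel"
proof -
  obtain K1 where 1: "f \<in> borel_measurable borel" "\<And>x. \<bar>f x\<bar> \<le> K1" using bounded_borelE[OF assms(1)] by metis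
  obtain K2 where 2: "g \<in> borel_measurable borel" "\<And>x. \<bar>g x\<bar> \<le> K2" using bounded_borelE[OF assms(2)] by metis
  have "\<bar>f x + g x\<bar> \<le> K1 + K2" for x
    using 1(2)[of x] 2(2)[of x] by linarith
  then show ?thesis
    by (rule bounded_borelI[rotated]) (use 1 2 in auto)
qed

lemma bounded_borel_mult [intro]:
  assumes "f \<in> bounded_borel" "g \<in> bounded_borel"
  shows "(\<lambda>x. f x * g x) \<in> bounded_borel"
proof -
  obtain K1 where 1: "f \<in> borel_measurable borel" "\<And>x. \<bar>f x\<bar> \<le> K1" using bounded_borelE[OF assms(1)] by metis
  obtain K2 where 2: "g \<in> borel_measurable borel" "\<And>x. \<bar>g x\<bar> \<le> K2" using bounded_borelE[OF assms(2)] by metis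
  have "\<bar>f x * g x\<bar> \<le> K1 * K2" for x
    unfolding abs_mult using 1(2)[of x] 2(2)[of x] by (intro mult_mono) auto
  then show ?thesis
    by (rule bounded_borelI[rotated]) (use 1 2 in auto)
qed

lemma bounded_borel_cmult [intro]: "f \<in> bounded_borel \<Longrightarrow> (\<lambda>x. c * f x) \<in> bounded_borel"
  using bounded_borel_mult[OF bounded_borel_const] .

lemma bounded_borel_diff [intro]:
  "f \<in> bounded_borel \<Longrightarrow> g \<in> bounded_borel \<Longrightarrow> (\<lambda>x. f x - g x) \<in> bounded_borel"
  using bounded_borel_add[of f "\<lambda>x. -1 * g x"] bounded_borel_cmult[of g "-1"] by simp

lemma bounded_borel_lim:
  assumes "\<And>n. s n \<in> borel_measurable borel" "\<And>n x. \<bar>s n x\<bar> \<le> K" "\<And>x. (\<lambda>n. s n x) \<longlonglongrightarrow> f x"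
  shows "f \<in> bounded_borel"
proof (rule bounded_borelI)
  show "f \<in> borel_measurable borel" by (rule borel_measurable_LIMSEQ_real[OF _ assms(1)]) (rule assms(3))
  show "\<bar>f x\<bar> \<le> K" for x
    by (rule LIMSEQ_le_const2[OF tendsto_rabs[OF assms(3)]]) (use assms(2) in auto)
qed

text \<open>The induction over nonnegative functions is run on the implication from boundedness to
  \<open>P\<close>: a bound on a sum or on an increasing limit passes to its parts, so it need not
  be built into the induction itself. Functions of both signs are reached by a shift.\<close>

lemma bounded_borel_induct_indicator [consumes 1, case_names indicator cmult add lim]:
  assumes f: "f \<in> bounded_borel"
    and ind: "\<And>A. A \<in> sets borel \<Longrightarrow> P (indicator A)"
    and cmult: "\<And>f c. f \<in> bounded_borel \<Longrightarrow> P f \<Longrightarrow> P (\<lambda>x. c * f x)"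
    and add: "\<And>f g. f \<in> bounded_borel \<Longrightarrow> P f \<Longrightarrow> g \<in> bounded_borel \<Longrightarrow> P g \<Longrightarrow> P (\<lambda>x. f x + g x)"
    and lim: "\<And>s f K. (\<And>n. s n \<in> borel_measurable borel) \<Longrightarrow> (\<And>n x. \<bar>s n x\<bar> \<le> K) \<Longrightarrow>
      (\<And>n. P (s n)) \<Longrightarrow> (\<And>x. (\<lambda>n. s n x) \<longlonglongrightarrow> f x) \<Longrightarrow> P f"
  shows "P f"
proof -
  obtain K where K: "f \<in> borel_measurable borel" "\<And>x. \<bar>f x\<bar> \<le> K" using bounded_borelE[OF f] by metis
  have nonneg: "(\<exists>C. \<forall>x. u x \<le> C) \<longrightarrow> P u"
    if "u \<in> borel_measurable borel" "\<And>x. 0 \<le> u x" for u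
    using that
  proof (induct rule: borel_measurable_induct_real)
    case (set A)
    then show ?case by (simp add: ind)
  next
    case (mult w c)
    show ?case
    proof
      assume "\<exists>C. \<forall>x. c * w x \<le> C"
      then obtain C where C: "\<And>x. c * w x \<le> C" by blast
      show "P (\<lambda>x. c * w x)"
      \<comment> \<open>For c = 0 a bound on \<open>c * w\<close> says nothing about
        \<open>w\<close>; the zero function is then treated as the indicator of the empty
        set.\<close>
      proof (cases "c = 0")
        case True
        then show ?thesis
          using ind[of "{}"] by (simp add: indicator_def[abs_def])
      next
        case False
        then have b: "w x \<le> C / c" for x
          using mult(1) C[of x] by (simp add: field_simps)
        then have "w \<in> bounded_borel"
          using mult(2,3) by (intro bounded_borelI[of _ "C / c"]) auto
        moreover have "P w" using mult(4) b by auto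
        ultimately show ?thesis by (rule cmult)
      qed
    qed
  next
    case (add w v)
    show ?case
    proof
      assume "\<exists>C. \<forall>x. v x + w x \<le> C"
      then obtain C where C: "\<And>x. v x + w x \<le> C" by blast
      have b: "w x \<le> C" "v x \<le> C" for x
        using C[of x] add(2)[of x] add(5)[of x] by auto
      then have "w \<in> bounded_borel" "v \<in> bounded_borel"
        using add(1,2,4,5) by (auto intro!: bounded_borelI[of _ C])
      moreover have "P w" "P v" using add(3,7) b by auto
      ultimately show "P (\<lambda>x. v x + w x)" by (intro assms(4))
    qed
  next
    case (seq U)
    then have lim': "\<And>x. (\<lambda>i. U i x) \<longlonglongrightarrow> u x" by simp
    show ?case
    proof
      assume "\<exists>C. \<forall>x. u x \<le> C"
      then obtain C where C: "\<And>x. u x \<le> C" by blast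
      have "U i x \<le> u x" for i x
        using seq(4) lim'[of x] by (intro incseq_le[of "\<lambda>i. U i x"]) (auto simp: incseq_def le_fun_def)
      then have b: "U i x \<le> C" for i x using C order_trans by metis
      show "P u"
      proof (rule lim)
        show "\<bar>U n x\<bar> \<le> C" for n x using b seq(2) by auto
        show "P (U n)" for n using seq(3)[of n] b by (meson)
      qed (use seq(1) lim' in auto)
    qed
  qed
  \<comment> \<open>Adding \<open>K\<close> makes the function nonnegative; the constant is removed
    again as a multiple of \<open>indicator UNIV\<close>.\<close>
  have b: "0 \<le> f x + K" "f x + K \<le> K + K" for x
    using K(2)[of x] by (auto simp: abs_le_iff)
  have p1: "P (\<lambda>x. f x + K)"
  proof (rule nonneg[THEN mp])
    show "\<exists>C. \<forall>x. f x + K \<le> C" using b(2) by (intro exI[of _ "K + K"]) simp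
  qed (use K(1) b(1) in auto)
  have p2: "P (\<lambda>x. - K * indicator UNIV x)"
    by (rule cmult[OF bounded_borel_indicator ind]) auto
  have "P (\<lambda>x. (f x + K) + - K * indicator UNIV x)"
    using f by (intro add[OF _ p1 _ p2] bounded_borel_add[OF f] bounded_borel_const bounded_borel_cmult bounded_borel_indicator) auto
  then show ?thesis by simp
qed

text \<open>The closure of the bounded continuous functions under bounded pointwise limits is an algebra,
  so its indicator functions form a \<open>\<sigma>\<close>-algebra containing the open sets.\<close>

inductive_set baire_class :: "('a::metric_space \<Rightarrow> real) set" where
  continuous: "continuous_on UNIV f \<Longrightarrow> (\<And>x. \<bar>f x\<bar> \<le> K) \<Longrightarrow> f \<in> baire_class"
| lim: "(\<And>n::nat. s n \<in> baire_class) \<Longrightarrow> (\<And>n x. \<bar>s n x\<bar> \<le> K) \<Longrightarrow>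
    (\<And>x. (\<lambda>n. s n x) \<longlonglongrightarrow> f x) \<Longrightarrow> f \<in> baire_class"

lemma baire_class_bounded_borel: "f \<in> baire_class \<Longrightarrow> f \<in> bounded_borel"
proof (induction rule: baire_class.induct)
  case (continuous f K)
  then show ?case by (intro bounded_borelI) (auto intro: borel_measurable_continuous_onI)
next
  case (lim s K f)
  show ?case
    by (rule bounded_borel_lim[OF _ lim(2,3)]) (simp add: bounded_borel_measurable lim(4))
qed

text \<open>The induction runs in one argument while the other is fixed, once with a continuous
  partner and once with an arbitrary one. Commutativity of \<open>h\<close> lets the same step serve
  both arguments; \<open>bdd\<close> gives the uniform bound that the limit rule demands.\<close>

lemma baire_class_combine:
  fixes h :: "real \<Rightarrow> real \<Rightarrow> real"
  assumes cont: "\<And>f g :: 'a::metric_space \<Rightarrow> real. continuous_on UNIV f \<Longrightarrow> continuous_on UNIV g \<Longrightarrow>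
      continuous_on UNIV (\<lambda>x. h (f x) (g x))"
    and comm: "\<And>s t. h s t = h t s"
    and lim: "\<And>s t u. (\<lambda>n. s n) \<longlonglongrightarrow> t \<Longrightarrow> (\<lambda>n. h (s n) u) \<longlonglongrightarrow> h t u"
    and bdd: "\<And>K L. \<exists>M. \<forall>s t. \<bar>s\<bar> \<le> K \<longrightarrow> \<bar>t\<bar> \<le> L \<longrightarrow> \<bar>h s t\<bar> \<le> M"
    and f: "f \<in> baire_class" and g: "g \<in> baire_class"
  shows "(\<lambda>x::'a. h (f x) (g x)) \<in> baire_class"
proof -
  have step: "(\<lambda>x. h (f x) (g x)) \<in> baire_class"
    if f: "f \<in> baire_class" and g: "g \<in> baire_class"
      and c: "\<And>u. continuous_on UNIV u \<Longrightarrow> bounded (range u) \<Longrightarrow> (\<lambda>x. h (u x) (g x)) \<in> baire_class"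
    for f g :: "'a \<Rightarrow> real"
    using f
  proof (induction rule: baire_class.induct)
    case (continuous f K)
    then show ?case by (intro c) (auto simp: bounded_iff)
  next
    case (lim s K f)
    obtain L where L: "\<And>x. \<bar>g x\<bar> \<le> L" using bounded_borelE[OF baire_class_bounded_borel[OF g]] by metis
    obtain M where M: "\<forall>s t. \<bar>s\<bar> \<le> K \<longrightarrow> \<bar>t\<bar> \<le> L \<longrightarrow> \<bar>h s t\<bar> \<le> M"
      using bdd[of K L] by (rule exE)
    show ?case
    proof (rule baire_class.lim[of "\<lambda>n x. h (s n x) (g x)" M])
      show "(\<lambda>n. h (s n x) (g x)) \<longlonglongrightarrow> h (f x) (g x)" for x
        by (rule assms(3)) (rule lim)
    qed (use lim L M in simp_all)
  qed
  have 1: "(\<lambda>x. h (f x) (g x)) \<in> baire_class"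
    if f: "f \<in> baire_class" and g: "continuous_on UNIV g" "bounded (range g)" for f g :: "'a \<Rightarrow> real"
  proof (rule step[OF f])
    obtain L where L: "\<And>x. \<bar>g x\<bar> \<le> L" using g(2) by (auto simp: bounded_iff)
    then show "g \<in> baire_class" using g(1) by (intro baire_class.continuous)
    fix u :: "'a \<Rightarrow> real" assume u: "continuous_on UNIV u" "bounded (range u)"
    obtain K where K: "\<And>x. \<bar>u x\<bar> \<le> K" using u(2) by (auto simp: bounded_iff)
    obtain M where M: "\<forall>s t. \<bar>s\<bar> \<le> K \<longrightarrow> \<bar>t\<bar> \<le> L \<longrightarrow> \<bar>h s t\<bar> \<le> M"
      using bdd[of K L] by (rule exE)
    show "(\<lambda>x. h (u x) (g x)) \<in> baire_class"
      by (rule baire_class.continuous[OF cont[OF u(1) g(1)], of M]) (use K L M in simp)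
  qed
  show ?thesis
    by (rule step[OF f g]) (use 1[OF g] comm in simp)
qed

lemma baire_class_add:
  "f \<in> baire_class \<Longrightarrow> g \<in> baire_class \<Longrightarrow> (\<lambda>x. f x + g x) \<in> baire_class"
proof (rule baire_class_combine[of "(+)"])
  show "\<exists>M. \<forall>s t. \<bar>s\<bar> \<le> K \<longrightarrow> \<bar>t\<bar> \<le> L \<longrightarrow> \<bar>s + t\<bar> \<le> M" for K L :: real
    by (rule exI[of _ "K + L"]) auto
qed (auto intro!: continuous_intros tendsto_intros)

lemma baire_class_mult:
  "f \<in> baire_class \<Longrightarrow> g \<in> baire_class \<Longrightarrow> (\<lambda>x. f x * g x) \<in> baire_class"
proof (rule baire_class_combine[of "(*)"])
  show "\<exists>M. \<forall>s t. \<bar>s\<bar> \<le> K \<longrightarrow> \<bar>t\<bar> \<le> L \<longrightarrow> \<bar>s * t\<bar> \<le> M" for K L :: real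
    by (rule exI[of _ "K * L"]) (auto simp: abs_mult intro!: mult_mono)
qed (auto intro!: continuous_intros tendsto_intros)

lemma baire_class_const: "(\<lambda>x. c) \<in> baire_class"
  by (rule baire_class.continuous[of _ "\<bar>c\<bar>"]) auto

text \<open>Truncated multiples of the distance to the closed complement converge to the indicator.
  The whole space is separated off because \<open>infdist\<close> to the empty set is 0 by
  convention.\<close>

lemma baire_class_indicator_open:
  assumes "open U"
  shows "indicator U \<in> (baire_class :: ('a::metric_space \<Rightarrow> real) set)"
proof (cases "U = UNIV")
  case True
  then show ?thesis using baire_class_const[of 1] by (simp add: indicator_def[abs_def])
next
  case False
  show ?thesis
  proof (rule baire_class.lim[of "\<lambda>n x. min 1 (real n * infdist x (- U))" 1])
    show "(\<lambda>x. min 1 (real n * infdist x (- U))) \<in> baire_class" for n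
      by (rule baire_class.continuous[of _ 1]) (auto intro!: continuous_intros simp: infdist_nonneg)
    show "\<bar>min 1 (real n * infdist x (- U))\<bar> \<le> 1" for n x
      by (auto simp: infdist_nonneg)
    show "(\<lambda>n. min 1 (real n * infdist x (- U))) \<longlonglongrightarrow> indicator U x" for x
    proof (cases "x \<in> U")
      case True
      have "closed (- U)" using assms by auto
      then have pos: "infdist x (- U) > 0"
        using True False by (intro infdist_pos_not_in_closed) auto
      obtain N :: nat where N: "real N * infdist x (- U) > 1"
        using reals_Archimedean3[OF pos] by blast
      have min1: "min 1 (real n * infdist x (- U)) = 1" if "n \<ge> N" for n
        using N mult_right_mono[of "real N" "real n" "infdist x (- U)"] that pos by linarith
      then have "\<forall>\<^sub>F n in sequentially. min 1 (real n * infdist x (- U)) = 1"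
        unfolding eventually_sequentially using min1 by (intro exI[of _ N]) simp
      then show ?thesis using True by (simp add: tendsto_eventually)
    qed simp
  qed
qed

lemma bounded_borel_baire_class:
  assumes "f \<in> bounded_borel"
  shows "f \<in> (baire_class :: ('a::metric_space \<Rightarrow> real) set)"
  using assms
proof (induction rule: bounded_borel_induct_indicator)
  case (indicator A)
  have compl: "indicator (- A) \<in> baire_class" if "indicator A \<in> (baire_class :: ('a \<Rightarrow> real) set)" for A
  proof -
    have "(\<lambda>x. 1 + (-1) * indicator A x) \<in> (baire_class :: ('a \<Rightarrow> real) set)"
      using that by (intro baire_class_add baire_class_mult baire_class_const)
    also have "(\<lambda>x. 1 + (-1) * indicator A x) = (indicator (- A) :: 'a \<Rightarrow> real)"
      by (auto simp: indicator_def)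
    finally show ?thesis .
  qed
  have int: "indicator (A \<inter> A') \<in> (baire_class :: ('a \<Rightarrow> real) set)"
    if "indicator A \<in> (baire_class :: ('a \<Rightarrow> real) set)" "indicator A' \<in> (baire_class :: ('a \<Rightarrow> real) set)" for A A'
    using baire_class_mult[OF that] by (simp add: indicator_inter_arith[abs_def])
  have "A \<in> sigma_sets UNIV {S. open S}"
    using indicator by (simp add: borel_def)
  then show ?case
  proof (induction rule: sigma_sets.induct)
    case (Basic a)
    then show ?case by (simp add: baire_class_indicator_open)
  next
    case Empty
    show ?case by (rule baire_class_indicator_open) auto
  next
    case (Compl a)
    then show ?case using compl[of a] by (simp add: Compl_eq_Diff_UNIV)
  next
    \<comment> \<open>Complements turn the union into an intersection, whose finite stages are
      products of indicators and converge boundedly.\<close>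
    case (Union a)
    have fin: "indicator (\<Inter>i<n. - a i) \<in> (baire_class :: ('a \<Rightarrow> real) set)" for n
    proof (induction n)
      case 0
      then show ?case using baire_class_indicator_open[of UNIV] by simp
    next
      case (Suc n)
      then have "indicator (- a n \<inter> (\<Inter>i<n. - a i)) \<in> (baire_class :: ('a \<Rightarrow> real) set)"
        by (intro int compl Union)
      then show ?case by (simp add: lessThan_Suc)
    qed
    have "indicator (\<Inter>i. - a i) \<in> (baire_class :: ('a \<Rightarrow> real) set)"
    proof (rule baire_class.lim[of "\<lambda>n. indicator (\<Inter>i<n. - a i)" 1, OF fin])
      show "(\<lambda>n. indicator (\<Inter>i<n. - a i) x :: real) \<longlonglongrightarrow> indicator (\<Inter>i. - a i) x" for x
      proof (cases "x \<in> (\<Inter>i. - a i)")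
        case True
        then show ?thesis by (simp add: indicator_def)
      next
        case False
        then obtain i where "x \<in> a i" by auto
        then have ind0: "indicator (\<Inter>i<n. - a i) x = (0::real)" if "n > i" for n
          using that by (auto simp: indicator_def)
        then have "\<forall>\<^sub>F n in sequentially. indicator (\<Inter>i<n. - a i) x = (0::real)"
          by (intro eventually_mono[OF eventually_gt_at_top[of i]] ind0)
        then show ?thesis using False by (simp add: tendsto_eventually)
      qed
    qed (auto simp: indicator_def)
    then show ?case using compl[of "\<Inter>i. - a i"] by (simp add: Compl_INT)
  qed
next
  case (cmult f c)
  then show ?case by (intro baire_class_mult baire_class_const)
next
  case (add f g)
  then show ?case by (intro baire_class_add)
next
  case (lim s f K)
  show ?case by (rule baire_class.lim[of s K f]) (use lim in simp_all)
qed

text \<open>Statements known for continuous integrands, where multiplication acts on the Hilbert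
  space, pass by this induction to indicators of Borel sets.\<close>

lemma bounded_borel_induct [consumes 1, case_names continuous lim]:
  fixes f :: "'a::metric_space \<Rightarrow> real"
  assumes f: "f \<in> bounded_borel"
    and cont: "\<And>f K. continuous_on UNIV f \<Longrightarrow> (\<And>x. \<bar>f x\<bar> \<le> K) \<Longrightarrow> P f"
    and lim: "\<And>s f K. (\<And>n. s n \<in> borel_measurable borel) \<Longrightarrow> (\<And>n x. \<bar>s n x\<bar> \<le> K) \<Longrightarrow>
      (\<And>n. P (s n)) \<Longrightarrow> (\<And>x. (\<lambda>n. s n x) \<longlonglongrightarrow> f x) \<Longrightarrow> P f"
  shows "P f"
  using bounded_borel_baire_class[OF f]
proof (induction rule: baire_class.induct)
  case (continuous f K)
  then show ?case by (rule cont)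
next
  case (lim s K f)
  show ?case
    by (rule assms(3)[OF _ lim(2) _ lim(3)])
      (simp_all add: lim bounded_borel_measurable baire_class_bounded_borel)
qed

text \<open>Integration against a finite signed measure, seen from the side of the integrand. This
  form is preserved by linear combinations and weights at once, whereas Jordan decompositions do not
  follow such operations.\<close>

definition sigma_functional :: "(('a::topological_space \<Rightarrow> real) \<Rightarrow> real) \<Rightarrow> bool" where
  "sigma_functional L \<longleftrightarrow>
    (\<forall>f\<in>bounded_borel. \<forall>g\<in>bounded_borel. L (\<lambda>x. f x + g x) = L f + L g) \<and>
    (\<forall>f\<in>bounded_borel. \<forall>c. L (\<lambda>x. c * f x) = c * L f) \<and>
    (\<forall>s f K. (\<forall>n::nat. s n \<in> borel_measurable borel) \<longrightarrow> (\<forall>n x. \<bar>s n x\<bar> \<le> K) \<longrightarrow>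
      (\<forall>x. (\<lambda>n. s n x) \<longlonglongrightarrow> f x) \<longrightarrow> (\<lambda>n. L (s n)) \<longlonglongrightarrow> L f)"

lemma sigma_functional_add:
  "sigma_functional L \<Longrightarrow> f \<in> bounded_borel \<Longrightarrow> g \<in> bounded_borel \<Longrightarrow> L (\<lambda>x. f x + g x) = L f + L g"
  unfolding sigma_functional_def by blast

lemma sigma_functional_cmult:
  "sigma_functional L \<Longrightarrow> f \<in> bounded_borel \<Longrightarrow> L (\<lambda>x. c * f x) = c * L f"
  unfolding sigma_functional_def by blast

lemma sigma_functional_lim:
  "sigma_functional L \<Longrightarrow> (\<And>n. s n \<in> borel_measurable borel) \<Longrightarrow> (\<And>n x. \<bar>s n x\<bar> \<le> K) \<Longrightarrow>
    (\<And>x. (\<lambda>n. s n x) \<longlonglongrightarrow> f x) \<Longrightarrow> (\<lambda>n. L (s n)) \<longlonglongrightarrow> L f"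
  unfolding sigma_functional_def by blast

lemma sigma_functional_diff:
  assumes "sigma_functional L" "f \<in> bounded_borel" "g \<in> bounded_borel"
  shows "L (\<lambda>x. f x - g x) = L f - L g"
proof -
  have "L (\<lambda>x. f x + -1 * g x) = L f + -1 * L g"
    using assms by (subst sigma_functional_add) (auto simp only: sigma_functional_cmult)
  then show ?thesis by simp
qed

lemma sigma_functional_zero: "sigma_functional L \<Longrightarrow> L (\<lambda>x. 0) = 0"
  using sigma_functional_cmult[of L "\<lambda>x. 0" 0] by auto

lemma sigma_functional_0: "sigma_functional (\<lambda>\<phi>. 0)"
  unfolding sigma_functional_def by auto

lemma sigma_functional_plus:
  assumes L: "sigma_functional L" and L': "sigma_functional L'"
  shows "sigma_functional (\<lambda>\<phi>. L \<phi> + L' \<phi>)"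
  unfolding sigma_functional_def
proof (intro conjI ballI allI impI)
  fix s :: "nat \<Rightarrow> 'a \<Rightarrow> real" and f K
  assume "\<forall>n. s n \<in> borel_measurable borel" "\<forall>n x. \<bar>s n x\<bar> \<le> K" "\<forall>x. (\<lambda>n. s n x) \<longlonglongrightarrow> f x"
  then show "(\<lambda>n. L (s n) + L' (s n)) \<longlonglongrightarrow> L f + L' f"
    by (intro tendsto_add sigma_functional_lim[OF L, of s K f] sigma_functional_lim[OF L', of s K f]) simp_all
qed (simp_all add: sigma_functional_add[OF L] sigma_functional_add[OF L'] sigma_functional_cmult[OF L]
  sigma_functional_cmult[OF L'] distrib_left)

lemma sigma_functional_times:
  assumes L: "sigma_functional L"
  shows "sigma_functional (\<lambda>\<phi>. c * L \<phi>)"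
  unfolding sigma_functional_def
proof (intro conjI ballI allI impI)
  fix s :: "nat \<Rightarrow> 'a \<Rightarrow> real" and f K
  assume "\<forall>n. s n \<in> borel_measurable borel" "\<forall>n x. \<bar>s n x\<bar> \<le> K" "\<forall>x. (\<lambda>n. s n x) \<longlonglongrightarrow> f x"
  then show "(\<lambda>n. c * L (s n)) \<longlonglongrightarrow> c * L f"
    by (intro tendsto_mult_left sigma_functional_lim[OF L, of s K f]) simp_all
qed (simp_all add: sigma_functional_add[OF L] sigma_functional_cmult[OF L] distrib_left)

lemma sigma_functional_minus:
  assumes "sigma_functional L" "sigma_functional L'"
  shows "sigma_functional (\<lambda>\<phi>. L \<phi> - L' \<phi>)"
  using sigma_functional_plus[OF assms(1) sigma_functional_times[OF assms(2), of "-1"]] by simp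

lemma sigma_functional_sum_list:
  assumes "\<And>a. a \<in> set as \<Longrightarrow> sigma_functional (L a)"
  shows "sigma_functional (\<lambda>\<phi>. \<Sum>a\<leftarrow>as. L a \<phi>)"
  using assms by (induction as) (auto intro: sigma_functional_0 sigma_functional_plus)

lemma sigma_functional_weight:
  assumes L: "sigma_functional L" and g: "g \<in> bounded_borel"
  shows "sigma_functional (\<lambda>\<phi>. L (\<lambda>x. \<phi> x * g x))"
  unfolding sigma_functional_def
proof (intro conjI ballI allI impI)
  fix f f' :: "'a \<Rightarrow> real" and c assume f: "f \<in> bounded_borel"
  show "L (\<lambda>x. c * f x * g x) = c * L (\<lambda>x. f x * g x)"
    using sigma_functional_cmult[OF L bounded_borel_mult[OF f g], of c] by (simp add: mult.assoc)
  assume f': "f' \<in> bounded_borel"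
  show "L (\<lambda>x. (f x + f' x) * g x) = L (\<lambda>x. f x * g x) + L (\<lambda>x. f' x * g x)"
    using sigma_functional_add[OF L bounded_borel_mult[OF f g] bounded_borel_mult[OF f' g]]
    by (simp add: distrib_right)
next
  fix s :: "nat \<Rightarrow> 'a \<Rightarrow> real" and f K
  assume s: "\<forall>n. s n \<in> borel_measurable borel" "\<forall>n x. \<bar>s n x\<bar> \<le> K" "\<forall>x. (\<lambda>n. s n x) \<longlonglongrightarrow> f x"
  obtain K' where K': "g \<in> borel_measurable borel" "\<And>x. \<bar>g x\<bar> \<le> K'" using bounded_borelE[OF g] by metis
  have "\<bar>s n x * g x\<bar> \<le> K * K'" for n x
    unfolding abs_mult using s(2) K'(2)[of x] order_trans[OF abs_ge_zero s(2)[rule_format]]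
    by (intro mult_mono) auto
  then show "(\<lambda>n. L (\<lambda>x. s n x * g x)) \<longlonglongrightarrow> L (\<lambda>x. f x * g x)"
    by (rule sigma_functional_lim[OF L, of "\<lambda>n x. s n x * g x" "K * K'", rotated])
      (use s K' in \<open>auto intro!: tendsto_mult_right borel_measurable_times\<close>)
qed

lemma sigma_functional_integral_density:
  fixes h :: "'a::topological_space \<Rightarrow> real"
  assumes h: "integrable M h" and M: "sets M = sets borel"
  shows "sigma_functional (\<lambda>\<phi>. \<integral>x. \<phi> x * h x \<partial>M)"
proof -
  have int: "integrable M (\<lambda>x. f x * h x)" if "f \<in> bounded_borel" for f
  proof -
    obtain K where K: "f \<in> borel_measurable borel" "\<And>x. \<bar>f x\<bar> \<le> K" using bounded_borelE[OF \<open>f \<in> bounded_borel\<close>] by metis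
    have "f \<in> borel_measurable M" using K(1) M by (simp cong: measurable_cong_sets)
    moreover have "\<bar>f x * h x\<bar> \<le> \<bar>K * h x\<bar>" for x
      unfolding abs_mult using K(2)[of x] by (intro mult_right_mono) auto
    ultimately show ?thesis
      using h by (intro Bochner_Integration.integrable_bound[where f = "\<lambda>x. K * h x" and g = "\<lambda>x. f x * h x"] integrable_mult_right) auto
  qed
  show ?thesis
    unfolding sigma_functional_def
  proof (intro conjI ballI allI impI)
    fix f g :: "'a \<Rightarrow> real" and c assume f: "f \<in> bounded_borel"
    show "(\<integral>x. c * f x * h x \<partial>M) = c * (\<integral>x. f x * h x \<partial>M)"
      by (simp add: mult.assoc)
    assume g: "g \<in> bounded_borel"
    show "(\<integral>x. (f x + g x) * h x \<partial>M) = (\<integral>x. f x * h x \<partial>M) + (\<integral>x. g x * h x \<partial>M)"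
      using int[OF f] int[OF g] by (simp add: distrib_right)
  next
    fix s :: "nat \<Rightarrow> 'a \<Rightarrow> real" and f K
    assume s: "\<forall>n. s n \<in> borel_measurable borel" "\<forall>n x. \<bar>s n x\<bar> \<le> K" "\<forall>x. (\<lambda>n. s n x) \<longlonglongrightarrow> f x"
    have m: "s n \<in> borel_measurable M" for n using s(1) M by (simp cong: measurable_cong_sets)
    have f: "f \<in> borel_measurable M"
      by (rule borel_measurable_LIMSEQ_real[OF _ m]) (use s(3) in auto)
    have "\<bar>s n x * h x\<bar> \<le> K * \<bar>h x\<bar>" for n x
      unfolding abs_mult using s(2) by (intro mult_right_mono) auto
    then show "(\<lambda>n. \<integral>x. s n x * h x \<partial>M) \<longlonglongrightarrow> (\<integral>x. f x * h x \<partial>M)"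
      using s(3) m f h
      by (intro integral_dominated_convergence[where w = "\<lambda>x. K * \<bar>h x\<bar>"]) (auto intro!: tendsto_intros)
  qed
qed

lemma sigma_functional_integral:
  assumes "finite_measure M" "sets M = sets borel"
  shows "sigma_functional (\<lambda>\<phi>. \<integral>x. \<phi> x \<partial>M)"
  using sigma_functional_integral_density[of M "\<lambda>x. 1"] assms by (simp add: finite_measure.integrable_const)

lemma sigma_functional_signed_integral:
  assumes "signed_measure \<sigma>"
  shows "sigma_functional (signed_integral \<sigma>)"
  unfolding signed_integral_def[abs_def]
  by (intro sigma_functional_minus sigma_functional_integral positive_variation signed_measure_uminus assms)

lemma signed_integral_indicator:
  assumes "signed_measure \<sigma>" "A \<in> sets borel"
  shows "signed_integral \<sigma> (indicator A) = \<sigma> A"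
  unfolding signed_integral_def jordan_decomposition[OF assms]
  using positive_variation(1)[OF assms(1)] positive_variation(1)[OF signed_measure_uminus[OF assms(1)]]
    assms(2) sets_eq_imp_space_eq[OF positive_variation(1)[OF assms(1)]]
     sets_eq_imp_space_eq[OF positive_variation(1)[OF signed_measure_uminus[OF assms(1)]]]
  by simp

lemma sigma_functional_eq_indicator:
  assumes L: "sigma_functional L" "sigma_functional L'"
    and eq: "\<And>A. A \<in> sets borel \<Longrightarrow> L (indicator A) = L' (indicator A)"
    and f: "f \<in> bounded_borel"
  shows "L f = L' f"
  using f
proof (induction rule: bounded_borel_induct_indicator)
  case (lim s f K)
  have "(\<lambda>n. L (s n)) \<longlonglongrightarrow> L f"
    by (rule sigma_functional_lim[OF L(1), of s K f]) (simp_all add: lim)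
  moreover have "(\<lambda>n. L (s n)) \<longlonglongrightarrow> L' f"
    unfolding lim.IH by (rule sigma_functional_lim[OF L(2), of s K f]) (simp_all add: lim)
  ultimately show ?case by (rule LIMSEQ_unique)
qed (use L eq in \<open>auto simp: sigma_functional_add sigma_functional_cmult\<close>)

text \<open>The functions on which two such functionals agree are closed under bounded pointwise
  limits. Symmetry of \<open>rep_form\<close> and the vanishing of mutual energy measures are
  reduced in this way to identities of scalar products.\<close>

lemma sigma_functional_eq_continuous:
  fixes f :: "'a::metric_space \<Rightarrow> real"
  assumes L: "sigma_functional L" "sigma_functional L'"
    and eq: "\<And>g. continuous_on UNIV g \<Longrightarrow> bounded (range g) \<Longrightarrow> L g = L' g"
    and f: "f \<in> bounded_borel"
  shows "L f = L' f"
  using f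
proof (induction rule: bounded_borel_induct)
  case (lim s f K)
  have "(\<lambda>n. L (s n)) \<longlonglongrightarrow> L f"
    by (rule sigma_functional_lim[OF L(1), of s K f]) (simp_all add: lim)
  moreover have "(\<lambda>n. L (s n)) \<longlonglongrightarrow> L' f"
    unfolding lim.IH by (rule sigma_functional_lim[OF L(2), of s K f]) (simp_all add: lim)
  ultimately show ?case by (rule LIMSEQ_unique)
qed (use eq in \<open>auto simp: bounded_iff\<close>)

text \<open>Squares are stable under bounded pointwise limits, so positivity passes from squares of
  continuous functions to squares of bounded Borel functions, and every nonnegative \<open>f\<close>
  is the square of its root. Squares are the right hypothesis because they produce squared
  norms.\<close>

lemma sigma_functional_nonneg:
  fixes f :: "'a::metric_space \<Rightarrow> real"
  assumes L: "sigma_functional L"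
    and sq: "\<And>g. continuous_on UNIV g \<Longrightarrow> bounded (range g) \<Longrightarrow> 0 \<le> L (\<lambda>x. g x * g x)"
    and f: "f \<in> bounded_borel" "\<And>x. 0 \<le> f x"
  shows "0 \<le> L f"
proof -
  have "0 \<le> L (\<lambda>x. g x * g x)" if "g \<in> bounded_borel" for g
    using that
  proof (induction rule: bounded_borel_induct)
    case (lim s f K)
    have b: "\<bar>s n x * s n x\<bar> \<le> K * K" for n x
      unfolding abs_mult using lim(2) order_trans[OF abs_ge_zero lim(2)] by (intro mult_mono) auto
    have "(\<lambda>n. L (\<lambda>x. s n x * s n x)) \<longlonglongrightarrow> L (\<lambda>x. f x * f x)"
      by (rule sigma_functional_lim[OF L, of "\<lambda>n x. s n x * s n x" "K * K"])
        (use b lim in \<open>auto intro!: tendsto_mult borel_measurable_times\<close>)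
    then show ?case by (rule LIMSEQ_le_const) (simp add: lim.IH)
  qed (use sq in \<open>auto simp: bounded_iff\<close>)
  from this[of "\<lambda>x. sqrt (f x)"] show ?thesis
  proof (rule back_subst[of "\<lambda>x. 0 \<le> L x"])
    obtain K where K: "f \<in> borel_measurable borel" "\<And>x. \<bar>f x\<bar> \<le> K" using bounded_borelE[OF f(1)] by metis
    show "(\<lambda>x. sqrt (f x)) \<in> bounded_borel"
    proof (rule bounded_borelI)
      show "\<bar>sqrt (f x)\<bar> \<le> sqrt K" for x
        using K(2)[of x] f(2)[of x] by simp
    qed (use K in auto)
  qed (use f(2) in auto)
qed

text \<open>Continuity along the increasing finite unions of a disjoint sequence is countable
  additivity. This connects functionals with \<open>as_measure\<close>, the form in which energy
  measures enter the definitions.\<close>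

lemma as_measure_sigma_functional:
  assumes L: "sigma_functional L" and nonneg: "\<And>A. A \<in> sets borel \<Longrightarrow> 0 \<le> L (indicator A)"
  defines "M \<equiv> as_measure (\<lambda>A. L (indicator A))"
  shows "sets M = sets borel"
    and "A \<in> sets borel \<Longrightarrow> emeasure M A = ennreal (L (indicator A))"
    and "finite_measure M"
    and "f \<in> bounded_borel \<Longrightarrow> (\<integral>x. f x \<partial>M) = L f"
proof -
  have sigma: "sigma_sets UNIV (sets borel) = (sets borel :: 'a set set)"
    using sets.sigma_sets_eq[of "borel :: 'a measure"] by simp
  show sets: "sets M = sets borel"
    unfolding M_def as_measure_def by (simp add: sets_measure_of sigma)
  have sp: "space M = UNIV" using sets_eq_imp_space_eq[OF sets] by simp
  show em: "emeasure M A = ennreal (L (indicator A))" if "A \<in> sets borel" for A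
  proof (rule emeasure_measure_of[OF M_def[unfolded as_measure_def, THEN meta_eq_to_obj_eq]])
    have "L (indicator {}) = 0" using sigma_functional_zero[OF L] by (simp add: indicator_def[abs_def])
    then show "positive (sets M) (\<lambda>A. ennreal (L (indicator A)))"
      by (simp add: positive_def)
    show "countably_additive (sets M) (\<lambda>A. ennreal (L (indicator A)))"
      unfolding countably_additive_def sets
    proof (intro allI impI)
      fix A :: "nat \<Rightarrow> 'a set" assume A: "range A \<subseteq> sets borel" "disjoint_family A"
      have part: "(\<Sum>i<n. L (indicator (A i))) = L (indicator (\<Union>i<n. A i))" for n
      proof (induction n)
        case 0
        then show ?case using sigma_functional_zero[OF L] by (simp add: indicator_def[abs_def])
      next
        case (Suc n)
        have "A i \<inter> A n = {}" if "i < n" for i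
          using disjoint_family_onD[OF A(2), of i n] that by simp
        then have "(\<Union>i<n. A i) \<inter> A n = {}" by auto
        then have "(indicator (\<Union>i<Suc n. A i) :: _ \<Rightarrow> real) =
            (\<lambda>x. indicator (\<Union>i<n. A i) x + indicator (A n) x)"
          by (auto simp: indicator_def less_Suc_eq fun_eq_iff)
        moreover have "(\<Union>i<n. A i) \<in> sets borel" using A(1) by auto
        ultimately show ?case
          using Suc A(1) by (simp add: sigma_functional_add[OF L] bounded_borel_indicator range_subsetD)
      qed
      have "(\<lambda>n. L (indicator (\<Union>i<n. A i))) \<longlonglongrightarrow> L (indicator (\<Union>i. A i))"
      proof (rule sigma_functional_lim[OF L, of _ 1])
        show "(\<lambda>n. indicator (\<Union>i<n. A i) x :: real) \<longlonglongrightarrow> indicator (\<Union>i. A i) x" for x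
          by (rule LIMSEQ_indicator_UN)
        show "indicator (\<Union>i<n. A i) \<in> borel_measurable borel" for n
          using A(1) by (intro borel_measurable_indicator) auto
      qed (auto simp: indicator_def)
      then have "(\<lambda>i. L (indicator (A i))) sums L (indicator (\<Union>i. A i))"
        unfolding sums_def part .
      then show "(suminf (\<lambda>i. ennreal (L (indicator (A i))))) = ennreal (L (indicator (\<Union>i. A i)))"
        using A(1) by (intro suminf_ennreal_eq nonneg) auto
    qed
  qed (use that sets in auto)
  show fin: "finite_measure M"
    by (rule finite_measureI) (simp add: em sp)
  show "f \<in> bounded_borel \<Longrightarrow> (\<integral>x. f x \<partial>M) = L f"
  proof (rule sigma_functional_eq_indicator[OF sigma_functional_integral[OF fin sets] L])
    show "(\<integral>x. indicator A x \<partial>M) = L (indicator A)" if "A \<in> sets borel" for A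
      using that nonneg[OF that] by (simp add: sets sp em measure_def)
  qed
qed

section \<open>Dense subspaces and orthogonal projections\<close>

lemma dense_image_sequence:
  assumes "closure (val ` R) = (UNIV :: 'x::metric_space set)"
  obtains r :: "nat \<Rightarrow> 'r" where "\<And>n. r n \<in> R" "(\<lambda>n. val (r n)) \<longlonglongrightarrow> x"
proof -
  have "x \<in> closure (val ` R)" using assms by simp
  then obtain v where v: "\<And>n. v n \<in> val ` R" "v \<longlonglongrightarrow> x" unfolding closure_sequential by auto
  then have "\<forall>n. \<exists>r. r \<in> R \<and> v n = val r" by auto
  then obtain r where r: "\<And>n. r n \<in> R" "\<And>n. v n = val (r n)" by metis
  show thesis by (rule that[of r]) (use r v in \<open>simp_all flip: r(2)\<close>)
qed

text \<open>The bound forces \<open>t r\<close> to depend on \<open>val r\<close> alone and to be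
  Lipschitz in it, so it extends to the closure by uniform continuity. Representatives with formal
  operations \<open>pl\<close> and \<open>sc\<close> stand in for a dense subspace: lists of pairs
  for \<open>'h\<close>, continuous functions for the space of classes.\<close>

lemma linear_extension_from_representatives:
  fixes val :: "'r \<Rightarrow> 'x::real_normed_vector" and t :: "'r \<Rightarrow> 'y::{real_normed_vector,complete_space}"
  assumes add: "\<And>r s. r \<in> R \<Longrightarrow> s \<in> R \<Longrightarrow> pl r s \<in> R \<and> val (pl r s) = val r + val s \<and> t (pl r s) = t r + t s"
    and scale: "\<And>c r. r \<in> R \<Longrightarrow> sc c r \<in> R \<and> val (sc c r) = c *\<^sub>R val r \<and> t (sc c r) = c *\<^sub>R t r"
    and bound: "\<And>r. r \<in> R \<Longrightarrow> norm (t r) \<le> K * norm (val r)"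
    and dense: "closure (val ` R) = UNIV"
  shows "\<exists>T. bounded_linear T \<and> (\<forall>r\<in>R. T (val r) = t r) \<and> (\<forall>x. norm (T x) \<le> K * norm x)"
proof -
  have lip: "norm (t r - t s) \<le> K * norm (val r - val s)" if "r \<in> R" "s \<in> R" for r s
  proof -
    have s: "sc (-1) s \<in> R" "val (sc (-1) s) = - val s" "t (sc (-1) s) = - t s"
      using scale[OF that(2), of "-1"] by auto
    have "pl r (sc (-1) s) \<in> R" "val (pl r (sc (-1) s)) = val r - val s" "t (pl r (sc (-1) s)) = t r - t s"
      using add[OF that(1) s(1)] s(2,3) by auto
    then show ?thesis using bound[of "pl r (sc (-1) s)"] by simp
  qed
  define f where "f v = t (SOME r. r \<in> R \<and> val r = v)" for v
  have f: "f (val r) = t r" if "r \<in> R" for r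
  proof -
    define s where "s = (SOME s. s \<in> R \<and> val s = val r)"
    have s: "s \<in> R \<and> val s = val r" unfolding s_def by (rule someI[of _ r]) (simp add: that)
    then have "norm (t s - t r) \<le> 0" using lip[of s r] that by simp
    then show ?thesis unfolding f_def s_def[symmetric] by simp
  qed
  have uc: "uniformly_continuous_on (val ` R) f"
    unfolding uniformly_continuous_on_def
  proof (intro allI impI)
    fix e :: real assume e: "0 < e"
    show "\<exists>d>0. \<forall>x\<in>val ` R. \<forall>x'\<in>val ` R. dist x' x < d \<longrightarrow> dist (f x') (f x) < e"
    \<comment> \<open>The denominator \<open>\<bar>K\<bar> + 1\<close> keeps the modulus positive
      whatever \<open>K\<close> is.\<close>
    proof (intro exI[of _ "e / (\<bar>K\<bar> + 1)"] conjI ballI impI)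
      show "0 < e / (\<bar>K\<bar> + 1)" using e by simp
      fix x x' assume "x \<in> val ` R" "x' \<in> val ` R" and d: "dist x' x < e / (\<bar>K\<bar> + 1)"
      then obtain r s where rs: "r \<in> R" "x = val r" "s \<in> R" "x' = val s" by auto
      have "dist (f x') (f x) = norm (t s - t r)" using f rs by (simp add: dist_norm)
      also have "\<dots> \<le> K * norm (val s - val r)" by (rule lip) (use rs in auto)
      also have "\<dots> \<le> (\<bar>K\<bar> + 1) * dist x' x"
        unfolding rs dist_norm by (intro mult_right_mono) auto
      also have "\<dots> < e" using d by (simp add: field_simps)
      finally show "dist (f x') (f x) < e" .
    qed
  qed
  obtain g where g: "uniformly_continuous_on (closure (val ` R)) g" "\<And>x. x \<in> val ` R \<Longrightarrow> f x = g x"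
    using uniformly_continuous_on_extension_on_closure[OF uc] by metis
  have gv: "g (val r) = t r" if "r \<in> R" for r using g(2)[of "val r"] f that by simp
  have "continuous_on UNIV g" using g(1) dense by (auto intro: uniformly_continuous_imp_continuous)
  then have lim: "(\<lambda>n. g (v n)) \<longlonglongrightarrow> g x" if "v \<longlonglongrightarrow> x" for v :: "nat \<Rightarrow> 'x" and x
    using that by (intro continuous_on_tendsto_compose[of UNIV g v x sequentially]) auto
  have gadd: "g (x + y) = g x + g y" for x y
  proof -
    obtain r where r: "\<And>n::nat. r n \<in> R" "(\<lambda>n. val (r n)) \<longlonglongrightarrow> x" using dense_image_sequence[OF dense] by metis
    obtain s where s: "\<And>n::nat. s n \<in> R" "(\<lambda>n. val (s n)) \<longlonglongrightarrow> y" using dense_image_sequence[OF dense] by metis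
    have "(\<lambda>n. g (val (r n) + val (s n))) \<longlonglongrightarrow> g (x + y)" by (intro lim tendsto_add r s)
    moreover have "g (val (r n) + val (s n)) = g (val (r n)) + g (val (s n))" for n
      using add[OF r(1) s(1), of n n] gv r(1) s(1) by metis
    ultimately have "(\<lambda>n. g (val (r n)) + g (val (s n))) \<longlonglongrightarrow> g (x + y)" by simp
    moreover have "(\<lambda>n. g (val (r n)) + g (val (s n))) \<longlonglongrightarrow> g x + g y" by (intro tendsto_add lim r s)
    ultimately show ?thesis by (rule LIMSEQ_unique)
  qed
  have gscale: "g (c *\<^sub>R x) = c *\<^sub>R g x" for c x
  proof -
    obtain r where r: "\<And>n::nat. r n \<in> R" "(\<lambda>n. val (r n)) \<longlonglongrightarrow> x" using dense_image_sequence[OF dense] by metis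
    have "(\<lambda>n. g (c *\<^sub>R val (r n))) \<longlonglongrightarrow> g (c *\<^sub>R x)" by (intro lim tendsto_scaleR tendsto_const r)
    moreover have "g (c *\<^sub>R val (r n)) = c *\<^sub>R g (val (r n))" for n
      using scale[OF r(1), of c n] gv r(1) by metis
    ultimately have "(\<lambda>n. c *\<^sub>R g (val (r n))) \<longlonglongrightarrow> g (c *\<^sub>R x)" by simp
    moreover have "(\<lambda>n. c *\<^sub>R g (val (r n))) \<longlonglongrightarrow> c *\<^sub>R g x" by (intro tendsto_scaleR tendsto_const lim r)
    ultimately show ?thesis by (rule LIMSEQ_unique)
  qed
  have gbound: "norm (g x) \<le> K * norm x" for x
  proof -
    obtain r where r: "\<And>n::nat. r n \<in> R" "(\<lambda>n. val (r n)) \<longlonglongrightarrow> x" using dense_image_sequence[OF dense] by metis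
    have "(\<lambda>n. norm (g (val (r n)))) \<longlonglongrightarrow> norm (g x)" "(\<lambda>n. K * norm (val (r n))) \<longlonglongrightarrow> K * norm x"
      by (intro tendsto_norm lim r tendsto_mult tendsto_const)+
    then show ?thesis by (rule LIMSEQ_le) (use bound gv r(1) in auto)
  qed
  have "bounded_linear g"
    by (rule bounded_linear_intro[of g K]) (use gadd gscale gbound in \<open>auto simp: mult.commute\<close>)
  then show ?thesis using gv gbound by (intro exI[of _ g]) simp
qed

lemma bounded_bilinear_eq_dense:
  fixes \<beta>1 \<beta>2 :: "'x::real_normed_vector \<Rightarrow> 'x \<Rightarrow> 'y::real_normed_vector"
  assumes b: "bounded_bilinear \<beta>1" "bounded_bilinear \<beta>2"
    and dense: "closure (val ` R) = UNIV"
    and eq: "\<And>r s. r \<in> R \<Longrightarrow> s \<in> R \<Longrightarrow> \<beta>1 (val r) (val s) = \<beta>2 (val r) (val s)"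
  shows "\<beta>1 x y = \<beta>2 x y"
proof -
  obtain r where r: "\<And>n::nat. r n \<in> R" "(\<lambda>n. val (r n)) \<longlonglongrightarrow> x" using dense_image_sequence[OF dense] by metis
  obtain s where s: "\<And>n::nat. s n \<in> R" "(\<lambda>n. val (s n)) \<longlonglongrightarrow> y" using dense_image_sequence[OF dense] by metis
  have "(\<lambda>n. \<beta>1 (val (r n)) (val (s n))) \<longlonglongrightarrow> \<beta>1 x y" by (intro bounded_bilinear.tendsto[OF b(1)] r s)
  moreover have "(\<lambda>n. \<beta>1 (val (r n)) (val (s n))) \<longlonglongrightarrow> \<beta>2 x y"
    unfolding eq[OF r(1) s(1)] by (intro bounded_bilinear.tendsto[OF b(2)] r s)
  ultimately show ?thesis by (rule LIMSEQ_unique)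
qed

lemma bounded_linear_eq_dense:
  fixes T1 T2 :: "'x::real_normed_vector \<Rightarrow> 'y::real_normed_vector"
  assumes b: "bounded_linear T1" "bounded_linear T2"
    and dense: "closure (val ` R) = UNIV"
    and eq: "\<And>r. r \<in> R \<Longrightarrow> T1 (val r) = T2 (val r)"
  shows "T1 x = T2 x"
proof -
  obtain r where r: "\<And>n::nat. r n \<in> R" "(\<lambda>n. val (r n)) \<longlonglongrightarrow> x" using dense_image_sequence[OF dense] by metis
  have "(\<lambda>n. T1 (val (r n))) \<longlonglongrightarrow> T1 x" by (intro bounded_linear.tendsto[OF b(1)] r)
  moreover have "(\<lambda>n. T1 (val (r n))) \<longlonglongrightarrow> T2 x"
    unfolding eq[OF r(1)] by (intro bounded_linear.tendsto[OF b(2)] r)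
  ultimately show ?thesis by (rule LIMSEQ_unique)
qed

lemma orthogonal_to_dense:
  fixes x :: "'x::real_inner"
  assumes "closure S = UNIV" "\<And>y. y \<in> S \<Longrightarrow> inner x y = 0"
  shows "x = 0"
proof -
  have "inner x x = inner 0 x"
    by (rule bounded_linear_eq_dense[of "\<lambda>y. inner x y" "\<lambda>y. inner 0 y" "\<lambda>y. y" S x])
      (use assms in \<open>auto intro: bounded_linear_inner_right\<close>)
  then show ?thesis by simp
qed

text \<open>A minimising sequence is Cauchy by the parallelogram law, since midpoints stay in
  \<open>W\<close>; minimality along the lines z + t w then forces orthogonality.\<close>

lemma orthogonal_projection_exists:
  fixes W :: "'x::{real_inner,complete_space} set"
  assumes W: "Real_Vector_Spaces.subspace W" "closed W"
  shows "\<exists>y\<in>W. \<forall>w\<in>W. inner (x - y) w = 0"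
proof -
  have W0: "0 \<in> W" using W(1) by (rule real_vector.subspace_0)
  define d where "d = infdist x W"
  have d: "d \<le> norm (x - w)" if "w \<in> W" for w
    unfolding d_def dist_norm[symmetric] by (rule infdist_le[OF that])
  have d0: "0 \<le> d" unfolding d_def by (rule infdist_nonneg)
  define \<delta> where "\<delta> n = inverse (real (Suc n))" for n
  have \<delta>: "0 < \<delta> n" "\<delta> n \<le> 1" for n unfolding \<delta>_def by (auto simp: field_simps)
  have "\<exists>w\<in>W. dist x w < d + \<delta> n" for n
  proof -
    have "infdist x W < d + \<delta> n" using \<delta>(1)[of n] unfolding d_def by simp
    then have "Inf (dist x ` W) < d + \<delta> n" using W0 unfolding infdist_def by (auto split: if_splits)
    then show ?thesis using W0 cInf_lessD[of "dist x ` W" "d + \<delta> n"] by auto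
  qed
  then obtain y where y: "\<And>n. y n \<in> W" "\<And>n. dist x (y n) < d + \<delta> n" by metis
  \<comment> \<open>With distances at most d + \<delta> m and d + \<delta> n the parallelogram law
    leaves 4 d (\<delta> m + \<delta> n) + 2 ((\<delta> m)^2 + (\<delta> n)^2). Since \<delta> \<le>
    1, its squares are bounded by \<delta> itself, whence 4 d + 2.\<close>
  have par: "(norm (y m - y n))\<^sup>2 \<le> (4 * d + 2) * (\<delta> m + \<delta> n)" for m n
  proof -
    define a where "a = x - y m"
    define c where "c = x - y n"
    have "(1/2) *\<^sub>R (y m + y n) \<in> W"
      by (intro real_vector.subspace_scale[OF W(1)] real_vector.subspace_add[OF W(1)] y)
    then have "d \<le> norm (x - (1/2) *\<^sub>R (y m + y n))" by (rule d)
    also have "x - (1/2) *\<^sub>R (y m + y n) = (1/2) *\<^sub>R (a + c)"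
      unfolding a_def c_def by (simp add: algebra_simps flip: scaleR_2)
    finally have "2 * d \<le> norm (a + c)" by simp
    then have 1: "(2 * d)\<^sup>2 \<le> (norm (a + c))\<^sup>2" using d0 by (intro power_mono) auto
    have 2: "(norm (a + c))\<^sup>2 + (norm (c - a))\<^sup>2 = 2 * (norm a)\<^sup>2 + 2 * (norm c)\<^sup>2"
      by (simp add: power2_norm_eq_inner algebra_simps inner_commute)
    have "norm a \<le> d + \<delta> m" "norm c \<le> d + \<delta> n"
      using y(2)[of m] y(2)[of n] unfolding a_def c_def dist_norm by auto
    then have "(norm a)\<^sup>2 \<le> (d + \<delta> m)\<^sup>2" "(norm c)\<^sup>2 \<le> (d + \<delta> n)\<^sup>2" by (auto intro!: power_mono)
    then have "(norm (c - a))\<^sup>2 \<le> 2 * (d + \<delta> m)\<^sup>2 + 2 * (d + \<delta> n)\<^sup>2 - (2 * d)\<^sup>2"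
      using 1 2 by linarith
    also have "\<dots> = 4 * d * (\<delta> m + \<delta> n) + 2 * (\<delta> m * \<delta> m + \<delta> n * \<delta> n)"
      by (simp add: power2_eq_square algebra_simps)
    also have "\<dots> \<le> 4 * d * (\<delta> m + \<delta> n) + 2 * (\<delta> m + \<delta> n)"
      using mult_left_mono[OF \<delta>(2) less_imp_le[OF \<delta>(1)], of m m] mult_left_mono[OF \<delta>(2) less_imp_le[OF \<delta>(1)], of n n]
      by simp
    finally show ?thesis unfolding a_def c_def by (simp add: algebra_simps)
  qed
  have "Cauchy y"
  proof (rule metric_CauchyI)
    fix e :: real assume e: "0 < e"
    have "\<delta> \<longlonglongrightarrow> 0" unfolding \<delta>_def by (rule LIMSEQ_inverse_real_of_nat)
    moreover have "0 < e\<^sup>2 / (2 * (4 * d + 2))" using e d0 by simp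
    ultimately have "\<forall>\<^sub>F n in sequentially. \<delta> n < e\<^sup>2 / (2 * (4 * d + 2))" by (rule order_tendstoD(2))
    then obtain N where N: "\<And>n. n \<ge> N \<Longrightarrow> \<delta> n < e\<^sup>2 / (2 * (4 * d + 2))"
      unfolding eventually_sequentially by auto
    show "\<exists>M. \<forall>m\<ge>M. \<forall>n\<ge>M. dist (y m) (y n) < e"
    proof (intro exI[of _ N] allI impI)
      fix m n assume "m \<ge> N" "n \<ge> N"
      then have "\<delta> m + \<delta> n < e\<^sup>2 / (2 * (4 * d + 2)) + e\<^sup>2 / (2 * (4 * d + 2))"
        using N by (intro add_strict_mono) simp_all
      also have "\<dots> = e\<^sup>2 / (4 * d + 2)" by (simp only: mult_2 add_divide_distrib[symmetric]) (use d0 in \<open>simp add: divide_simps\<close>)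
      finally have "\<delta> m + \<delta> n < e\<^sup>2 / (4 * d + 2)" .
      then have "(4 * d + 2) * (\<delta> m + \<delta> n) < e\<^sup>2" using d0 by (simp add: field_simps)
      then have "(norm (y m - y n))\<^sup>2 < e\<^sup>2" using par[of m n] by linarith
      then show "dist (y m) (y n) < e" using e unfolding dist_norm by (simp add: power2_less_imp_less)
    qed
  qed
  then obtain z where z: "y \<longlonglongrightarrow> z" using Cauchy_convergent_iff convergent_def by metis
  have zW: "z \<in> W" by (rule closed_sequentially[OF W(2) y(1) z])
  have "(\<lambda>n. dist x (y n)) \<longlonglongrightarrow> dist x z" by (intro tendsto_dist tendsto_const z)
  moreover have "(\<lambda>n. d + \<delta> n) \<longlonglongrightarrow> d + 0"
    unfolding \<delta>_def by (intro tendsto_add tendsto_const LIMSEQ_inverse_real_of_nat)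
  ultimately have "dist x z \<le> d + 0" by (rule LIMSEQ_le) (use y(2) less_imp_le in auto)
  then have min: "norm (x - z) \<le> norm (x - w)" if "w \<in> W" for w using d[OF that] unfolding dist_norm by simp
  have "inner (x - z) w = 0" if w: "w \<in> W" for w
  proof (cases "w = 0")
    case False
    \<comment> \<open>The minimiser in t of the squared distance from x to z + t w.\<close>
    define t where "t = inner (x - z) w / inner w w"
    have "z + t *\<^sub>R w \<in> W" by (intro real_vector.subspace_add[OF W(1)] zW real_vector.subspace_scale[OF W(1)] w)
    then have "(norm (x - z))\<^sup>2 \<le> (norm (x - (z + t *\<^sub>R w)))\<^sup>2" using min by (intro power_mono) auto
    also have "\<dots> = (norm (x - z))\<^sup>2 - 2 * t * inner (x - z) w + t * t * inner w w"
      by (simp add: power2_norm_eq_inner algebra_simps inner_commute)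
    also have "t * t * inner w w = t * inner (x - z) w" using False unfolding t_def by simp
    finally have "t * inner (x - z) w \<le> 0" by simp
    moreover have "t * inner (x - z) w = (inner (x - z) w)\<^sup>2 / inner w w" unfolding t_def by (simp add: power2_eq_square)
    moreover have "0 < inner w w" using False by simp
    ultimately have "(inner (x - z) w)\<^sup>2 / inner w w \<le> 0" "0 < inner w w" by auto
    then have "(inner (x - z) w)\<^sup>2 \<le> 0" by (auto simp: divide_le_0_iff)
    then show ?thesis by simp
  qed simp
  with zW show ?thesis by auto
qed

text \<open>The functional lives on \<open>W\<close> only, so its kernel is taken inside
  \<open>W\<close>; there it is closed by the bound, and a vector of \<open>W\<close> orthogonal to
  it spans the rest. The lemma is meant for the range of the gradient.\<close>

lemma riesz_on_subspace:
  fixes W :: "'x::{real_inner,complete_space} set"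
  assumes W: "Real_Vector_Spaces.subspace W" "closed W"
    and add: "\<And>x y. x \<in> W \<Longrightarrow> y \<in> W \<Longrightarrow> l (x + y) = l x + l y"
    and scale: "\<And>c x. x \<in> W \<Longrightarrow> l (c *\<^sub>R x) = c * (l x :: real)"
    and bound: "\<And>x. x \<in> W \<Longrightarrow> \<bar>l x\<bar> \<le> K * norm x"
  shows "\<exists>u\<in>W. \<forall>w\<in>W. inner u w = l w"
proof (cases "\<forall>w\<in>W. l w = 0")
  case True
  then show ?thesis using real_vector.subspace_0[OF W(1)] by (intro bexI[of _ 0]) auto
next
  case False
  then obtain w0 where w0: "w0 \<in> W" "l w0 \<noteq> 0" by auto
  have diff: "l (x - y) = l x - l y" if "x \<in> W" "y \<in> W" for x y
    using add[of x "(-1) *\<^sub>R y"] scale[of y "-1"] that real_vector.subspace_scale[OF W(1), of y "-1"] by simp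
  define N where "N = {w \<in> W. l w = 0}"
  have N: "Real_Vector_Spaces.subspace N"
  proof (rule real_vector.subspaceI)
    show "0 \<in> N" using real_vector.subspace_0[OF W(1)] scale[of 0 0] unfolding N_def by simp
  qed (use W(1) add scale in \<open>auto simp: N_def intro: real_vector.subspace_add real_vector.subspace_scale\<close>)
  have "closed N"
    unfolding closed_sequential_limits
  proof (intro allI impI)
    fix s x assume s: "(\<forall>n. s n \<in> N) \<and> s \<longlonglongrightarrow> x"
    then have x: "x \<in> W" using closed_sequentially[OF W(2), of s x] unfolding N_def by auto
    have "(\<lambda>n. K * norm (x - s n)) \<longlonglongrightarrow> K * norm (x - x)" using s by (intro tendsto_intros) auto
    moreover have "\<bar>l x\<bar> \<le> K * norm (x - s n)" for n
    proof -
      have sn: "s n \<in> W" "l (s n) = 0" using s unfolding N_def by auto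
      show ?thesis using bound[of "x - s n"] diff[OF x sn(1)] sn(2) real_vector.subspace_diff[OF W(1) x sn(1)] by simp
    qed
    ultimately have "\<bar>l x\<bar> \<le> K * norm (x - x)" by (intro LIMSEQ_le_const) auto
    then show "x \<in> N" using x unfolding N_def by simp
  qed
  then obtain y where y: "y \<in> N" "\<forall>w\<in>N. inner (w0 - y) w = 0" using orthogonal_projection_exists[OF N] by metis
  define e where "e = w0 - y"
  have yW: "y \<in> W" "l y = 0" using y(1) unfolding N_def by auto
  have e: "e \<in> W" "l e \<noteq> 0" "e \<noteq> 0"
    unfolding e_def using real_vector.subspace_diff[OF W(1) w0(1) yW(1)] diff[OF w0(1) yW(1)] w0(2) yW by auto
  show ?thesis
  proof (intro bexI[of _ "(l e / inner e e) *\<^sub>R e"] ballI)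
    fix w assume w: "w \<in> W"
    have "w - (l w / l e) *\<^sub>R e \<in> N"
      unfolding N_def using w e real_vector.subspace_diff[OF W(1) w real_vector.subspace_scale[OF W(1) e(1)]]
        diff[OF w real_vector.subspace_scale[OF W(1) e(1)]] scale[OF e(1)] by simp
    then have "inner e (w - (l w / l e) *\<^sub>R e) = 0" using y(2) unfolding e_def by simp
    then have "inner e w = l w / l e * inner e e" by (simp add: inner_diff_right)
    then show "inner ((l e / inner e e) *\<^sub>R e) w = l w" using e by simp
  qed (intro real_vector.subspace_scale[OF W(1)] e(1))
qed

section \<open>Energy measures of vector fields\<close>

text \<open>Cauchy-Schwarz for semidefinite forms, stated for numbers so that it serves
  \<open>rep_form\<close> on lists and \<open>EM\<close> on fields alike. The sign of
  \<open>c\<close> has to be extracted from the hypothesis before the square is completed.\<close>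

lemma discriminant_le:
  fixes a b c :: real
  assumes "\<And>t. 0 \<le> a + 2 * t * b + t * t * c"
  shows "b * b \<le> a * c"
proof (cases "c = 0")
  case True
  have "b = 0"
  proof (rule ccontr)
    assume b: "b \<noteq> 0"
    \<comment> \<open>At this point the affine function a + 2 t b takes the value -1.\<close>
    have "0 \<le> a + 2 * (- (a + 1) / (2 * b)) * b" using assms[of "- (a + 1) / (2 * b)"] True by simp
    also have "2 * (- (a + 1) / (2 * b)) * b = - (a + 1)" using b by simp
    finally show False by simp
  qed
  then show ?thesis using True by simp
next
  case False
  have "0 \<le> c"
  proof (rule ccontr)
    assume c: "\<not> 0 \<le> c"
    \<comment> \<open>Chosen so that |a| + 2 |b| + t c = c; because t \<ge> 1, the quadratic is then
      at most t c, which is negative.\<close>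
    define t where "t = 1 + (\<bar>a\<bar> + 2 * \<bar>b\<bar>) / (- c)"
    have "0 \<le> (\<bar>a\<bar> + 2 * \<bar>b\<bar>) / (- c)" using c by (intro divide_nonneg_pos) auto
    then have t: "t \<ge> 1" unfolding t_def by linarith
    have "0 \<le> a + 2 * t * b + t * t * c" by (rule assms)
    also have "\<dots> \<le> \<bar>a\<bar> * t + 2 * t * \<bar>b\<bar> + t * t * c"
    proof -
      have "a \<le> \<bar>a\<bar> * t" using t mult_left_mono[of 1 t "\<bar>a\<bar>"] by simp
      moreover have "2 * t * b \<le> 2 * t * \<bar>b\<bar>" using t by (intro mult_left_mono) auto
      ultimately show ?thesis by simp
    qed
    also have "\<dots> = t * (\<bar>a\<bar> + 2 * \<bar>b\<bar> + t * c)" by (simp add: algebra_simps)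
    also have "\<bar>a\<bar> + 2 * \<bar>b\<bar> + t * c = c" unfolding t_def using c by (simp add: field_simps)
    finally have "0 \<le> t * c" .
    then show False using t c by (simp add: zero_le_mult_iff)
  qed
  then have c: "0 < c" using False by simp
  have "0 \<le> a + 2 * (- b / c) * b + (- b / c) * (- b / c) * c" by (rule assms)
  also have "\<dots> = a - b * b / c" using c by (simp add: field_simps)
  finally show ?thesis using c by (simp add: field_simps)
qed

locale compact_form =
  fixes E :: "('a::metric_space \<Rightarrow> real) \<Rightarrow> ('a \<Rightarrow> real) \<Rightarrow> real" and C :: "('a \<Rightarrow> real) set"
    and \<nu> :: "('a \<Rightarrow> real) \<Rightarrow> ('a \<Rightarrow> real) \<Rightarrow> 'a set \<Rightarrow> real"
    and \<iota> :: "('a \<times> 'a \<Rightarrow> real) \<Rightarrow> 'h::{real_inner, complete_space}"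
  assumes admissible: "admissible_form E C" and energy: "energy_measures E C \<nu>"
    and first_order: "first_order_space C \<nu> \<iota>" and one_C: "(\<lambda>x. 1) \<in> C"
begin

section \<open>Compactness of the space, the function algebra and the generators of the field
  space\<close>

lemma C_Cc: "f \<in> C \<Longrightarrow> f \<in> Cc"
  using admissible unfolding admissible_form_def subalgebra_Cc_def by auto

text \<open>The support of the constant 1 is the whole space, and members of \<open>C\<close> have
  compact support.\<close>

lemma compact_space: "compact (UNIV :: 'a set)"
  using C_Cc[OF one_C] unfolding Cc_def by simp

lemma Cc_iff: "f \<in> Cc \<longleftrightarrow> continuous_on UNIV (f :: 'a \<Rightarrow> real)"
  unfolding Cc_def using closed_Int_compact[OF closed_closure compact_space] by auto

lemma Cc_bounded:
  assumes "(f :: 'a \<Rightarrow> real) \<in> Cc"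
  obtains K where "\<And>x. \<bar>f x\<bar> \<le> K" "0 \<le> K"
proof -
  have "bounded (range f)"
    using assms unfolding Cc_iff by (intro compact_imp_bounded compact_continuous_image compact_space)
  then obtain K where "\<And>x. \<bar>f x\<bar> \<le> K" by (auto simp: bounded_iff)
  moreover from this have "0 \<le> K" by (rule order_trans[OF abs_ge_zero])
  ultimately show thesis by (rule that)
qed

lemma Cc_bounded_borel: "(f :: 'a \<Rightarrow> real) \<in> Cc \<Longrightarrow> f \<in> bounded_borel"
proof -
  assume f: "f \<in> Cc"
  then obtain K where "\<And>x. \<bar>f x\<bar> \<le> K" using Cc_bounded by metis
  then show ?thesis using f unfolding Cc_iff by (intro bounded_borelI[of f K] borel_measurable_continuous_onI)
qed

lemma Cc_simps: "(\<lambda>x::'a. c) \<in> Cc" "f \<in> Cc \<Longrightarrow> g \<in> Cc \<Longrightarrow> (\<lambda>x::'a. f x + g x) \<in> Cc"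
  "f \<in> Cc \<Longrightarrow> g \<in> Cc \<Longrightarrow> (\<lambda>x::'a. f x * g x) \<in> Cc" "f \<in> Cc \<Longrightarrow> g \<in> Cc \<Longrightarrow> (\<lambda>x::'a. f x - g x) \<in> Cc"
  unfolding Cc_iff by (auto intro!: continuous_intros)

lemma coefficients_eq: "coefficients = (Cc :: ('a \<Rightarrow> real) set)"
  unfolding coefficients_def using Cc_simps(1)[of 1] by auto

lemma C_add: "f \<in> C \<Longrightarrow> g \<in> C \<Longrightarrow> (\<lambda>x. f x + g x) \<in> C"
  and C_mult: "f \<in> C \<Longrightarrow> g \<in> C \<Longrightarrow> (\<lambda>x. f x * g x) \<in> C"
  and C_scale: "f \<in> C \<Longrightarrow> (\<lambda>x. c * f x) \<in> C"
  using admissible unfolding admissible_form_def subalgebra_Cc_def by simp_all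

lemma C_const: "(\<lambda>x. c) \<in> C"
  using C_scale[OF one_C, of c] by simp

lemma C_diff: "f \<in> C \<Longrightarrow> g \<in> C \<Longrightarrow> (\<lambda>x. f x - g x) \<in> C"
  using C_add[of f "\<lambda>x. -1 * g x"] C_scale[of g "-1"] by simp

lemma simple_field_span: "g \<in> Cc \<Longrightarrow> f \<in> C \<Longrightarrow> simple_field g f \<in> field_span C"
  unfolding field_span_def coefficients_eq
  by (rule CollectI, rule exI[of _ 1], rule exI[of _ "\<lambda>_. 1"], rule exI[of _ "\<lambda>_. g"], rule exI[of _ "\<lambda>_. f"]) simp

lemma \<iota>_add: "F \<in> field_span C \<Longrightarrow> G \<in> field_span C \<Longrightarrow> \<iota> (\<lambda>z. F z + G z) = \<iota> F + \<iota> G"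
  and \<iota>_scale: "F \<in> field_span C \<Longrightarrow> \<iota> (\<lambda>z. c * F z) = c *\<^sub>R \<iota> F"
  using first_order unfolding first_order_space_def by simp_all

definition gen :: "('a \<Rightarrow> real) \<Rightarrow> ('a \<Rightarrow> real) \<Rightarrow> 'h" where
  "gen g f = \<iota> (simple_field g f)"

lemma gen_inner: "g1 \<in> Cc \<Longrightarrow> g2 \<in> Cc \<Longrightarrow> f1 \<in> C \<Longrightarrow> f2 \<in> C \<Longrightarrow>
    inner (gen g1 f1) (gen g2 f2) = signed_integral (\<nu> f1 f2) (\<lambda>x. g1 x * g2 x)"
  using first_order unfolding first_order_space_def coefficients_eq gen_def by simp

lemma gen_scale: "g \<in> Cc \<Longrightarrow> f \<in> C \<Longrightarrow> gen (\<lambda>x. c * g x) f = c *\<^sub>R gen g f"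
proof -
  assume gf: "g \<in> Cc" "f \<in> C"
  have "simple_field (\<lambda>x. c * g x) f = (\<lambda>z. c * simple_field g f z)"
    unfolding simple_field_def mean_ext_def by (auto simp: fun_eq_iff algebra_simps)
  then show ?thesis unfolding gen_def using \<iota>_scale[OF simple_field_span[OF gf]] by simp
qed

lemma \<nu>_signed: "f \<in> C \<Longrightarrow> g \<in> C \<Longrightarrow> signed_measure (\<nu> f g)"
  using energy unfolding energy_measures_def by simp

lemma \<nu>_functional: "f \<in> C \<Longrightarrow> g \<in> C \<Longrightarrow> sigma_functional (signed_integral (\<nu> f g))"
  by (intro sigma_functional_signed_integral \<nu>_signed)

text \<open>A list of pairs \<open>(g, f)\<close> represents the sum of the \<open>g \<partial>f\<close>, and \<open>rep_form \<phi>\<close> is the integral of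
  \<open>\<phi>\<close> against the mutual energy measure of two such sums.\<close>

definition reps :: "(('a \<Rightarrow> real) \<times> ('a \<Rightarrow> real)) list set" where
  "reps = lists (Cc \<times> C)"

definition val :: "(('a \<Rightarrow> real) \<times> ('a \<Rightarrow> real)) list \<Rightarrow> 'h" where
  "val r = (\<Sum>a\<leftarrow>r. gen (fst a) (snd a))"

definition act :: "('a \<Rightarrow> real) \<Rightarrow> (('a \<Rightarrow> real) \<times> ('a \<Rightarrow> real)) list \<Rightarrow> (('a \<Rightarrow> real) \<times> ('a \<Rightarrow> real)) list" where
  "act \<phi> r = map (\<lambda>a. (\<lambda>x. \<phi> x * fst a x, snd a)) r"

definition rep_form :: "('a \<Rightarrow> real) \<Rightarrow> (('a \<Rightarrow> real) \<times> ('a \<Rightarrow> real)) list \<Rightarrow> (('a \<Rightarrow> real) \<times> ('a \<Rightarrow> real)) list \<Rightarrow> real" where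
  "rep_form \<phi> r s = (\<Sum>a\<leftarrow>r. \<Sum>a'\<leftarrow>s. signed_integral (\<nu> (snd a) (snd a')) (\<lambda>x. \<phi> x * (fst a x * fst a' x)))"

lemma reps_simps [simp]: "[] \<in> reps" "a # r \<in> reps \<longleftrightarrow> fst a \<in> Cc \<and> snd a \<in> C \<and> r \<in> reps"
  "r @ s \<in> reps \<longleftrightarrow> r \<in> reps \<and> s \<in> reps"
  unfolding reps_def by (auto simp: mem_Times_iff)

lemma repsD: "r \<in> reps \<Longrightarrow> a \<in> set r \<Longrightarrow> fst a \<in> Cc \<and> snd a \<in> C"
  unfolding reps_def by (cases a) auto

lemma act_reps: "\<phi> \<in> Cc \<Longrightarrow> r \<in> reps \<Longrightarrow> act \<phi> r \<in> reps"
  unfolding act_def by (induction r) (auto simp: Cc_simps)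

lemma val_append: "val (r @ s) = val r + val s"
  unfolding val_def by simp

lemma act_append: "act \<phi> (r @ s) = act \<phi> r @ act \<phi> s"
  unfolding act_def by simp

lemma val_scale: "r \<in> reps \<Longrightarrow> val (act (\<lambda>x. c) r) = c *\<^sub>R val r"
  unfolding val_def act_def by (induction r) (auto simp: gen_scale scaleR_right_distrib)

lemma inner_val: "r \<in> reps \<Longrightarrow> s \<in> reps \<Longrightarrow> inner (val r) (val s) =
    (\<Sum>a\<leftarrow>r. \<Sum>a'\<leftarrow>s. signed_integral (\<nu> (snd a) (snd a')) (\<lambda>x. fst a x * fst a' x))"
proof (induction r)
  case Nil
  then show ?case by (simp add: val_def)
next
  case (Cons a r)
  have "inner (gen (fst a) (snd a)) (val s) =
      (\<Sum>a'\<leftarrow>s. signed_integral (\<nu> (snd a) (snd a')) (\<lambda>x. fst a x * fst a' x))"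
    using Cons(3)
  proof (induction s)
    case (Cons a' s)
    then show ?case using \<open>a # r \<in> reps\<close> by (simp add: val_def inner_add_right gen_inner)
  qed (simp add: val_def)
  then show ?case using Cons by (simp add: val_def inner_add_left)
qed

text \<open>A continuous weight can be multiplied into the coefficients of either list, and the
  square of a weight into both. So \<open>rep_form\<close> turns into a scalar product or a squared
  norm, which is the source of symmetry and positivity of the energy measures.\<close>

lemma rep_form_cont:
  assumes "\<phi> \<in> Cc" "r \<in> reps" "s \<in> reps"
  shows "rep_form \<phi> r s = inner (val r) (val (act \<phi> s))" "rep_form \<phi> r s = inner (val (act \<phi> r)) (val s)"
    "rep_form (\<lambda>x. \<phi> x * \<phi> x) r r = (norm (val (act \<phi> r)))\<^sup>2"
  unfolding power2_norm_eq_inner inner_val[OF assms(2) act_reps[OF assms(1,3)]]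
    inner_val[OF act_reps[OF assms(1,2)] assms(3)] inner_val[OF act_reps[OF assms(1,2)] act_reps[OF assms(1,2)]]
  unfolding rep_form_def act_def by (simp_all add: comp_def mult.assoc mult.left_commute)

lemma rep_form_functional:
  assumes "r \<in> reps" "s \<in> reps"
  shows "sigma_functional (\<lambda>\<phi>. rep_form \<phi> r s)"
  unfolding rep_form_def
  by (intro sigma_functional_sum_list sigma_functional_weight \<nu>_functional bounded_borel_mult Cc_bounded_borel)
    (use repsD assms in auto)

lemma rep_form_append: "rep_form \<phi> (r @ r') s = rep_form \<phi> r s + rep_form \<phi> r' s" "rep_form \<phi> r (s @ s') = rep_form \<phi> r s + rep_form \<phi> r s'"
  unfolding rep_form_def by (simp_all add: sum_list_addf)

lemma rep_form_scale:
  assumes "\<phi> \<in> bounded_borel" "r \<in> reps" "s \<in> reps"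
  shows "rep_form \<phi> (act (\<lambda>x. c) r) s = c * rep_form \<phi> r s" "rep_form \<phi> r (act (\<lambda>x. c) s) = c * rep_form \<phi> r s"
proof -
  have L: "rep_form (\<lambda>x. c * \<phi> x) r s = c * rep_form \<phi> r s"
    by (rule sigma_functional_cmult[OF rep_form_functional[OF assms(2,3)] assms(1)])
  show "rep_form \<phi> (act (\<lambda>x. c) r) s = c * rep_form \<phi> r s" "rep_form \<phi> r (act (\<lambda>x. c) s) = c * rep_form \<phi> r s"
    unfolding L[symmetric] by (simp_all add: rep_form_def act_def comp_def mult.assoc mult.left_commute)
qed

lemma rep_form_one: "r \<in> reps \<Longrightarrow> s \<in> reps \<Longrightarrow> rep_form (\<lambda>x. 1) r s = inner (val r) (val s)"
  by (simp add: inner_val rep_form_def)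

lemma rep_form_sym:
  assumes "\<phi> \<in> bounded_borel" "r \<in> reps" "s \<in> reps"
  shows "rep_form \<phi> r s = rep_form \<phi> s r"
proof (rule sigma_functional_eq_continuous[OF rep_form_functional rep_form_functional, OF assms(2,3) assms(3,2) _ assms(1)])
  fix g :: "'a \<Rightarrow> real" assume "continuous_on UNIV g"
  then have "g \<in> Cc" by (simp add: Cc_iff)
  then show "rep_form g r s = rep_form g s r" using rep_form_cont(1)[of g r s] rep_form_cont(2)[of g s r] assms by (simp add: inner_commute)
qed

lemma rep_form_nonneg:
  assumes "\<phi> \<in> bounded_borel" "\<And>x. 0 \<le> \<phi> x" "r \<in> reps"
  shows "0 \<le> rep_form \<phi> r r"
proof (rule sigma_functional_nonneg[OF rep_form_functional[OF assms(3,3)] _ assms(1,2)])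
  fix g :: "'a \<Rightarrow> real" assume "continuous_on UNIV g"
  then have "g \<in> Cc" by (simp add: Cc_iff)
  then show "0 \<le> rep_form (\<lambda>x. g x * g x) r r" using rep_form_cont(3)[of g r r] assms by simp
qed

lemma rep_form_upper:
  assumes \<phi>: "\<phi> \<in> bounded_borel" "\<And>x. \<phi> x \<le> K" and r: "r \<in> reps"
  shows "rep_form \<phi> r r \<le> K * (norm (val r))\<^sup>2"
proof -
  have "0 \<le> rep_form (\<lambda>x. K * 1 - \<phi> x) r r"
    using \<phi> by (intro rep_form_nonneg[OF _ _ r] bounded_borel_diff bounded_borel_cmult bounded_borel_const) auto
  also have "\<dots> = K * rep_form (\<lambda>x. 1) r r - rep_form \<phi> r r"
    using sigma_functional_diff[OF rep_form_functional[OF r r] bounded_borel_cmult[OF bounded_borel_const] \<phi>(1), of K 1]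
      sigma_functional_cmult[OF rep_form_functional[OF r r] bounded_borel_const, of K 1]
    by metis
  finally show ?thesis by (simp add: rep_form_one[OF r r] power2_norm_eq_inner)
qed

text \<open>The shifted weight \<psi> = \<phi> + K satisfies 0 \<le> \<psi> \<le> 2 K, so
  Cauchy-Schwarz gives the constant 2 K; removing the shift costs another K.\<close>

lemma rep_form_bound:
  assumes \<phi>: "\<phi> \<in> bounded_borel" "\<And>x. \<bar>\<phi> x\<bar> \<le> K" and r: "r \<in> reps" and s: "s \<in> reps"
  shows "\<bar>rep_form \<phi> r s\<bar> \<le> 3 * K * norm (val r) * norm (val s)"
proof -
  define \<psi> where "\<psi> = (\<lambda>x. \<phi> x + K * 1)"
  have K: "0 \<le> K" using order_trans[OF abs_ge_zero \<phi>(2)] .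
  have \<psi>: "\<psi> \<in> bounded_borel" "\<And>x. 0 \<le> \<psi> x" "\<And>x. \<psi> x \<le> 2 * K"
    unfolding \<psi>_def using \<phi> by (auto intro!: bounded_borel_add bounded_borel_const simp: abs_le_iff)
      (metis add.commute add_le_cancel_left diff_ge_0_iff_ge diff_minus_eq_add minus_le_iff)+
  have cs: "(rep_form \<psi> r s) * (rep_form \<psi> r s) \<le> rep_form \<psi> r r * rep_form \<psi> s s"
  proof (rule discriminant_le)
    fix t :: real
    have ts: "act (\<lambda>x. t) s \<in> reps" by (rule act_reps[OF Cc_simps(1) s])
    \<comment> \<open>Positivity on the list that represents r + t s is the quadratic inequality in
      \<open>t\<close>.\<close>
    have "0 \<le> rep_form \<psi> (r @ act (\<lambda>x. t) s) (r @ act (\<lambda>x. t) s)"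
      by (rule rep_form_nonneg[OF \<psi>(1,2)]) (simp add: r ts)
    then show "0 \<le> rep_form \<psi> r r + 2 * t * rep_form \<psi> r s + t * t * rep_form \<psi> s s"
      using rep_form_scale[OF \<psi>(1) s r, of t] rep_form_scale[OF \<psi>(1) r s, of t] rep_form_scale[OF \<psi>(1) s s, of t]
        rep_form_scale[OF \<psi>(1) s ts, of t] rep_form_sym[OF \<psi>(1) r s]
      by (simp add: rep_form_append algebra_simps)
  qed
  also have "\<dots> \<le> (2 * K * (norm (val r))\<^sup>2) * (2 * K * (norm (val s))\<^sup>2)"
    using K by (intro mult_mono rep_form_upper \<psi> r s rep_form_nonneg) auto
  also have "\<dots> = (2 * K * norm (val r) * norm (val s))\<^sup>2" by (simp add: power2_eq_square)
  finally have "(rep_form \<psi> r s)\<^sup>2 \<le> (2 * K * norm (val r) * norm (val s))\<^sup>2" by (simp add: power2_eq_square)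
  then have "\<bar>rep_form \<psi> r s\<bar> \<le> \<bar>2 * K * norm (val r) * norm (val s)\<bar>" by (simp only: abs_le_square_iff)
  then have 1: "\<bar>rep_form \<psi> r s\<bar> \<le> 2 * K * norm (val r) * norm (val s)" using K by simp
  have "rep_form \<psi> r s = rep_form \<phi> r s + K * rep_form (\<lambda>x. 1) r s"
    unfolding \<psi>_def using sigma_functional_add[OF rep_form_functional[OF r s] \<phi>(1) bounded_borel_cmult[OF bounded_borel_const], of K 1]
      sigma_functional_cmult[OF rep_form_functional[OF r s] bounded_borel_const, of K 1]
    by metis
  moreover have "\<bar>K * rep_form (\<lambda>x. 1) r s\<bar> \<le> K * (norm (val r) * norm (val s))"
    unfolding rep_form_one[OF r s] abs_mult using K by (simp add: mult_left_mono Cauchy_Schwarz_ineq2)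
  ultimately show ?thesis using 1 by (simp add: algebra_simps)
qed

text \<open>Scalars are absorbed into coefficients, so each finite sum in the span is the value of a
  list.\<close>

lemma dense_val: "closure (val ` reps) = UNIV"
proof -
  have "\<iota> ` field_span C \<subseteq> val ` reps"
  proof
    fix v assume "v \<in> \<iota> ` field_span C"
    then obtain n :: nat and c :: "nat \<Rightarrow> real" and g f where gf: "\<forall>i<n. g i \<in> Cc \<and> f i \<in> C"
      and v: "v = \<iota> (\<lambda>z. \<Sum>i<n. c i * simple_field (g i) (f i) z)"
      unfolding field_span_def coefficients_eq by auto
    have "\<exists>r\<in>reps. val r = \<iota> (\<lambda>z. \<Sum>i<m. c i * simple_field (g i) (f i) z)" if "m \<le> n" for m
      using that
    proof (induction m)
      case 0
      \<comment> \<open>Linearity of \<open>\<iota>\<close> is given on the span only; the zero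
        function is sent to 0 because it is 0 times an element of the span.\<close>
      have "\<iota> (\<lambda>z. 0 * simple_field (\<lambda>x. 1) (\<lambda>x. 1) z) = 0"
        using \<iota>_scale[OF simple_field_span[OF Cc_simps(1) one_C], of 0] by simp
      then show ?case by (intro bexI[of _ "[]"]) (auto simp: val_def)
    next
      case (Suc m)
      then obtain r where r: "r \<in> reps" "val r = \<iota> (\<lambda>z. \<Sum>i<m. c i * simple_field (g i) (f i) z)" by auto
      have gm: "g m \<in> Cc" "f m \<in> C" using gf Suc by auto
      have 1: "(\<lambda>z. \<Sum>i<m. c i * simple_field (g i) (f i) z) \<in> field_span C"
        unfolding field_span_def coefficients_eq using gf Suc(2) by (intro CollectI exI[of _ m] exI[of _ c] exI[of _ g] exI[of _ f]) auto
      have 2: "(\<lambda>z. c m * simple_field (g m) (f m) z) \<in> field_span C"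
        unfolding field_span_def coefficients_eq using gm
        by (intro CollectI exI[of _ 1] exI[of _ "\<lambda>_. c m"] exI[of _ "\<lambda>_. g m"] exI[of _ "\<lambda>_. f m"]) auto
      have "\<iota> (\<lambda>z. \<Sum>i<Suc m. c i * simple_field (g i) (f i) z) = val r + c m *\<^sub>R gen (g m) (f m)"
        using \<iota>_add[OF 1 2] \<iota>_scale[OF simple_field_span[OF gm], of "c m"] r(2) unfolding gen_def by simp
      also have "\<dots> = val (r @ [(\<lambda>x. c m * g m x, f m)])"
        by (simp add: val_def gen_scale[OF gm])
      finally show ?case using r(1) gm by (intro bexI[of _ "r @ [(\<lambda>x. c m * g m x, f m)]"]) (auto simp: Cc_simps)
    qed
    from this[of n] show "v \<in> val ` reps" unfolding v by force
  qed
  then have "closure (\<iota> ` field_span C) \<subseteq> closure (val ` reps)" by (rule closure_mono)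
  then show ?thesis using first_order unfolding first_order_space_def by auto
qed

text \<open>The extension lemma is used twice. For a fixed list on the left it gives a bounded
  functional on \<open>'h\<close>; the map from lists to these functionals is then extended with
  values in the dual space.\<close>

lemma bilinear_extension:
  assumes \<phi>: "\<phi> \<in> bounded_borel" "\<And>x. \<bar>\<phi> x\<bar> \<le> K"
  shows "\<exists>\<beta>. bounded_bilinear \<beta> \<and> (\<forall>r\<in>reps. \<forall>s\<in>reps. \<beta> (val r) (val s) = rep_form \<phi> r s) \<and>
    (\<forall>v w. \<bar>\<beta> v w\<bar> \<le> 3 * K * norm v * norm w)"
proof -
  have K: "0 \<le> K" using order_trans[OF abs_ge_zero \<phi>(2)] .
  have "\<exists>T. bounded_linear T \<and> (\<forall>s\<in>reps. T (val s) = rep_form \<phi> r s) \<and> (\<forall>x. norm (T x) \<le> (3 * K * norm (val r)) * norm x)"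
    if r: "r \<in> reps" for r
  proof (rule linear_extension_from_representatives[where pl = "(@)" and sc = "\<lambda>c. act (\<lambda>x. c)"])
    show "s \<in> reps \<Longrightarrow> norm (rep_form \<phi> r s) \<le> 3 * K * norm (val r) * norm (val s)" for s
      using rep_form_bound[OF \<phi> r] by simp
  qed (use r \<phi> in \<open>simp_all add: val_append val_scale rep_form_append rep_form_scale act_reps Cc_simps dense_val\<close>)
  then obtain T where T: "\<And>r. r \<in> reps \<Longrightarrow> bounded_linear (T r)"
    "\<And>r s. r \<in> reps \<Longrightarrow> s \<in> reps \<Longrightarrow> T r (val s) = rep_form \<phi> r s"
    "\<And>r x. r \<in> reps \<Longrightarrow> norm (T r x) \<le> (3 * K * norm (val r)) * norm x" by metis
  define t where "t r = Blinfun (T r)" for r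
  have t: "blinfun_apply (t r) = T r" if "r \<in> reps" for r
    unfolding t_def by (rule bounded_linear_Blinfun_apply[OF T(1)[OF that]])
  have eqI: "F = G" if "\<And>s. s \<in> reps \<Longrightarrow> blinfun_apply F (val s) = blinfun_apply G (val s)" for F G :: "'h \<Rightarrow>\<^sub>L real"
    by (rule blinfun_eqI, rule bounded_linear_eq_dense[OF blinfun.bounded_linear_right blinfun.bounded_linear_right dense_val])
      (rule that)
  have "\<exists>U. bounded_linear U \<and> (\<forall>r\<in>reps. U (val r) = t r) \<and> (\<forall>x. norm (U x) \<le> (3 * K) * norm x)"
  proof (rule linear_extension_from_representatives[where pl = "(@)" and sc = "\<lambda>c. act (\<lambda>x. c)"])
    fix r s c assume r: "r \<in> reps"
    have "t (act (\<lambda>x. c) r) = c *\<^sub>R t r"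
      by (rule eqI) (simp add: t r act_reps Cc_simps blinfun.scaleR_left T(2) rep_form_scale \<phi>)
    then show "act (\<lambda>x. c) r \<in> reps \<and> val (act (\<lambda>x. c) r) = c *\<^sub>R val r \<and> t (act (\<lambda>x. c) r) = c *\<^sub>R t r"
      using r by (simp add: act_reps Cc_simps val_scale)
    show "norm (t r) \<le> 3 * K * norm (val r)"
      by (rule norm_blinfun_bound) (use K T(3)[OF r] in \<open>simp_all add: t[OF r]\<close>)
    assume s: "s \<in> reps"
    have "t (r @ s) = t r + t s"
      by (rule eqI) (simp add: t r s blinfun.add_left T(2) rep_form_append)
    then show "r @ s \<in> reps \<and> val (r @ s) = val r + val s \<and> t (r @ s) = t r + t s"
      using r s by (simp add: val_append)
  qed (rule dense_val)
  then obtain U where U: "bounded_linear U" "\<And>r. r \<in> reps \<Longrightarrow> U (val r) = t r" "\<And>x. norm (U x) \<le> (3 * K) * norm x"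
    by auto
  show ?thesis
  proof (intro exI[of _ "\<lambda>v w. blinfun_apply (U v) w"] conjI ballI allI)
    show "bounded_bilinear (\<lambda>v. blinfun_apply (U v))"
      by (rule bounded_bilinear.comp1[OF bounded_bilinear_blinfun_apply U(1)])
    show "blinfun_apply (U (val r)) (val s) = rep_form \<phi> r s" if "r \<in> reps" "s \<in> reps" for r s
      using that by (simp add: U t T)
    show "\<bar>blinfun_apply (U v) w\<bar> \<le> 3 * K * norm v * norm w" for v w
    proof -
      have "\<bar>blinfun_apply (U v) w\<bar> \<le> norm (U v) * norm w" using norm_blinfun[of "U v" w] by simp
      also have "\<dots> \<le> 3 * K * norm v * norm w" using U(3)[of v] by (intro mult_right_mono) auto
      finally show ?thesis .
    qed
  qed
qed

lemma bilinear_val: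
  assumes \<beta>: "bounded_bilinear \<beta>"
  shows "\<beta> (val r) (val s) = (\<Sum>a\<leftarrow>r. \<Sum>a'\<leftarrow>s. \<beta> (gen (fst a) (snd a)) (gen (fst a') (snd a')))"
proof -
  have "\<beta> v (val s) = (\<Sum>a'\<leftarrow>s. \<beta> v (gen (fst a') (snd a')))" for v
    by (induction s) (auto simp: val_def bounded_bilinear.add_right[OF \<beta>] bounded_bilinear.zero_right[OF \<beta>])
  then show ?thesis
    by (induction r)
      (auto simp: val_def bounded_bilinear.add_left[OF \<beta>] bounded_bilinear.zero_left[OF \<beta>] sum_list_addf)
qed

text \<open>\<open>EM \<phi> v w\<close> is the integral of \<open>\<phi>\<close> against \<open>\<nu>\<^bsub>v,w\<^esub>\<close>.\<close>

definition EM :: "('a \<Rightarrow> real) \<Rightarrow> 'h \<Rightarrow> 'h \<Rightarrow> real" where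
  "EM \<phi> = (THE \<beta>. bounded_bilinear \<beta> \<and>
        (\<forall>g1\<in>coefficients. \<forall>g2\<in>coefficients. \<forall>f1\<in>C. \<forall>f2\<in>C.
           \<beta> (\<iota> (simple_field g1 f1)) (\<iota> (simple_field g2 f2)) =
             signed_integral (\<nu> f1 f2) (\<lambda>x. \<phi> x * (g1 x * g2 x))))"

lemma field_energy_measure_eq: "field_energy_measure C \<nu> \<iota> v w A = EM (indicator A) v w"
  unfolding field_energy_measure_def EM_def ..

text \<open>A bounded bilinear form with the prescribed values on generators is determined on all
  pairs of lists, hence everywhere by density, and \<open>bilinear_extension\<close> provides one.
  Uniqueness also identifies the extensions obtained from different bounds, so the estimate holds
  for every admissible \<open>K\<close>.\<close>

lemma EM:
  assumes \<phi>: "\<phi> \<in> bounded_borel"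
  shows "bounded_bilinear (EM \<phi>)"
    and "\<And>r s. r \<in> reps \<Longrightarrow> s \<in> reps \<Longrightarrow> EM \<phi> (val r) (val s) = rep_form \<phi> r s"
    and "\<And>K v w. (\<And>x. \<bar>\<phi> x\<bar> \<le> K) \<Longrightarrow> \<bar>EM \<phi> v w\<bar> \<le> 3 * K * norm v * norm w"
proof -
  define Q where "Q \<beta> \<longleftrightarrow> bounded_bilinear \<beta> \<and>
        (\<forall>g1\<in>coefficients. \<forall>g2\<in>coefficients. \<forall>f1\<in>C. \<forall>f2\<in>C.
           \<beta> (\<iota> (simple_field g1 f1)) (\<iota> (simple_field g2 f2)) =
             signed_integral (\<nu> f1 f2) (\<lambda>x. \<phi> x * (g1 x * g2 x)))" for \<beta> :: "'h \<Rightarrow> 'h \<Rightarrow> real"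
  have Qval: "\<beta> (val r) (val s) = rep_form \<phi> r s" if "Q \<beta>" "r \<in> reps" "s \<in> reps" for \<beta> r s
  proof -
    have b: "bounded_bilinear \<beta>" using \<open>Q \<beta>\<close> unfolding Q_def by simp
    have g: "\<beta> (gen (fst a) (snd a)) (gen (fst a') (snd a')) =
        signed_integral (\<nu> (snd a) (snd a')) (\<lambda>x. \<phi> x * (fst a x * fst a' x))"
      if "a \<in> set r" "a' \<in> set s" for a a'
      using \<open>Q \<beta>\<close> repsD[OF \<open>r \<in> reps\<close> that(1)] repsD[OF \<open>s \<in> reps\<close> that(2)]
      unfolding Q_def coefficients_eq gen_def by simp
    have "map (\<lambda>a'. \<beta> (gen (fst a) (snd a)) (gen (fst a') (snd a'))) s =
        map (\<lambda>a'. signed_integral (\<nu> (snd a) (snd a')) (\<lambda>x. \<phi> x * (fst a x * fst a' x))) s" if "a \<in> set r" for a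
      by (rule map_cong[OF refl]) (rule g[OF that])
    then show ?thesis
      unfolding bilinear_val[OF b] rep_form_def by (intro arg_cong[where f = sum_list] map_cong[OF refl]) simp
  qed
  have Quniq: "\<beta> = \<beta>'" if "Q \<beta>" "Q \<beta>'" for \<beta> \<beta>'
  proof (intro ext)
    show "\<beta> v w = \<beta>' v w" for v w
    proof (rule bounded_bilinear_eq_dense[OF _ _ dense_val])
      show "bounded_bilinear \<beta>" "bounded_bilinear \<beta>'" using that unfolding Q_def by simp_all
    qed (simp add: Qval that)
  qed
  have ex: "\<exists>\<beta>. Q \<beta> \<and> (\<forall>v w. \<bar>\<beta> v w\<bar> \<le> 3 * K * norm v * norm w)" if K: "\<And>x. \<bar>\<phi> x\<bar> \<le> K" for K
  proof -
    obtain \<beta> where \<beta>: "bounded_bilinear \<beta>" "\<forall>r\<in>reps. \<forall>s\<in>reps. \<beta> (val r) (val s) = rep_form \<phi> r s"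
      "\<forall>v w. \<bar>\<beta> v w\<bar> \<le> 3 * K * norm v * norm w"
      using bilinear_extension[OF \<phi> K] by auto
    have "\<beta> (gen g1 f1) (gen g2 f2) = signed_integral (\<nu> f1 f2) (\<lambda>x. \<phi> x * (g1 x * g2 x))"
      if "g1 \<in> Cc" "g2 \<in> Cc" "f1 \<in> C" "f2 \<in> C" for g1 g2 f1 f2
      using \<beta>(2)[rule_format, of "[(g1, f1)]" "[(g2, f2)]"] that by (simp add: val_def rep_form_def)
    then have "Q \<beta>" unfolding Q_def coefficients_eq gen_def using \<beta>(1) by simp
    then show ?thesis using \<beta>(3) by auto
  qed
  obtain K where "\<And>x. \<bar>\<phi> x\<bar> \<le> K" using bounded_borelE[OF \<phi>] by metis
  then obtain \<beta> where "Q \<beta>" using ex by metis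
  then have "EM \<phi> = \<beta>" unfolding EM_def Q_def[symmetric] using Quniq by (intro the_equality)
  then have QE: "Q (EM \<phi>)" using \<open>Q \<beta>\<close> by simp
  show "bounded_bilinear (EM \<phi>)" using QE unfolding Q_def by simp
  show "EM \<phi> (val r) (val s) = rep_form \<phi> r s" if "r \<in> reps" "s \<in> reps" for r s using Qval[OF QE that] .
  show "\<bar>EM \<phi> v w\<bar> \<le> 3 * K * norm v * norm w" if K: "\<And>x. \<bar>\<phi> x\<bar> \<le> K" for K v w
  proof -
    obtain \<beta>' where "Q \<beta>'" "\<forall>v w. \<bar>\<beta>' v w\<bar> \<le> 3 * K * norm v * norm w" using ex[OF K] by auto
    then show ?thesis using Quniq[OF QE] by metis
  qed
qed

end

context compact_form
begin

section \<open>Integrals against the energy measures of fields\<close>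

lemma EM_tendsto:
  assumes "\<phi> \<in> bounded_borel" "v \<longlonglongrightarrow> x" "w \<longlonglongrightarrow> y"
  shows "(\<lambda>n::nat. EM \<phi> (v n) (w n)) \<longlonglongrightarrow> EM \<phi> x y"
  by (rule bounded_bilinear.tendsto[OF EM(1)[OF assms(1)] assms(2,3)])

text \<open>One pair of approximating sequences serves all integrands at once, so that linear
  relations between integrands survive the limit.\<close>

lemma EM_sequences:
  "\<exists>r s :: nat \<Rightarrow> (('a \<Rightarrow> real) \<times> ('a \<Rightarrow> real)) list.
    (\<forall>n. r n \<in> reps) \<and> (\<forall>n. s n \<in> reps) \<and> (\<lambda>n. val (r n)) \<longlonglongrightarrow> v \<and> (\<lambda>n. val (s n)) \<longlonglongrightarrow> w \<and>
    (\<forall>\<phi>\<in>bounded_borel. (\<lambda>n. rep_form \<phi> (r n) (s n)) \<longlonglongrightarrow> EM \<phi> v w)"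
proof -
  obtain r where r: "\<And>n::nat. r n \<in> reps" "(\<lambda>n. val (r n)) \<longlonglongrightarrow> v" using dense_image_sequence[OF dense_val] by metis
  obtain s where s: "\<And>n::nat. s n \<in> reps" "(\<lambda>n. val (s n)) \<longlonglongrightarrow> w" using dense_image_sequence[OF dense_val] by metis
  have "(\<lambda>n. rep_form \<phi> (r n) (s n)) \<longlonglongrightarrow> EM \<phi> v w" if \<phi>: "\<phi> \<in> bounded_borel" for \<phi>
    using EM_tendsto[OF \<phi> r(2) s(2)] by (simp add: EM(2)[OF \<phi>] r(1) s(1))
  then show ?thesis using r s by (intro exI[of _ r] exI[of _ s]) simp
qed

text \<open>Linearity passes to the limit along \<open>EM_sequences\<close>. For bounded
  convergence, the error made by replacing fields by lists is uniform over integrands bounded by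
  \<open>K\<close>, so it is enough to fix one good pair of lists and use the continuity of
  \<open>rep_form\<close>.\<close>

lemma EM_functional: "sigma_functional (\<lambda>\<phi>. EM \<phi> v w)"
  unfolding sigma_functional_def
proof (intro conjI ballI allI impI)
  obtain r s where rs': "\<forall>n. r n \<in> reps" "\<forall>n. s n \<in> reps" "(\<lambda>n. val (r n)) \<longlonglongrightarrow> v" "(\<lambda>n. val (s n)) \<longlonglongrightarrow> w"
    "\<forall>\<phi>\<in>bounded_borel. (\<lambda>n. rep_form \<phi> (r n) (s n)) \<longlonglongrightarrow> EM \<phi> v w"
    using EM_sequences[of v w] by (elim exE conjE)
  note rs = rs'[rule_format]
  {
    fix f g :: "'a \<Rightarrow> real" and c assume f: "f \<in> bounded_borel"
    have "(\<lambda>n. rep_form (\<lambda>x. c * f x) (r n) (s n)) \<longlonglongrightarrow> EM (\<lambda>x. c * f x) v w"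
      by (intro rs bounded_borel_cmult f)
    moreover have "(\<lambda>n. rep_form (\<lambda>x. c * f x) (r n) (s n)) \<longlonglongrightarrow> c * EM f v w"
      unfolding sigma_functional_cmult[OF rep_form_functional[OF rs(1,2)] f] by (intro tendsto_mult_left rs f)
    ultimately show "EM (\<lambda>x. c * f x) v w = c * EM f v w" by (rule LIMSEQ_unique)
    assume g: "g \<in> bounded_borel"
    have "(\<lambda>n. rep_form (\<lambda>x. f x + g x) (r n) (s n)) \<longlonglongrightarrow> EM (\<lambda>x. f x + g x) v w"
      by (intro rs bounded_borel_add f g)
    moreover have "(\<lambda>n. rep_form (\<lambda>x. f x + g x) (r n) (s n)) \<longlonglongrightarrow> EM f v w + EM g v w"
      unfolding sigma_functional_add[OF rep_form_functional[OF rs(1,2)] f g] by (intro tendsto_add rs f g)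
    ultimately show "EM (\<lambda>x. f x + g x) v w = EM f v w + EM g v w" by (rule LIMSEQ_unique)
  }
  fix u :: "nat \<Rightarrow> 'a \<Rightarrow> real" and f K
  assume u: "\<forall>n. u n \<in> borel_measurable borel" "\<forall>n x. \<bar>u n x\<bar> \<le> K" "\<forall>x. (\<lambda>n. u n x) \<longlonglongrightarrow> f x"
  have fb: "f \<in> bounded_borel" by (rule bounded_borel_lim[of u K f]) (use u in simp_all)
  have ub: "u n \<in> bounded_borel" for n by (rule bounded_borelI[of _ K]) (use u in simp_all)
  have fK: "\<bar>f x\<bar> \<le> K" for x
    by (rule LIMSEQ_le_const2[OF tendsto_rabs[OF u(3)[rule_format]]]) (use u(2) in auto)
  define \<delta> where "\<delta> k = 3 * K * norm (v - val (r k)) * norm w + 3 * K * norm (val (r k)) * norm (w - val (s k))" for k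
  have diff: "\<bar>EM \<phi> v w - rep_form \<phi> (r k) (s k)\<bar> \<le> \<delta> k" if \<phi>: "\<phi> \<in> bounded_borel" "\<And>x. \<bar>\<phi> x\<bar> \<le> K" for \<phi> k
  proof -
    have "EM \<phi> v w - rep_form \<phi> (r k) (s k) = EM \<phi> (v - val (r k)) w + EM \<phi> (val (r k)) (w - val (s k))"
      by (simp add: bounded_bilinear.diff_left[OF EM(1)[OF \<phi>(1)]] bounded_bilinear.diff_right[OF EM(1)[OF \<phi>(1)]]
        EM(2)[OF \<phi>(1) rs(1,2)])
    also have "\<bar>\<dots>\<bar> \<le> \<delta> k"
      unfolding \<delta>_def by (intro order_trans[OF abs_triangle_ineq] add_mono EM(3) \<phi>)
    finally show ?thesis .
  qed
  have "\<delta> \<longlonglongrightarrow> 3 * K * norm (v - v) * norm w + 3 * K * norm v * norm (w - w)"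
    unfolding \<delta>_def by (intro tendsto_intros rs)
  then have \<delta>0: "\<delta> \<longlonglongrightarrow> 0" by simp
  show "(\<lambda>n. EM (u n) v w) \<longlonglongrightarrow> EM f v w"
  proof (rule LIMSEQ_I)
    fix e :: real assume e: "0 < e"
    have "\<forall>\<^sub>F k in sequentially. \<delta> k < e / 3" using \<delta>0 e by (intro order_tendstoD(2)) auto
    then obtain k where k: "\<delta> k < e / 3" unfolding eventually_sequentially by auto
    have "(\<lambda>n. rep_form (u n) (r k) (s k)) \<longlonglongrightarrow> rep_form f (r k) (s k)"
      by (rule sigma_functional_lim[OF rep_form_functional[OF rs(1,2)], of u K f]) (use u in simp_all)
    then obtain N where N: "\<And>n. n \<ge> N \<Longrightarrow> \<bar>rep_form (u n) (r k) (s k) - rep_form f (r k) (s k)\<bar> < e / 3"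
      using LIMSEQ_D[of _ _ "e / 3"] e by (metis divide_pos_pos real_norm_def zero_less_numeral)
    show "\<exists>N. \<forall>n\<ge>N. norm (EM (u n) v w - EM f v w) < e"
    proof (intro exI[of _ N] allI impI)
      fix n assume n: "n \<ge> N"
      have "\<bar>EM (u n) v w - rep_form (u n) (r k) (s k)\<bar> \<le> \<delta> k" by (rule diff[OF ub]) (use u in simp)
      moreover have "\<bar>EM f v w - rep_form f (r k) (s k)\<bar> \<le> \<delta> k" by (rule diff[OF fb fK])
      ultimately show "norm (EM (u n) v w - EM f v w) < e" using N[OF n] k unfolding real_norm_def by linarith
    qed
  qed
qed

lemma EM_one: "EM (\<lambda>x. 1) v w = inner v w"
  by (rule bounded_bilinear_eq_dense[OF EM(1)[OF bounded_borel_const] bounded_bilinear_inner dense_val])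
    (simp add: EM(2)[OF bounded_borel_const] rep_form_one)

lemma EM_sym: "\<phi> \<in> bounded_borel \<Longrightarrow> EM \<phi> v w = EM \<phi> w v"
  by (rule bounded_bilinear_eq_dense[OF EM(1) bounded_bilinear.flip[OF EM(1)] dense_val])
    (simp_all add: EM(2) rep_form_sym)

lemma EM_nonneg:
  assumes \<phi>: "\<phi> \<in> bounded_borel" "\<And>x. 0 \<le> \<phi> x"
  shows "0 \<le> EM \<phi> v v"
proof -
  obtain r where r: "\<And>n::nat. r n \<in> reps" "(\<lambda>n. val (r n)) \<longlonglongrightarrow> v" using dense_image_sequence[OF dense_val] by metis
  have "(\<lambda>n. EM \<phi> (val (r n)) (val (r n))) \<longlonglongrightarrow> EM \<phi> v v" by (rule EM_tendsto[OF \<phi>(1) r(2,2)])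
  then show ?thesis by (rule LIMSEQ_le_const) (simp add: EM(2)[OF \<phi>(1)] r(1) rep_form_nonneg[OF \<phi>])
qed

lemma EM_mono:
  assumes "\<phi> \<in> bounded_borel" "\<psi> \<in> bounded_borel" "\<And>x. \<phi> x \<le> \<psi> x"
  shows "EM \<phi> v v \<le> EM \<psi> v v"
  using EM_nonneg[of "\<lambda>x. \<psi> x - \<phi> x" v] sigma_functional_diff[OF EM_functional assms(2,1), of v v] assms
  by (simp add: bounded_borel_diff)

lemma EM_simps:
  assumes "\<phi> \<in> bounded_borel"
  shows "EM \<phi> (v + v') w = EM \<phi> v w + EM \<phi> v' w" "EM \<phi> v (w + w') = EM \<phi> v w + EM \<phi> v w'"
    "EM \<phi> (v - v') w = EM \<phi> v w - EM \<phi> v' w" "EM \<phi> v (w - w') = EM \<phi> v w - EM \<phi> v w'"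
    "EM \<phi> (c *\<^sub>R v) w = c * EM \<phi> v w" "EM \<phi> v (c *\<^sub>R w) = c * EM \<phi> v w"
  using EM(1)[OF assms]
  by (simp_all add: bounded_bilinear.add_left bounded_bilinear.add_right bounded_bilinear.diff_left
    bounded_bilinear.diff_right bounded_bilinear.scaleR_left bounded_bilinear.scaleR_right)

lemma EM_Cauchy_Schwarz:
  assumes \<phi>: "\<phi> \<in> bounded_borel" "\<And>x. 0 \<le> \<phi> x"
  shows "EM \<phi> v w * EM \<phi> v w \<le> EM \<phi> v v * EM \<phi> w w"
proof (rule discriminant_le)
  fix t :: real
  show "0 \<le> EM \<phi> v v + 2 * t * EM \<phi> v w + t * t * EM \<phi> w w"
    using EM_nonneg[OF \<phi>, of "v + t *\<^sub>R w"] EM_sym[OF \<phi>(1), of w v]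
    by (simp add: EM_simps[OF \<phi>(1)] algebra_simps)
qed

section \<open>Multiplication of fields by continuous functions\<close>

definition T :: "('a \<Rightarrow> real) \<Rightarrow> 'h \<Rightarrow> 'h" where
  "T g = action C \<iota> g"

text \<open>The squared norm of the list multiplied by g is the \<open>rep_form\<close> with weight
  g^2, at most K^2 times the one with weight 1. Hence multiplication is bounded by \<open>K\<close>
  on values of lists, is well defined there, and extends.\<close>

lemma T:
  assumes g: "g \<in> Cc"
  shows "bounded_linear (T g)" and "\<And>g1 f. g1 \<in> Cc \<Longrightarrow> f \<in> C \<Longrightarrow> T g (gen g1 f) = gen (\<lambda>x. g x * g1 x) f"
    and "\<And>r. r \<in> reps \<Longrightarrow> T g (val r) = val (act g r)"
proof -
  define Q where "Q T \<longleftrightarrow> bounded_linear T \<and>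
     (\<forall>g1\<in>coefficients. \<forall>f\<in>C. T (\<iota> (simple_field g1 f)) = \<iota> (simple_field (\<lambda>x. g x * g1 x) f))" for T :: "'h \<Rightarrow> 'h"
  have Qval: "U (val r) = val (act g r)" if "Q U" "r \<in> reps" for U r
  proof -
    have lin: "linear U" using \<open>Q U\<close> unfolding Q_def by (simp add: bounded_linear.linear)
    show ?thesis using that(2)
    proof (induction r)
      case Nil
      show ?case by (simp add: val_def act_def linear_0[OF lin])
    next
      case (Cons a r)
      then have "U (gen (fst a) (snd a)) = gen (\<lambda>x. g x * fst a x) (snd a)"
        using \<open>Q U\<close> unfolding Q_def coefficients_eq gen_def by simp
      then show ?case using Cons by (simp add: val_def act_def linear_add[OF lin])
    qed
  qed
  have Quniq: "U = U'" if "Q U" "Q U'" for U U'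
  proof (intro ext)
    show "U v = U' v" for v
    proof (rule bounded_linear_eq_dense[of U U' val reps, OF _ _ dense_val])
      show "bounded_linear U" "bounded_linear U'" using that unfolding Q_def by simp_all
    qed (simp add: Qval that)
  qed
  obtain K where K: "\<And>x. \<bar>g x\<bar> \<le> K" "0 \<le> K" using Cc_bounded[OF g] by metis
  have gg: "(\<lambda>x. g x * g x) \<in> bounded_borel" by (intro Cc_bounded_borel Cc_simps g)
  have "\<exists>U. bounded_linear U \<and> (\<forall>r\<in>reps. U (val r) = val (act g r)) \<and> (\<forall>x. norm (U x) \<le> K * norm x)"
  proof (rule linear_extension_from_representatives[where pl = "(@)" and sc = "\<lambda>c. act (\<lambda>x. c)"])
    fix r s c assume r: "r \<in> reps"
    have c: "act g (act (\<lambda>x. c) r) = act (\<lambda>x. c) (act g r)"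
      by (simp add: act_def comp_def mult.left_commute)
    show "act (\<lambda>x. c) r \<in> reps \<and> val (act (\<lambda>x. c) r) = c *\<^sub>R val r \<and> val (act g (act (\<lambda>x. c) r)) = c *\<^sub>R val (act g r)"
      using r by (simp add: c act_reps Cc_simps val_scale g)
    have "(norm (val (act g r)))\<^sup>2 = rep_form (\<lambda>x. g x * g x) r r" by (simp add: rep_form_cont(3)[OF g r r])
    also have "\<dots> \<le> (K * K) * (norm (val r))\<^sup>2"
    proof (rule rep_form_upper[OF gg _ r])
      show "g x * g x \<le> K * K" for x
        using mult_mono[OF K(1)[of x] K(1)[of x]] K(2) by (simp flip: abs_mult)
    qed
    also have "\<dots> = (K * norm (val r))\<^sup>2" by (simp add: power2_eq_square)
    finally show "norm (val (act g r)) \<le> K * norm (val r)"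
      by (rule power2_le_imp_le) (use K(2) in simp)
    assume "s \<in> reps"
    then show "r @ s \<in> reps \<and> val (r @ s) = val r + val s \<and> val (act g (r @ s)) = val (act g r) + val (act g s)"
      using r by (simp add: val_append act_append)
  qed (rule dense_val)
  then obtain U where U: "bounded_linear U" "\<forall>r\<in>reps. U (val r) = val (act g r)" by auto
  have "U (gen g1 f) = gen (\<lambda>x. g x * g1 x) f" if "g1 \<in> Cc" "f \<in> C" for g1 f
    using U(2)[rule_format, of "[(g1, f)]"] that by (simp add: val_def act_def)
  then have "Q U" unfolding Q_def coefficients_eq gen_def using U(1) by simp
  then have "T g = U" unfolding T_def action_def Q_def[symmetric] using Quniq by (intro the_equality)
  then have QT: "Q (T g)" using \<open>Q U\<close> by simp
  show "bounded_linear (T g)" "\<And>g1 f. g1 \<in> Cc \<Longrightarrow> f \<in> C \<Longrightarrow> T g (gen g1 f) = gen (\<lambda>x. g x * g1 x) f"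
    using QT unfolding Q_def coefficients_eq gen_def by simp_all
  show "\<And>r. r \<in> reps \<Longrightarrow> T g (val r) = val (act g r)" by (rule Qval[OF QT])
qed

text \<open>On lists both sides are the same double sum; in terms of measures, g moves from the
  field into the density.\<close>

lemma EM_T:
  assumes \<phi>: "\<phi> \<in> bounded_borel" and g: "g \<in> Cc"
  shows "EM \<phi> (T g v) w = EM (\<lambda>x. \<phi> x * g x) v w"
proof (rule bounded_bilinear_eq_dense[OF bounded_bilinear.comp1[OF EM(1)[OF \<phi>] T(1)[OF g]] EM(1) dense_val])
  show b: "(\<lambda>x. \<phi> x * g x) \<in> bounded_borel" by (intro bounded_borel_mult \<phi> Cc_bounded_borel g)
  fix r s assume "r \<in> reps" "s \<in> reps"
  then show "EM \<phi> (T g (val r)) (val s) = EM (\<lambda>x. \<phi> x * g x) (val r) (val s)"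
    by (simp add: T(3)[OF g] EM(2)[OF \<phi>] EM(2)[OF b] act_reps g) (simp add: rep_form_def act_def comp_def mult.assoc)
qed

lemma inner_T: "g \<in> Cc \<Longrightarrow> inner (T g v) w = EM g v w"
  using EM_T[OF bounded_borel_const, of g 1 v w] by (simp add: EM_one)

lemma inner_T_T: "g \<in> Cc \<Longrightarrow> h \<in> Cc \<Longrightarrow> inner (T g v) (T h w) = EM (\<lambda>x. g x * h x) v w"
proof -
  assume g: "g \<in> Cc" and h: "h \<in> Cc"
  have "inner (T g v) (T h w) = EM g v (T h w)" by (rule inner_T[OF g])
  also have "\<dots> = EM g (T h w) v" by (rule EM_sym[OF Cc_bounded_borel[OF g]])
  also have "\<dots> = EM (\<lambda>x. g x * h x) w v" by (rule EM_T[OF Cc_bounded_borel[OF g] h])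
  also have "\<dots> = EM (\<lambda>x. g x * h x) v w" by (rule EM_sym) (intro Cc_bounded_borel Cc_simps g h)
  finally show ?thesis .
qed

lemma T_linear: "g \<in> Cc \<Longrightarrow> linear (T g)"
  using T(1) by (rule bounded_linear.linear)

lemma eq_inner: "(\<And>w. inner (v::'h) w = inner v' w) \<Longrightarrow> v = v'"
  by (metis inner_commute vector_eq_ldot)

text \<open>Testing against \<open>w\<close> turns the action into the integral of \<open>g\<close>,
  so the rules for \<open>T\<close> in its function argument are linearity of \<open>EM\<close> in
  the integrand.\<close>

lemma T_add: "g \<in> Cc \<Longrightarrow> h \<in> Cc \<Longrightarrow> T (\<lambda>x. g x + h x) v = T g v + T h v"
  by (rule eq_inner) (simp add: inner_add_left inner_T Cc_simps sigma_functional_add[OF EM_functional] Cc_bounded_borel)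

lemma T_cmult: "g \<in> Cc \<Longrightarrow> T (\<lambda>x. c * g x) v = c *\<^sub>R T g v"
  by (rule eq_inner) (simp add: inner_T Cc_simps sigma_functional_cmult[OF EM_functional] Cc_bounded_borel)

lemma T_diff: "g \<in> Cc \<Longrightarrow> h \<in> Cc \<Longrightarrow> T (\<lambda>x. g x - h x) v = T g v - T h v"
  by (rule eq_inner) (simp add: inner_diff_left inner_T Cc_simps sigma_functional_diff[OF EM_functional] Cc_bounded_borel)

lemma T_mult: "g \<in> Cc \<Longrightarrow> h \<in> Cc \<Longrightarrow> T g (T h v) = T (\<lambda>x. g x * h x) v"
  by (rule eq_inner) (simp add: inner_T EM_T Cc_simps Cc_bounded_borel)

lemma T_const: "T (\<lambda>x. c) v = c *\<^sub>R v"
  by (rule eq_inner) (use sigma_functional_cmult[OF EM_functional bounded_borel_const, of c 1]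
    in \<open>simp add: inner_T Cc_simps EM_one\<close>)

definition field_measure :: "'h \<Rightarrow> 'a measure" where
  "field_measure v = as_measure (field_energy_measure C \<nu> \<iota> v v)"

lemma field_measure:
  shows "sets (field_measure v) = sets borel" "space (field_measure v) = UNIV"
    and "A \<in> sets borel \<Longrightarrow> emeasure (field_measure v) A = ennreal (EM (indicator A) v v)"
    and "finite_measure (field_measure v)"
    and "f \<in> bounded_borel \<Longrightarrow> (\<integral>x. f x \<partial>field_measure v) = EM f v v"
proof -
  have eq: "field_measure v = as_measure (\<lambda>A. EM (indicator A) v v)"
    unfolding field_measure_def field_energy_measure_eq ..
  have nonneg: "0 \<le> EM (indicator A) v v" if "A \<in> sets borel" for A
    by (rule EM_nonneg) (use that bounded_borel_indicator in auto)
  note m = as_measure_sigma_functional[OF EM_functional nonneg, folded eq]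
  show "sets (field_measure v) = sets borel" by (rule m)
  then show "space (field_measure v) = UNIV" using sets_eq_imp_space_eq[OF m(1)] by simp
  show "A \<in> sets borel \<Longrightarrow> emeasure (field_measure v) A = ennreal (EM (indicator A) v v)" by (rule m)
  show "finite_measure (field_measure v)" by (rule m)
  show "f \<in> bounded_borel \<Longrightarrow> (\<integral>x. f x \<partial>field_measure v) = EM f v v" by (rule m)
qed

section \<open>Calculus of the gradient\<close>

abbreviation D :: "('a \<Rightarrow> real) \<Rightarrow> 'h" where "D \<equiv> gradient \<iota>"

lemma D_gen: "D f = gen (\<lambda>x. 1) f"
proof -
  have "universal_deriv f = simple_field (\<lambda>x. 1) f" unfolding simple_field_def mean_ext_def by auto
  then show ?thesis unfolding gradient_def gen_def by simp
qed

lemma universal_deriv_span: "f \<in> C \<Longrightarrow> universal_deriv f \<in> field_span C"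
proof -
  assume f: "f \<in> C"
  have "universal_deriv f = simple_field (\<lambda>x. 1) f" unfolding simple_field_def mean_ext_def by auto
  then show ?thesis using simple_field_span[OF Cc_simps(1) f, of 1] by simp
qed

lemma D_add: "f \<in> C \<Longrightarrow> g \<in> C \<Longrightarrow> D (\<lambda>x. f x + g x) = D f + D g"
proof -
  assume fg: "f \<in> C" "g \<in> C"
  have "universal_deriv (\<lambda>x. f x + g x) = (\<lambda>z. universal_deriv f z + universal_deriv g z)"
    unfolding universal_deriv_def by auto
  then show ?thesis unfolding gradient_def using \<iota>_add[OF universal_deriv_span universal_deriv_span, OF fg] by simp
qed

lemma D_scale: "f \<in> C \<Longrightarrow> D (\<lambda>x. c * f x) = c *\<^sub>R D f"
proof -
  assume f: "f \<in> C"
  have "universal_deriv (\<lambda>x. c * f x) = (\<lambda>z. c * universal_deriv f z)"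
    unfolding universal_deriv_def by (auto simp: algebra_simps)
  then show ?thesis unfolding gradient_def using \<iota>_scale[OF universal_deriv_span[OF f], of c] by simp
qed

lemma D_diff: "f \<in> C \<Longrightarrow> g \<in> C \<Longrightarrow> D (\<lambda>x. f x - g x) = D f - D g"
  using D_add[of f "\<lambda>x. -1 * g x"] C_scale[of g "-1"] D_scale[of g "-1"] by simp

lemma D_const: "D (\<lambda>x. c) = 0"
proof -
  have "universal_deriv (\<lambda>x::'a. c) = (\<lambda>z. 0 * universal_deriv (\<lambda>x::'a. 1) z)"
    unfolding universal_deriv_def by auto
  then show ?thesis unfolding gradient_def using \<iota>_scale[OF universal_deriv_span[OF one_C], of 0] by simp
qed

lemma T_D: "g \<in> Cc \<Longrightarrow> f \<in> C \<Longrightarrow> T g (D f) = gen g f"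
  unfolding D_gen using T(2)[of g "\<lambda>x. 1" f] by (simp add: Cc_simps)

text \<open>An exact identity in two variables: f(x) g(x) - f(y) g(y) is the sum of the two products
  of a mean with a difference. This is what the symmetric average in \<open>mean_ext\<close>
  achieves.\<close>

lemma Leibniz:
  assumes f: "f \<in> C" and g: "g \<in> C"
  shows "D (\<lambda>x. f x * g x) = T f (D g) + T g (D f)"
proof -
  have "universal_deriv (\<lambda>x. f x * g x) = (\<lambda>z. simple_field f g z + simple_field g f z)"
    unfolding universal_deriv_def simple_field_def mean_ext_def by (auto simp: fun_eq_iff field_simps)
  then show ?thesis
    unfolding T_D[OF C_Cc[OF f] g] T_D[OF C_Cc[OF g] f] unfolding gradient_def gen_def
    using \<iota>_add[OF simple_field_span[OF C_Cc[OF f] g] simple_field_span[OF C_Cc[OF g] f]] by simp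
qed

text \<open>Inserting the constant 1 into the formula for \<open>\<nu> f g\<close> leaves E(f,g)
  minus half of E(f g, 1), and the latter vanishes by locality, 1 being constant near every
  support.\<close>

lemma E_eq:
  assumes f: "f \<in> C" and g: "g \<in> C"
  shows "E f g = inner (D f) (D g)"
proof -
  have "\<exists>U c. open U \<and> closure {x. f x * g x \<noteq> 0} \<subseteq> U \<and> (\<forall>x\<in>U. (\<lambda>x::'a. 1::real) x = c)"
    by (intro exI[of _ UNIV] exI[of _ 1]) auto
  then have "E (\<lambda>x. f x * g x) (\<lambda>x. 1) = 0"
    using admissible C_mult[OF f g] one_C unfolding admissible_form_def by simp
  moreover have "signed_integral (\<nu> f g) (\<lambda>x. 1) =
      1/2 * (E (\<lambda>x. f x * 1) g + E f (\<lambda>x. g x * 1) - E (\<lambda>x. f x * g x) (\<lambda>x. 1))"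
    using energy f g one_C unfolding energy_measures_def by blast
  moreover have "inner (D f) (D g) = signed_integral (\<nu> f g) (\<lambda>x. 1)"
    unfolding D_gen using gen_inner[OF Cc_simps(1) Cc_simps(1) f g, of 1 1] by simp
  ultimately show ?thesis by simp
qed

lemma EM_D:
  assumes "\<phi> \<in> bounded_borel" "f \<in> C" "g \<in> C"
  shows "EM \<phi> (D f) (D g) = signed_integral (\<nu> f g) \<phi>"
  using EM(2)[OF assms(1), of "[(\<lambda>x. 1, f)]" "[(\<lambda>x. 1, g)]"] assms
  by (simp add: val_def rep_form_def D_gen Cc_simps)

lemma EM_indicator_D: "A \<in> sets borel \<Longrightarrow> f \<in> C \<Longrightarrow> g \<in> C \<Longrightarrow> EM (indicator A) (D f) (D g) = \<nu> f g A"
  by (simp add: EM_D bounded_borel_indicator signed_integral_indicator \<nu>_signed)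

text \<open>Cauchy-Schwarz kills all pairings with a gradient; multiplying it by a continuous g
  changes its energy measure by the bounded factor g^2; and finite sums of such fields are dense.
  Null sets can thus be tested on gradients alone.\<close>

lemma EM_null:
  assumes A: "A \<in> sets borel" and null: "\<And>f. f \<in> C \<Longrightarrow> EM (indicator A) (D f) (D f) = 0"
  shows "EM (indicator A) v w = 0"
proof -
  have I: "indicator A \<in> bounded_borel" "\<And>x. 0 \<le> (indicator A x :: real)"
    using bounded_borel_indicator[OF A] by auto
  have 1: "EM (indicator A) (D f) w = 0" if "f \<in> C" for f w
    using EM_Cauchy_Schwarz[OF I, of "D f" w] null[OF that] zero_le_square[of "EM (indicator A) (D f) w"] by auto
  have 2: "EM (indicator A) (gen g f) w = 0" if g: "g \<in> Cc" and f: "f \<in> C" for g f w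
  proof -
    have "EM (indicator A) (gen g f) w = EM (indicator A) w (T g (D f))"
      unfolding T_D[OF g f] by (rule EM_sym[OF I(1)])
    obtain K where K: "\<And>x. \<bar>g x\<bar> \<le> K" "0 \<le> K" using Cc_bounded[OF g] by metis
    have b: "(\<lambda>x. indicator A x * g x) \<in> bounded_borel" by (intro bounded_borel_mult I Cc_bounded_borel g)
    have "EM (indicator A) (gen g f) (gen g f) = EM (indicator A) (T g (D f)) (T g (D f))" by (simp add: T_D g f)
    also have "\<dots> = EM (\<lambda>x. indicator A x * g x) (D f) (T g (D f))" by (rule EM_T[OF I(1) g])
    also have "\<dots> = EM (\<lambda>x. indicator A x * g x) (T g (D f)) (D f)" by (rule EM_sym[OF b])
    also have "\<dots> = EM (\<lambda>x. indicator A x * g x * g x) (D f) (D f)" by (rule EM_T[OF b g])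
    also have "\<dots> \<le> EM (\<lambda>x. (K * K) * indicator A x) (D f) (D f)"
    proof (rule EM_mono)
      show "(\<lambda>x. indicator A x * g x * g x) \<in> bounded_borel" by (intro bounded_borel_mult[OF b] Cc_bounded_borel g)
      show "(\<lambda>x. (K * K) * indicator A x) \<in> bounded_borel" by (intro bounded_borel_cmult I)
      show "indicator A x * g x * g x \<le> (K * K) * indicator A x" for x
        using mult_mono[OF K(1)[of x] K(1)[of x]] K(2) by (auto simp: indicator_def simp flip: abs_mult)
    qed
    also have "\<dots> = (K * K) * EM (indicator A) (D f) (D f)" by (rule sigma_functional_cmult[OF EM_functional I(1)])
    finally have "EM (indicator A) (gen g f) (gen g f) \<le> 0" using null[OF f] by simp
    then have "EM (indicator A) (gen g f) (gen g f) = 0" using EM_nonneg[OF I, of "gen g f"] by simp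
    then show ?thesis
      using EM_Cauchy_Schwarz[OF I, of "gen g f" w] zero_le_square[of "EM (indicator A) (gen g f) w"] by auto
  qed
  have "EM (indicator A) v w = (\<lambda>v w. 0) v w"
  proof (rule bounded_bilinear_eq_dense[OF EM(1)[OF I(1)] _ dense_val])
    show "bounded_bilinear (\<lambda>(v::'h) (w::'h). 0::real)" by (rule bounded_bilinear.intro) (auto intro: exI[of _ 0])
    fix r s assume r: "r \<in> reps" and "s \<in> reps"
    show "EM (indicator A) (val r) (val s) = 0"
      using r by (induction r) (simp_all add: val_def EM_simps[OF I(1)] 2 bounded_bilinear.zero_left[OF EM(1)[OF I(1)]])
  qed
  then show ?thesis by simp
qed

end

section \<open>Complete forms\<close>

text \<open>Each power h^i with i \<le> n is at least h^n, and the sum of these n + 1 powers times 1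
  - h telescopes. The bound, uniform in n, controls the derivative of t (1 - t^2)^(n+1).\<close>

lemma power_derivative_bound:
  fixes h :: real
  assumes "0 \<le> h" "h \<le> 1"
  shows "real (Suc n) * (1 - h) * h ^ n \<le> 1"
proof -
  have "real (Suc n) * h ^ n = (\<Sum>i<Suc n. h ^ n)" by simp
  also have "\<dots> \<le> (\<Sum>i<Suc n. h ^ i)"
    by (rule sum_mono) (use assms in \<open>auto intro: power_decreasing\<close>)
  finally have "(1 - h) * (real (Suc n) * h ^ n) \<le> (1 - h) * (\<Sum>i<Suc n. h ^ i)"
    using assms by (intro mult_left_mono) auto
  also have "\<dots> = 1 - h ^ Suc n" by (rule one_diff_power_eq[symmetric])
  also have "\<dots> \<le> 1" using assms by simp
  finally show ?thesis by (simp add: mult.left_commute mult.assoc)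
qed

locale complete_compact_form = compact_form E C \<nu> \<iota>
  for E :: "('a::metric_space \<Rightarrow> real) \<Rightarrow> ('a \<Rightarrow> real) \<Rightarrow> real" and C :: "('a \<Rightarrow> real) set"
    and \<nu> :: "('a \<Rightarrow> real) \<Rightarrow> ('a \<Rightarrow> real) \<Rightarrow> 'a set \<Rightarrow> real"
    and \<iota> :: "('a \<times> 'a \<Rightarrow> real) \<Rightarrow> 'h::{real_inner, complete_space}" +
  fixes p :: 'a
  assumes complete: "complete_form E C \<iota> p"
begin

section \<open>Uniform bounds and closedness of the set of gradients\<close>

lemma sup_norm_upper: "f \<in> Cc \<Longrightarrow> \<bar>f (x::'a)\<bar> \<le> sup_norm f"
proof -
  assume "f \<in> Cc"
  then obtain K where K: "\<And>x. \<bar>f x\<bar> \<le> K" using Cc_bounded by metis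
  have "bdd_above (range (\<lambda>x. \<bar>f x\<bar>))" by (rule bdd_aboveI2[of _ _ K]) (rule K)
  then show ?thesis unfolding sup_norm_def by (intro cSUP_upper) simp_all
qed

lemma uniformly_dense:
  assumes "f \<in> Cc" "0 < e"
  shows "\<exists>g\<in>C. \<forall>x. \<bar>f x - g x\<bar> < e"
proof -
  obtain g where g: "g \<in> C" "sup_norm (\<lambda>x. f x - g x) < e"
    using admissible assms unfolding admissible_form_def by metis
  have "\<bar>f x - g x\<bar> < e" for x
    using sup_norm_upper[OF Cc_simps(4)[OF assms(1) C_Cc[OF g(1)]], of x] g(2) by linarith
  then show ?thesis using g(1) by auto
qed

lemma D_zero: "f \<in> C \<Longrightarrow> D f = 0 \<Longrightarrow> f x = f y"
proof -
  assume "f \<in> C" "D f = 0"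
  then have "f \<in> range (\<lambda>c x. c)" using complete unfolding complete_form_def by blast
  then show ?thesis by auto
qed

lemma norm_D: "f \<in> C \<Longrightarrow> sqrt (E f f) = norm (D f)"
  by (simp add: E_eq norm_eq_sqrt_inner)

lemma sup_bound_ex: "\<exists>c. \<forall>f\<in>C. \<forall>x. \<bar>f x - f p\<bar> \<le> c * norm (D f)"
proof -
  obtain c where c: "\<forall>f\<in>C. f p = 0 \<longrightarrow> sup_norm f \<le> c * sqrt (E f f)"
    using complete unfolding complete_form_def by auto
  have "\<bar>f x - f p\<bar> \<le> c * norm (D f)" if f: "f \<in> C" for f x
  proof -
    have g: "(\<lambda>x. f x - f p) \<in> C" by (rule C_diff[OF f C_const])
    have "\<bar>f x - f p\<bar> \<le> sup_norm (\<lambda>x. f x - f p)" using sup_norm_upper[OF C_Cc[OF g]] .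
    also have "\<dots> \<le> c * norm (D (\<lambda>x. f x - f p))" using c g by (simp add: norm_D)
    also have "D (\<lambda>x. f x - f p) = D f" by (simp add: D_diff f C_const D_const)
    finally show ?thesis .
  qed
  then show ?thesis by auto
qed

definition c_sup :: real where
  "c_sup = (SOME c. \<forall>f\<in>C. \<forall>x. \<bar>f x - f p\<bar> \<le> c * norm (D f))"

lemma sup_bound: "f \<in> C \<Longrightarrow> \<bar>f x - f p\<bar> \<le> c_sup * norm (D f)"
  using someI_ex[OF sup_bound_ex] unfolding c_sup_def by blast

text \<open>The squared distance of two gradients is the energy of the difference, so completeness,
  phrased through E on functions vanishing at \<open>p\<close>, becomes convergence in
  \<open>'h\<close>.\<close>

lemma complete_limit:
  assumes u: "\<And>n::nat. u n \<in> C" "\<And>n. u n p = 0" and cauchy: "Cauchy (\<lambda>n. D (u n))"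
  obtains f where "f \<in> C" "f p = 0" "(\<lambda>n. D (u n)) \<longlonglongrightarrow> D f"
proof -
  have Ed: "E (\<lambda>x. f x - g x) (\<lambda>x. f x - g x) = (norm (D f - D g))\<^sup>2" if "f \<in> C" "g \<in> C" for f g
    using that by (simp add: E_eq C_diff D_diff power2_norm_eq_inner)
  have lim: "\<forall>e>0. \<exists>N::nat. \<forall>m\<ge>N. \<forall>n\<ge>N. E (\<lambda>x. u m x - u n x) (\<lambda>x. u m x - u n x) < e"
  proof (intro allI impI)
    fix e :: real assume e: "0 < e"
    then obtain N where N: "\<forall>m\<ge>N. \<forall>n\<ge>N. norm (D (u m) - D (u n)) < sqrt e"
      using CauchyD[OF cauchy, of "sqrt e"] by auto
    have "E (\<lambda>x. u m x - u n x) (\<lambda>x. u m x - u n x) < e" if "m \<ge> N" "n \<ge> N" for m n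
    proof -
      have "(norm (D (u m) - D (u n)))\<^sup>2 < (sqrt e)\<^sup>2" using N that by (intro power_strict_mono) auto
      then show ?thesis using e by (simp add: Ed u)
    qed
    then show "\<exists>N::nat. \<forall>m\<ge>N. \<forall>n\<ge>N. E (\<lambda>x. u m x - u n x) (\<lambda>x. u m x - u n x) < e" by auto
  qed
  have H: "\<forall>u. (\<forall>n. u n \<in> C \<and> u n p = 0) \<longrightarrow>
      (\<forall>\<epsilon>>0. \<exists>N::nat. \<forall>m\<ge>N. \<forall>n\<ge>N. E (\<lambda>x. u m x - u n x) (\<lambda>x. u m x - u n x) < \<epsilon>) \<longrightarrow>
      (\<exists>f\<in>C. f p = 0 \<and> (\<lambda>n. E (\<lambda>x. u n x - f x) (\<lambda>x. u n x - f x)) \<longlonglongrightarrow> 0)"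
    using complete unfolding complete_form_def by (elim conjE)
  have "\<exists>f\<in>C. f p = 0 \<and> (\<lambda>n. E (\<lambda>x. u n x - f x) (\<lambda>x. u n x - f x)) \<longlonglongrightarrow> 0"
    using H[THEN spec, of u, THEN mp, THEN mp, OF _ lim] u by simp
  then obtain f where f: "f \<in> C" "f p = 0" "(\<lambda>n. E (\<lambda>x. u n x - f x) (\<lambda>x. u n x - f x)) \<longlonglongrightarrow> 0"
    by auto
  have "(\<lambda>n. sqrt ((norm (D (u n) - D f))\<^sup>2)) \<longlonglongrightarrow> sqrt 0"
    using f(3) unfolding Ed[OF u(1) f(1)] by (rule tendsto_real_sqrt)
  then have "(\<lambda>n. D (u n)) \<longlonglongrightarrow> D f" by (simp add: tendsto_norm_zero_iff LIM_zero_iff)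
  then show thesis using f(1,2) by (intro that)
qed

text \<open>Subtracting the value at \<open>p\<close> leaves the gradient unchanged and brings the
  functions under the completeness hypothesis. Closedness is what later provides projections onto
  gradients.\<close>

lemma D_closed: "closed (D ` C)"
  unfolding closed_sequential_limits
proof (intro allI impI)
  fix s v assume s: "(\<forall>n. s n \<in> D ` C) \<and> s \<longlonglongrightarrow> v"
  then have "\<forall>n. \<exists>f. f \<in> C \<and> s n = D f" by auto
  then obtain f where f: "\<And>n. f n \<in> C" "\<And>n. s n = D (f n)" by metis
  have Du: "D (\<lambda>x. f n x - f n p) = s n" for n by (simp add: D_diff f C_const D_const)
  obtain g where "g \<in> C" "(\<lambda>n. D (\<lambda>x. f n x - f n p)) \<longlonglongrightarrow> D g"
    by (rule complete_limit[of "\<lambda>n x. f n x - f n p"])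
      (use s in \<open>auto simp: Du C_diff[OF f(1) C_const] intro: LIMSEQ_imp_Cauchy\<close>)
  then show "v \<in> D ` C" using s unfolding Du by (metis LIMSEQ_unique imageI)
qed

text \<open>Induction with the product rule takes the place of a chain rule.\<close>

lemma D_power:
  assumes h: "h \<in> C"
  shows "(\<lambda>x. h x ^ n) \<in> C" "D (\<lambda>x. h x ^ Suc n) = T (\<lambda>x. real (Suc n) * h x ^ n) (D h)"
proof -
  have C: "(\<lambda>x. h x ^ n) \<in> C" for n
    by (induction n) (simp_all add: C_const C_mult h)
  then show "(\<lambda>x. h x ^ n) \<in> C" .
  show "D (\<lambda>x. h x ^ Suc n) = T (\<lambda>x. real (Suc n) * h x ^ n) (D h)"
  proof (induction n)
    case 0
    then show ?case by (simp add: T_const)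
  next
    case (Suc n)
    have "D (\<lambda>x. h x * h x ^ Suc n) = T h (D (\<lambda>x. h x ^ Suc n)) + T (\<lambda>x. h x ^ Suc n) (D h)"
      by (rule Leibniz[OF h C])
    also have "T h (D (\<lambda>x. h x ^ Suc n)) = T (\<lambda>x. h x * (real (Suc n) * h x ^ n)) (D h)"
      unfolding Suc by (intro T_mult C_Cc h C_scale C)
    also have "\<dots> + T (\<lambda>x. h x ^ Suc n) (D h) = T (\<lambda>x. h x * (real (Suc n) * h x ^ n) + h x ^ Suc n) (D h)"
      by (rule T_add[symmetric]) (intro C_Cc h C_mult C_scale C)+
    also have "(\<lambda>x. h x * (real (Suc n) * h x ^ n) + h x ^ Suc n) = (\<lambda>x. real (Suc (Suc n)) * h x ^ Suc n)"
      by (simp add: fun_eq_iff algebra_simps)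
    finally show ?case by simp
  qed
qed

text \<open>Apply the chain rule to \<open>f (1 - f\<^sup>2)\<^sup>n\<close>: these functions tend to zero pointwise, whereas their
  gradients converge to the restriction of \<open>\<partial>f\<close> to the zero set of \<open>f\<close>.  By completeness the limit
  of the gradients has to vanish.\<close>

lemma energy_zero_set:
  assumes f: "f \<in> C" and f1: "\<And>x. \<bar>f x\<bar> \<le> 1"
  shows "EM (indicator {x. f x = 0}) (D f) (D f) = 0"
proof -
  define h where "h = (\<lambda>x. 1 - f x * f x)"
  have h: "h \<in> C" unfolding h_def by (intro C_diff C_const C_mult f)
  have h01: "0 \<le> h x" "h x \<le> 1" for x
    unfolding h_def using mult_mono[OF f1[of x] f1[of x]] by (simp_all flip: abs_mult)
  have fCc: "f \<in> Cc" using f C_Cc by auto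
  have hn: "(\<lambda>x. h x ^ n) \<in> C" for n by (rule D_power[OF h])
  define w where "w n = (\<lambda>x. f x * h x ^ Suc n)" for n
  \<comment> \<open>The derivative of t (1 - t^2)^(n+1) at t = f(x), with its second summand grouped
    in the way the product rule and \<open>T_mult\<close> assemble it.\<close>
  define \<phi> where "\<phi> n = (\<lambda>x. h x ^ Suc n + (- 2) * (f x * (real (Suc n) * h x ^ n * f x)))" for n
  define I where "I = (indicator {x. f x = 0} :: 'a \<Rightarrow> real)"
  let ?v = "D f"
  have w: "w n \<in> C" for n unfolding w_def by (intro C_mult f hn)
  have g: "(\<lambda>x. real (Suc n) * h x ^ n) \<in> Cc" for n by (intro C_Cc C_scale hn)
  have \<phi>Cc: "\<phi> n \<in> Cc" for n
    unfolding \<phi>_def by (intro Cc_simps C_Cc[OF hn] g fCc)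
  have Dh: "D h = (- 2) *\<^sub>R T f ?v"
    unfolding h_def by (simp add: D_diff C_const C_mult f D_const Leibniz flip: scaleR_2)
  have Dw: "D (w n) = T (\<phi> n) ?v" for n
  proof -
    have "D (w n) = T f (D (\<lambda>x. h x ^ Suc n)) + T (\<lambda>x. h x ^ Suc n) ?v"
      unfolding w_def by (rule Leibniz[OF f hn])
    also have "D (\<lambda>x. h x ^ Suc n) = (- 2) *\<^sub>R T (\<lambda>x. real (Suc n) * h x ^ n * f x) ?v"
      unfolding D_power(2)[OF h] Dh linear_scale[OF T_linear[OF g]] T_mult[OF g fCc] ..
    also have "T f ((- 2) *\<^sub>R T (\<lambda>x. real (Suc n) * h x ^ n * f x) ?v) =
        T (\<lambda>x. (- 2) * (f x * (real (Suc n) * h x ^ n * f x))) ?v"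
      unfolding linear_scale[OF T_linear[OF fCc]] T_mult[OF fCc Cc_simps(3)[OF g fCc]]
      by (rule T_cmult[symmetric]) (intro Cc_simps g fCc)
    also have "\<dots> + T (\<lambda>x. h x ^ Suc n) ?v = T (\<phi> n) ?v"
      unfolding \<phi>_def T_add[OF C_Cc[OF hn] Cc_simps(3)[OF Cc_simps(1) Cc_simps(3)[OF fCc Cc_simps(3)[OF g fCc]]]]
      by (rule add.commute)
    finally show ?thesis .
  qed
  have ff: "f x * f x = 1 - h x" for x unfolding h_def by simp
  have \<phi>eq: "\<phi> n x = h x ^ Suc n - 2 * (real (Suc n) * (1 - h x) * h x ^ n)" for n x
    unfolding \<phi>_def ff[symmetric] by (simp add: algebra_simps)
  \<comment> \<open>Since f^2 = 1 - h, the two terms are bounded by 1 and by 2.\<close>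
  have \<phi>3: "\<bar>\<phi> n x\<bar> \<le> 3" for n x
  proof -
    have "0 \<le> h x ^ Suc n" "h x ^ Suc n \<le> 1" by (rule zero_le_power power_le_one, (rule h01)+)+
    moreover have "real (Suc n) * (1 - h x) * h x ^ n \<le> 1" by (rule power_derivative_bound[OF h01])
    moreover have "0 \<le> real (Suc n) * (1 - h x) * h x ^ n" using h01[of x] by (intro mult_nonneg_nonneg) auto
    ultimately show ?thesis unfolding \<phi>eq by linarith
  qed
  have pow0: "(\<lambda>n. h x ^ Suc n) \<longlonglongrightarrow> 0" "(\<lambda>n. real (Suc n) * h x ^ n) \<longlonglongrightarrow> 0" if "f x \<noteq> 0" for x
  proof -
    have "0 < f x * f x" using that by (simp add: less_le)
    then have h1: "norm (h x) < 1" using h01[of x] unfolding h_def by simp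
    then have p: "(\<lambda>n. h x ^ n) \<longlonglongrightarrow> 0" by (rule LIMSEQ_power_zero)
    then show "(\<lambda>n. h x ^ Suc n) \<longlonglongrightarrow> 0" by (rule LIMSEQ_Suc)
    have "(\<lambda>n. real n * h x ^ n + h x ^ n) \<longlonglongrightarrow> 0 + 0"
      by (intro tendsto_add p powser_times_n_limit_0[OF h1])
    then show "(\<lambda>n. real (Suc n) * h x ^ n) \<longlonglongrightarrow> 0" by (simp add: algebra_simps)
  qed
  have \<phi>lim: "(\<lambda>n. \<phi> n x) \<longlonglongrightarrow> I x" for x
  proof (cases "f x = 0")
    case True
    then have "h x = 1" unfolding h_def by simp
    then show ?thesis using True unfolding \<phi>eq I_def by simp
  next
    case False
    have "(\<lambda>n. h x ^ Suc n - 2 * (1 - h x) * (real (Suc n) * h x ^ n)) \<longlonglongrightarrow> 0 - 2 * (1 - h x) * 0"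
      by (intro tendsto_diff tendsto_mult_left pow0 False)
    moreover have "(\<lambda>n. \<phi> n x) = (\<lambda>n. h x ^ Suc n - 2 * (1 - h x) * (real (Suc n) * h x ^ n))"
      unfolding \<phi>eq by (simp add: fun_eq_iff)
    ultimately show ?thesis using False unfolding I_def by simp
  qed
  have wlim: "(\<lambda>n. w n x) \<longlonglongrightarrow> 0" for x
  proof (cases "f x = 0")
    case False
    then show ?thesis unfolding w_def using tendsto_mult_left[OF pow0(1)[OF False], of "f x"] by simp
  qed (simp add: w_def)
  have Ib: "I \<in> bounded_borel"
    by (rule bounded_borel_lim[of \<phi> 3]) (use \<phi>3 \<phi>lim bounded_borel_measurable[OF Cc_bounded_borel[OF \<phi>Cc]] in auto)
  have \<phi>b: "\<phi> n \<in> bounded_borel" for n by (rule Cc_bounded_borel[OF \<phi>Cc])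
  \<comment> \<open>\<open>I\<close> need not be continuous, while only continuous functions act on
    fields. The Cauchy property is therefore measured by the squared L^2 distance of
    \<open>\<phi> n\<close> to \<open>I\<close> for the energy measure of f.\<close>
  define a where "a n = EM (\<lambda>x. (\<phi> n x - I x) * (\<phi> n x - I x)) ?v ?v" for n
  have db: "(\<lambda>x. (\<phi> n x - I x) * (\<phi> n x - I x)) \<in> bounded_borel" for n
    by (intro bounded_borel_mult bounded_borel_diff \<phi>b Ib)
  have "a \<longlonglongrightarrow> EM (\<lambda>x. 0) ?v ?v"
    unfolding a_def
  proof (rule sigma_functional_lim[OF EM_functional, of "\<lambda>n x. (\<phi> n x - I x) * (\<phi> n x - I x)" 16])
    show "(\<lambda>x. (\<phi> n x - I x) * (\<phi> n x - I x)) \<in> borel_measurable borel" for n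
      by (rule bounded_borel_measurable[OF db])
    show "\<bar>(\<phi> n x - I x) * (\<phi> n x - I x)\<bar> \<le> 16" for n x
    proof -
      have "\<bar>\<phi> n x - I x\<bar> \<le> 4" using \<phi>3[of n x] unfolding I_def indicator_def by auto
      then have "\<bar>\<phi> n x - I x\<bar> * \<bar>\<phi> n x - I x\<bar> \<le> 4 * 4" by (intro mult_mono) auto
      then show ?thesis by (simp add: abs_mult)
    qed
    have "(\<lambda>n. (\<phi> n x - I x) * (\<phi> n x - I x)) \<longlonglongrightarrow> (I x - I x) * (I x - I x)" for x
      by (intro tendsto_mult tendsto_diff tendsto_const \<phi>lim)
    then show "(\<lambda>n. (\<phi> n x - I x) * (\<phi> n x - I x)) \<longlonglongrightarrow> 0" for x by simp
  qed
  then have a0: "a \<longlonglongrightarrow> 0" by (simp add: sigma_functional_zero[OF EM_functional])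
  have dist: "(norm (D (w m) - D (w n)))\<^sup>2 \<le> 2 * a m + 2 * a n" for m n
  proof -
    have "D (w m) - D (w n) = T (\<lambda>x. \<phi> m x - \<phi> n x) ?v"
      unfolding Dw by (rule T_diff[OF \<phi>Cc \<phi>Cc, symmetric])
    then have "(norm (D (w m) - D (w n)))\<^sup>2 = EM (\<lambda>x. (\<phi> m x - \<phi> n x) * (\<phi> m x - \<phi> n x)) ?v ?v"
      using inner_T_T[OF Cc_simps(4)[OF \<phi>Cc[of m] \<phi>Cc[of n]] Cc_simps(4)[OF \<phi>Cc[of m] \<phi>Cc[of n]], of ?v ?v]
      by (simp add: power2_norm_eq_inner)
    also have "\<dots> \<le> EM (\<lambda>x. 2 * ((\<phi> m x - I x) * (\<phi> m x - I x)) + 2 * ((\<phi> n x - I x) * (\<phi> n x - I x))) ?v ?v"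
    proof (rule EM_mono)
      show "(\<lambda>x. (\<phi> m x - \<phi> n x) * (\<phi> m x - \<phi> n x)) \<in> bounded_borel"
        by (intro bounded_borel_mult bounded_borel_diff \<phi>b)
      show "(\<lambda>x. 2 * ((\<phi> m x - I x) * (\<phi> m x - I x)) + 2 * ((\<phi> n x - I x) * (\<phi> n x - I x))) \<in> bounded_borel"
        by (intro bounded_borel_add bounded_borel_cmult db)
      show "(\<phi> m x - \<phi> n x) * (\<phi> m x - \<phi> n x) \<le>
          2 * ((\<phi> m x - I x) * (\<phi> m x - I x)) + 2 * ((\<phi> n x - I x) * (\<phi> n x - I x))" for x
      proof -
        have "0 \<le> (\<phi> m x + \<phi> n x - 2 * I x) * (\<phi> m x + \<phi> n x - 2 * I x)" by simp
        then show ?thesis by (simp add: algebra_simps)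
      qed
    qed
    also have "\<dots> = 2 * a m + 2 * a n"
      unfolding a_def
      by (simp add: sigma_functional_add[OF EM_functional bounded_borel_cmult[OF db] bounded_borel_cmult[OF db]]
        sigma_functional_cmult[OF EM_functional db])
    finally show ?thesis .
  qed
  have cauchy: "Cauchy (\<lambda>n. D (w n))"
  proof (rule CauchyI)
    fix e :: real assume e: "0 < e"
    have "\<forall>\<^sub>F n in sequentially. a n < e\<^sup>2 / 4" using e by (intro order_tendstoD(2)[OF a0]) simp
    then obtain N where N: "\<And>n. n \<ge> N \<Longrightarrow> a n < e\<^sup>2 / 4" unfolding eventually_sequentially by auto
    show "\<exists>M. \<forall>m\<ge>M. \<forall>n\<ge>M. norm (D (w m) - D (w n)) < e"
    proof (intro exI[of _ N] allI impI)
      fix m n assume "m \<ge> N" "n \<ge> N"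
      then have "(norm (D (w m) - D (w n)))\<^sup>2 < e\<^sup>2" using N[of m] N[of n] dist[of m n] by simp
      then show "norm (D (w m) - D (w n)) < e" using e by (simp add: power2_less_imp_less)
    qed
  qed
  have Du: "D (\<lambda>x. w n x - w n p) = D (w n)" for n by (simp add: D_diff w C_const D_const)
  have uC: "(\<lambda>x. w n x - w n p) \<in> C" for n by (intro C_diff w C_const)
  obtain f0 where f0: "f0 \<in> C" "f0 p = 0" "(\<lambda>n. D (\<lambda>x. w n x - w n p)) \<longlonglongrightarrow> D f0"
    by (rule complete_limit[of "\<lambda>n x. w n x - w n p"]) (use cauchy in \<open>simp_all add: Du uC\<close>)
  have lim0: "(\<lambda>n. c_sup * norm (D (\<lambda>x. w n x - w n p) - D f0)) \<longlonglongrightarrow> c_sup * norm (D f0 - D f0)"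
    by (intro tendsto_intros f0)
  \<comment> \<open>The sup bound turns convergence of gradients into convergence of w n - w n p to
    \<open>f0\<close> at every point, and there the limit is 0.\<close>
  have "f0 x = 0" for x
  proof -
    have "(\<lambda>n. \<bar>(w n x - w n p) - f0 x\<bar>) \<longlonglongrightarrow> \<bar>(0 - 0) - f0 x\<bar>" by (intro tendsto_intros wlim)
    moreover have "\<bar>(w n x - w n p) - f0 x\<bar> \<le> c_sup * norm (D (\<lambda>x. w n x - w n p) - D f0)" for n
      using sup_bound[OF C_diff[OF uC[of n] f0(1)], of x] f0(2) by (simp add: D_diff[OF uC f0(1)])
    ultimately have "\<bar>(0 - 0) - f0 x\<bar> \<le> c_sup * norm (D f0 - D f0)" using lim0 by (intro LIMSEQ_le) auto
    then show ?thesis by simp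
  qed
  then have "f0 = (\<lambda>x. 0)" by auto
  then have "(\<lambda>n. norm (D (w n))) \<longlonglongrightarrow> norm (0::'h)" using tendsto_norm[OF f0(3)] by (simp add: Du D_const)
  then have "(\<lambda>n. (norm (D (w n)))\<^sup>2) \<longlonglongrightarrow> 0\<^sup>2" by (intro tendsto_power) simp
  then have 1: "(\<lambda>n. EM (\<lambda>x. \<phi> n x * \<phi> n x) ?v ?v) \<longlonglongrightarrow> 0"
    unfolding Dw power2_norm_eq_inner inner_T_T[OF \<phi>Cc \<phi>Cc] by simp
  have "(\<lambda>n. EM (\<lambda>x. \<phi> n x * \<phi> n x) ?v ?v) \<longlonglongrightarrow> EM (\<lambda>x. I x * I x) ?v ?v"
  proof (rule sigma_functional_lim[OF EM_functional, of "\<lambda>n x. \<phi> n x * \<phi> n x" 9])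
    show "\<bar>\<phi> n x * \<phi> n x\<bar> \<le> 9" for n x
      using mult_mono[OF \<phi>3[of n x] \<phi>3[of n x]] by (simp add: abs_mult)
  qed (auto intro!: tendsto_mult \<phi>lim bounded_borel_measurable bounded_borel_mult \<phi>b)
  then have "EM (\<lambda>x. I x * I x) ?v ?v = 0" using 1 LIMSEQ_unique by auto
  moreover have "(\<lambda>x. I x * I x) = I" unfolding I_def by (simp add: fun_eq_iff indicator_def)
  ultimately show ?thesis unfolding I_def by simp
qed

text \<open>By \<open>EM_null\<close> it suffices to test gradients. A multiple of f - f q is
  bounded by 1 and vanishes at q, so the point lies in a zero set to which
  \<open>energy_zero_set\<close> applies.\<close>

lemma EM_point: "EM (indicator {q}) v w = 0"
proof (rule EM_null)
  show q: "{q} \<in> sets borel" by simp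
  fix f assume f: "f \<in> C"
  have fq: "(\<lambda>x. f x - f q) \<in> C" by (rule C_diff[OF f C_const])
  obtain K where K: "\<And>x. \<bar>f x - f q\<bar> \<le> K" using Cc_bounded[OF C_Cc[OF fq]] by metis
  define R where "R = \<bar>K\<bar> + 1"
  have R: "0 < R" "\<bar>f x - f q\<bar> \<le> R" for x using K[of x] unfolding R_def by auto
  define g where "g = (\<lambda>x. (1 / R) * (f x - f q))"
  have g: "g \<in> C" unfolding g_def by (intro C_scale fq)
  have Dg: "D g = (1 / R) *\<^sub>R D f" unfolding g_def using D_scale[OF fq, of "1 / R"] by (simp add: D_diff f C_const D_const)
  have "EM (indicator {x. g x = 0}) (D g) (D g) = 0"
    by (rule energy_zero_set[OF g]) (use R in \<open>simp add: g_def abs_mult divide_simps\<close>)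
  moreover have "EM (indicator {q}) (D g) (D g) \<le> EM (indicator {x. g x = 0}) (D g) (D g)"
  proof (rule EM_mono)
    have "closed {x. g x = 0}"
      using C_Cc[OF g] unfolding Cc_iff by (intro closed_Collect_eq) auto
    then show "indicator {x. g x = 0} \<in> bounded_borel" by (intro bounded_borel_indicator) simp
    show "indicator {q} x \<le> (indicator {x. g x = 0} x :: real)" for x
      by (auto simp: indicator_def g_def)
  qed (rule bounded_borel_indicator[OF q])
  moreover have "0 \<le> EM (indicator {q}) (D g) (D g)"
    by (rule EM_nonneg[OF bounded_borel_indicator[OF q]]) simp
  ultimately have "EM (indicator {q}) (D g) (D g) = 0" by simp
  then show "EM (indicator {q}) (D f) (D f) = 0"
    unfolding Dg using R(1) by (simp add: EM_simps[OF bounded_borel_indicator[OF q]])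
qed

text \<open>The distance to \<open>q\<close> separates the two points; an approximation within half
  the gap still does.\<close>

lemma separate: "q \<noteq> q' \<Longrightarrow> \<exists>f\<in>C. f q \<noteq> f q'"
proof -
  assume "q \<noteq> q'"
  then have d: "0 < dist q' q" by (simp add: zero_less_dist_iff)
  have "(\<lambda>x. dist x q) \<in> Cc" unfolding Cc_iff by (intro continuous_intros)
  then obtain g where g: "g \<in> C" "\<And>x. \<bar>dist x q - g x\<bar> < dist q' q / 2"
    using uniformly_dense[of "\<lambda>x. dist x q" "dist q' q / 2"] d by auto
  have "g q < dist q' q / 2" using g(2)[of q] by (simp add: abs_less_iff)
  moreover have "dist q' q / 2 < g q'" using g(2)[of q'] unfolding abs_less_iff by linarith
  ultimately have "g q \<noteq> g q'" by simp
  then show ?thesis using g(1) by auto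
qed

end

section \<open>Martingale dimension one\<close>

text \<open>Disjoint row and column indices make room for four unrelated functions: no diagonal
  entry of the matrix occurs in the minor. If it were nonzero, the rank would be at least
  two.\<close>

lemma minor_of_rank_one:
  fixes a :: "nat \<Rightarrow> nat \<Rightarrow> real"
  assumes "vec_space.rank 4 (Matrix.mat 4 4 (\<lambda>(i, j). a i j)) \<le> 1"
  shows "a 0 2 * a 1 3 = a 0 3 * a 1 2"
proof (rule ccontr)
  assume neq: "a 0 2 * a 1 3 \<noteq> a 0 3 * a 1 2"
  let ?A = "Matrix.mat 4 4 (\<lambda>(i, j). a i j)"
  let ?S = "submatrix ?A {0, 1} {2, 3}"
  have I: "{i. i < (4::nat) \<and> i \<in> {0, 1}} = {0, 1}" and J: "{j. j < (4::nat) \<and> j \<in> {2, 3}} = {2, 3}" by auto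
  have pI: "pick {0, 1} 0 = 0" "pick {0, 1} 1 = 1"
    by (auto intro!: Least_equality)
  have pJ0: "pick {2, 3} 0 = 2" by (auto intro!: Least_equality)
  have pJ: "pick {2, 3} 1 = 3"
    unfolding One_nat_def pick.simps(2) pJ0 by (rule Least_equality) auto
  have cI: "card {i. i < (4::nat) \<and> (i = 0 \<or> i = Suc 0)} = 2" and cJ: "card {j. j < (4::nat) \<and> (j = 2 \<or> j = 3)} = 2"
    using arg_cong[OF I, of card] arg_cong[OF J, of card] by simp_all
  have S: "?S \<in> carrier_mat 2 2"
    by (rule carrier_matI) (simp_all add: dim_submatrix cI cJ)
  have sub: "?S $$ (i, j) = ?A $$ (pick {0, 1} i, pick {2, 3} j)" if "i < 2" "j < 2" for i j
    by (rule submatrix_index) (use that cI cJ in simp_all)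
  have e: "?S $$ (0, 0) = a 0 2" "?S $$ (0, 1) = a 0 3" "?S $$ (1, 0) = a 1 2" "?S $$ (1, 1) = a 1 3"
    using sub[of 0 0] sub[of 0 1] sub[of 1 0] sub[of 1 1] unfolding pI pJ0 pJ by simp_all
  have "Determinant.det ?S \<noteq> 0"
  proof
    assume "Determinant.det ?S = 0"
    then obtain v where v: "v \<in> carrier_vec 2" "v \<noteq> 0\<^sub>v 2" "?S *\<^sub>v v = 0\<^sub>v 2"
      using det_0_iff_vec_prod_zero_field[OF S] by auto
    have dv: "dim_vec v = 2" using v(1) by simp
    have comp: "vec_index (?S *\<^sub>v v) i = ?S $$ (i, 0) * vec_index v 0 + ?S $$ (i, 1) * vec_index v 1" if "i < 2" for i
      using that S dv by (simp add: scalar_prod_def numeral_2_eq_2)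
    have eqs: "a 0 2 * vec_index v 0 + a 0 3 * vec_index v 1 = 0" "a 1 2 * vec_index v 0 + a 1 3 * vec_index v 1 = 0"
      using comp[of 0] comp[of 1] v(3) e by simp_all
    \<comment> \<open>Cramer's rule by hand: the minor times each coordinate is a combination of the
      two kernel equations.\<close>
    have "(a 0 2 * a 1 3 - a 0 3 * a 1 2) * vec_index v 0 =
        a 1 3 * (a 0 2 * vec_index v 0 + a 0 3 * vec_index v 1) - a 0 3 * (a 1 2 * vec_index v 0 + a 1 3 * vec_index v 1)"
      "(a 0 2 * a 1 3 - a 0 3 * a 1 2) * vec_index v 1 =
        a 0 2 * (a 1 2 * vec_index v 0 + a 1 3 * vec_index v 1) - a 1 2 * (a 0 2 * vec_index v 0 + a 0 3 * vec_index v 1)"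
      by (simp_all add: algebra_simps)
    then have "(a 0 2 * a 1 3 - a 0 3 * a 1 2) * vec_index v 0 = 0" "(a 0 2 * a 1 3 - a 0 3 * a 1 2) * vec_index v 1 = 0"
      unfolding eqs by simp_all
    then have z: "vec_index v 0 = 0" "vec_index v 1 = 0" using neq by simp_all
    have "v = 0\<^sub>v 2"
    proof (rule Matrix.eq_vecI)
      fix i assume "i < dim_vec (0\<^sub>v 2 :: real Matrix.vec)"
      then have "i = 0 \<or> i = 1" by auto
      then show "vec_index v i = vec_index (0\<^sub>v 2) i" using z by auto
    qed (simp add: dv)
    then show False using v(2) by simp
  qed
  then have "card {j. j < (4::nat) \<and> j \<in> {2, 3}} \<le> vec_space.rank 4 ?A"
    using vec_space.rank_gt_minor[OF mat_carrier[of 4 4 "\<lambda>(i, j). a i j"]] by metis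
  then have "card {2, 3::nat} \<le> vec_space.rank 4 ?A" unfolding J .
  then show False using assms by simp
qed

locale dominated_form = compact_form E C \<nu> \<iota>
  for E :: "('a::metric_space \<Rightarrow> real) \<Rightarrow> ('a \<Rightarrow> real) \<Rightarrow> real" and C :: "('a \<Rightarrow> real) set"
    and \<nu> :: "('a \<Rightarrow> real) \<Rightarrow> ('a \<Rightarrow> real) \<Rightarrow> 'a set \<Rightarrow> real"
    and \<iota> :: "('a \<times> 'a \<Rightarrow> real) \<Rightarrow> 'h::{real_inner, complete_space}" +
  fixes M :: "'a measure"
  assumes dominant: "energy_dominant C \<nu> M"
begin

section \<open>Densities of energy measures with respect to a dominant measure\<close>

lemma sets_M: "sets M = sets borel" and sigma_finite_M: "sigma_finite_measure M"
  using dominant unfolding energy_dominant_def by auto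

lemma as_measure_\<nu>:
  assumes "f \<in> C"
  shows "as_measure (\<nu> f f) = field_measure (D f)"
  unfolding field_measure_def as_measure_def field_energy_measure_eq
proof (rule measure_of_eq)
  fix A :: "'a set" assume "A \<in> sigma_sets UNIV (sets borel)"
  then have "A \<in> sets borel" using sets.sigma_sets_eq[of "borel :: 'a measure"] by simp
  then show "ennreal (\<nu> f f A) = ennreal (EM (indicator A) (D f) (D f))"
    by (simp add: EM_indicator_D assms)
qed simp

lemma EM_null_M:
  assumes "A \<in> null_sets M"
  shows "EM (indicator A) v w = 0"
proof (rule EM_null)
  show A: "A \<in> sets borel" using assms sets_M by auto
  fix f assume f: "f \<in> C"
  have "A \<in> null_sets (field_measure (D f))"
    using dominant assms f unfolding energy_dominant_def absolutely_continuous_def as_measure_\<nu>[OF f, symmetric] by auto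
  then have "ennreal (EM (indicator A) (D f) (D f)) = 0" using field_measure(3)[OF A] by auto
  moreover have "0 \<le> EM (indicator A) (D f) (D f)"
    by (rule EM_nonneg[OF bounded_borel_indicator[OF A]]) simp
  ultimately show "EM (indicator A) (D f) (D f) = 0" by (simp add: ennreal_eq_0_iff)
qed

definition dens :: "'h \<Rightarrow> 'h \<Rightarrow> ('a \<Rightarrow> real) \<Rightarrow> bool" where
  "dens v w h \<longleftrightarrow> integrable M h \<and> (\<forall>A\<in>sets borel. set_lebesgue_integral M A h = EM (indicator A) v w)"

lemma dens_integral:
  assumes d: "dens v w h" and \<phi>: "\<phi> \<in> bounded_borel"
  shows "(\<integral>x. \<phi> x * h x \<partial>M) = EM \<phi> v w"
proof (rule sigma_functional_eq_indicator[OF sigma_functional_integral_density[OF _ sets_M] EM_functional _ \<phi>])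
  show "integrable M h" using d unfolding dens_def by simp
  show "(\<integral>x. indicator A x * h x \<partial>M) = EM (indicator A) v w" if "A \<in> sets borel" for A
    using d that unfolding dens_def set_lebesgue_integral_def by simp
qed

text \<open>The energy measure of a field is finite and, by \<open>EM_null_M\<close>, absolutely
  continuous, so its extended real density is finite almost everywhere and can be made real.\<close>

lemma dens_self: "\<exists>h. dens v v h"
proof -
  interpret sigma_finite_measure M by (rule sigma_finite_M)
  let ?N = "field_measure v"
  define f where "f = RN_deriv M ?N"
  have "absolutely_continuous M ?N"
    unfolding absolutely_continuous_def
  proof
    fix A assume A: "A \<in> null_sets M"
    then have "A \<in> sets borel" using sets_M by auto
    then show "A \<in> null_sets ?N" using field_measure(3)[of A v] EM_null_M[OF A] by (simp add: null_sets_def field_measure(1))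
  qed
  then have N: "density M f = ?N" unfolding f_def by (rule density_RN_deriv) (simp add: field_measure(1) sets_M)
  have f[measurable]: "f \<in> borel_measurable M" unfolding f_def by simp
  have em: "emeasure ?N A = (\<integral>\<^sup>+x. f x * indicator A x \<partial>M)" if "A \<in> sets borel" for A
    unfolding N[symmetric] using that sets_M by (intro emeasure_density) simp_all
  have "(\<integral>\<^sup>+x. f x \<partial>M) = emeasure ?N UNIV" using em[of UNIV] by simp
  also have "\<dots> < \<infinity>" using finite_measure.emeasure_finite[OF field_measure(4), of v UNIV] by (simp add: less_top)
  finally have fin: "(\<integral>\<^sup>+x. f x \<partial>M) \<noteq> \<infinity>" by simp
  then have AE: "AE x in M. f x \<noteq> \<infinity>" by (intro nn_integral_PInf_AE f)
  define h where "h = (\<lambda>x. enn2real (f x))"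
  have h[measurable]: "h \<in> borel_measurable M" unfolding h_def by simp
  have eq: "AE x in M. ennreal (h x) = f x" using AE by eventually_elim (simp add: h_def less_top)
  have "(\<integral>\<^sup>+x. ennreal (h x) \<partial>M) = (\<integral>\<^sup>+x. f x \<partial>M)" by (rule nn_integral_cong_AE[OF eq])
  then have int: "integrable M h"
    using fin by (intro integrableI_nonneg) (auto simp: h_def less_top)
  have "set_lebesgue_integral M A h = EM (indicator A) v v" if A: "A \<in> sets borel" for A
  proof -
    have AM[measurable]: "A \<in> sets M" using A sets_M by simp
    have "set_lebesgue_integral M A h = (\<integral>x. indicator A x * h x \<partial>M)" unfolding set_lebesgue_integral_def by simp
    also have "\<dots> = enn2real (\<integral>\<^sup>+x. ennreal (indicator A x * h x) \<partial>M)"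
      by (rule integral_eq_nn_integral) (auto simp: h_def)
    also have "(\<integral>\<^sup>+x. ennreal (indicator A x * h x) \<partial>M) = (\<integral>\<^sup>+x. f x * indicator A x \<partial>M)"
      by (rule nn_integral_cong_AE) (use eq in \<open>eventually_elim, auto simp: indicator_def\<close>)
    also have "\<dots> = ennreal (EM (indicator A) v v)" using em[OF A] field_measure(3)[OF A] by simp
    also have "enn2real \<dots> = EM (indicator A) v v"
      by (rule enn2real_ennreal) (rule EM_nonneg[OF bounded_borel_indicator[OF A]], simp)
    finally show ?thesis .
  qed
  then show ?thesis unfolding dens_def using int by auto
qed

lemma set_integral_eq:
  fixes h :: "'a \<Rightarrow> real"
  shows "set_lebesgue_integral M A h = (\<integral>x. indicator A x * h x \<partial>M)"
  unfolding set_lebesgue_integral_def by simp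

lemma dens_add: "dens v w h \<Longrightarrow> dens v' w h' \<Longrightarrow> dens (v + v') w (\<lambda>x. h x + h' x)"
  unfolding dens_def set_integral_eq
proof (elim conjE, intro conjI ballI)
  assume i: "integrable M h" "integrable M h'" and e: "\<forall>A\<in>sets borel. (\<integral>x. indicator A x * h x \<partial>M) = EM (indicator A) v w"
    "\<forall>A\<in>sets borel. (\<integral>x. indicator A x * h' x \<partial>M) = EM (indicator A) v' w"
  show "integrable M (\<lambda>x. h x + h' x)" using i by simp
  fix A :: "'a set" assume A: "A \<in> sets borel"
  have "integrable M (\<lambda>x. indicator A x * h x)" "integrable M (\<lambda>x. indicator A x * h' x)"
    using i A sets_M by (auto intro: integrable_real_mult_indicator simp: mult.commute)
  then show "(\<integral>x. indicator A x * (h x + h' x) \<partial>M) = EM (indicator A) (v + v') w"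
    using e A by (simp add: distrib_left EM_simps bounded_borel_indicator)
qed

lemma dens_scale: "dens v w h \<Longrightarrow> dens (c *\<^sub>R v) w (\<lambda>x. c * h x)"
  unfolding dens_def set_integral_eq
  by (simp add: EM_simps bounded_borel_indicator mult.left_commute)

lemma dens_sym: "dens v w h \<Longrightarrow> dens w v h"
  unfolding dens_def by (simp add: EM_sym[OF bounded_borel_indicator, of _ w v])

text \<open>Polarisation: one quarter of the density for v + w minus one quarter of that for v -
  w.\<close>

lemma dens_exists: "\<exists>h. dens v w h"
proof -
  obtain h1 where h1: "dens (v + w) (v + w) h1" using dens_self by auto
  obtain h2 where h2: "dens (v - w) (v - w) h2" using dens_self by auto
  have "dens v w (\<lambda>x. (1/4) * h1 x + (-1/4) * h2 x)"
    unfolding dens_def set_integral_eq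
  proof (intro conjI ballI)
    have i: "integrable M h1" "integrable M h2" using h1 h2 unfolding dens_def by auto
    then show "integrable M (\<lambda>x. (1/4) * h1 x + (-1/4) * h2 x)" by simp
    fix A :: "'a set" assume A: "A \<in> sets borel"
    have I: "indicator A \<in> bounded_borel" using A by (rule bounded_borel_indicator)
    have "integrable M (\<lambda>x. indicator A x * h1 x)" "integrable M (\<lambda>x. indicator A x * h2 x)"
      using i A sets_M by (auto intro: integrable_real_mult_indicator simp: mult.commute)
    then have "(\<integral>x. indicator A x * ((1/4) * h1 x + (-1/4) * h2 x) \<partial>M) =
        (1/4) * (\<integral>x. indicator A x * h1 x \<partial>M) + (-1/4) * (\<integral>x. indicator A x * h2 x \<partial>M)"
      by (simp add: distrib_left right_diff_distrib)
    also have "\<dots> = (1/4) * EM (indicator A) (v + w) (v + w) + (-1/4) * EM (indicator A) (v - w) (v - w)"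
      by (simp only: dens_integral[OF h1 I] dens_integral[OF h2 I])
    also have "\<dots> = EM (indicator A) v w"
      using EM_sym[OF I, of w v] by (simp add: EM_simps[OF I] algebra_simps)
    finally show "(\<integral>x. indicator A x * ((1/4) * h1 x + (-1/4) * h2 x) \<partial>M) = EM (indicator A) v w" .
  qed
  then show ?thesis by auto
qed

text \<open>A version is selected by the same choice as in \<open>signed_RN_deriv\<close>, so that
  the entries of the Gram matrices coincide with \<open>\<gamma>\<close> at gradients, not merely
  almost everywhere.\<close>

definition \<gamma> :: "'h \<Rightarrow> 'h \<Rightarrow> 'a \<Rightarrow> real" where
  "\<gamma> v w = (SOME h. dens v w h)"

lemma dens_\<gamma>: "dens v w (\<gamma> v w)"
  unfolding \<gamma>_def using dens_exists by (rule someI_ex)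

lemma \<gamma>_integrable: "integrable M (\<gamma> v w)"
  using dens_\<gamma> unfolding dens_def by simp

lemma \<gamma>_unique: "dens v w h \<Longrightarrow> AE x in M. \<gamma> v w x = h x"
  by (rule density_unique_real) (use dens_\<gamma>[of v w] sets_M in \<open>auto simp: dens_def\<close>)

lemma \<gamma>_sym: "AE x in M. \<gamma> v w x = \<gamma> w v x"
  by (rule \<gamma>_unique[OF dens_sym[OF dens_\<gamma>]])

lemma \<gamma>_T:
  assumes g: "g \<in> Cc"
  shows "AE x in M. \<gamma> (T g v) w x = g x * \<gamma> v w x"
proof (rule \<gamma>_unique)
  obtain K where K: "\<And>x. \<bar>g x\<bar> \<le> K" "0 \<le> K" using Cc_bounded[OF g] by metis
  have gm: "g \<in> borel_measurable M"
    using bounded_borel_measurable[OF Cc_bounded_borel[OF g]] sets_M by (simp cong: measurable_cong_sets)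
  show "dens (T g v) w (\<lambda>x. g x * \<gamma> v w x)"
    unfolding dens_def set_integral_eq
  proof (intro conjI ballI)
    have "\<bar>g x * \<gamma> v w x\<bar> \<le> \<bar>K * \<gamma> v w x\<bar>" for x
      unfolding abs_mult using K(1)[of x] by (intro mult_right_mono) auto
    then show "integrable M (\<lambda>x. g x * \<gamma> v w x)"
      using gm \<gamma>_integrable[of v w]
      by (intro Bochner_Integration.integrable_bound[of M "\<lambda>x. K * \<gamma> v w x" "\<lambda>x. g x * \<gamma> v w x"]) auto
    fix A :: "'a set" assume "A \<in> sets borel"
    then have I: "indicator A \<in> bounded_borel" by (rule bounded_borel_indicator)
    have "(\<integral>x. (indicator A x * g x) * \<gamma> v w x \<partial>M) = EM (\<lambda>x. indicator A x * g x) v w"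
      by (rule dens_integral[OF dens_\<gamma>]) (intro bounded_borel_mult I Cc_bounded_borel g)
    then show "(\<integral>x. indicator A x * (g x * \<gamma> v w x) \<partial>M) = EM (indicator A) (T g v) w"
      by (simp add: EM_T[OF I g] mult.assoc)
  qed
qed

text \<open>The sign of the density is itself a bounded Borel integrand. The estimate makes
  densities depend continuously, in L^1, on the field.\<close>

lemma \<gamma>_L1_bound: "(\<integral>x. \<bar>\<gamma> v w x\<bar> \<partial>M) \<le> 3 * norm v * norm w"
proof -
  have "\<gamma> v w \<in> borel_measurable borel"
    using \<gamma>_integrable[of v w] sets_M by (auto dest: borel_measurable_integrable cong: measurable_cong_sets)
  then have b: "(\<lambda>x. sgn (\<gamma> v w x)) \<in> bounded_borel"
    by (intro bounded_borelI[of _ 1]) (auto simp: sgn_if)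
  have "(\<integral>x. \<bar>\<gamma> v w x\<bar> \<partial>M) = (\<integral>x. sgn (\<gamma> v w x) * \<gamma> v w x \<partial>M)" by (simp add: abs_sgn mult.commute)
  also have "\<dots> = EM (\<lambda>x. sgn (\<gamma> v w x)) v w" by (rule dens_integral[OF dens_\<gamma> b])
  also have "\<dots> \<le> 3 * 1 * norm v * norm w" by (rule order_trans[OF abs_ge_self EM(3)[OF b]]) (simp add: sgn_if)
  finally show ?thesis by simp
qed

lemma \<gamma>_diff_L1: "(\<integral>x. \<bar>\<gamma> v w x - \<gamma> v' w x\<bar> \<partial>M) \<le> 3 * norm (v - v') * norm w"
proof -
  have "dens (v + (-1) *\<^sub>R v') w (\<lambda>x. \<gamma> v w x + (-1) * \<gamma> v' w x)"
    by (intro dens_add dens_scale dens_\<gamma>)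
  then have "AE x in M. \<gamma> (v - v') w x = \<gamma> v w x - \<gamma> v' w x" using \<gamma>_unique by fastforce
  then have "(\<integral>x. \<bar>\<gamma> v w x - \<gamma> v' w x\<bar> \<partial>M) = (\<integral>x. \<bar>\<gamma> (v - v') w x\<bar> \<partial>M)"
    by (intro integral_cong_AE) (use \<gamma>_integrable in \<open>auto dest: borel_measurable_integrable\<close>)
  then show ?thesis using \<gamma>_L1_bound[of "v - v'" w] by simp
qed

text \<open>All \<open>2 \<times> 2\<close> minors of the Gram matrices vanish.  This property is invariant under a group
  acting transitively on the four arguments, so that it suffices to extend it in the first one.\<close>

definition minors :: "'h \<Rightarrow> 'h \<Rightarrow> 'h \<Rightarrow> 'h \<Rightarrow> bool" where
  "minors v1 v2 v3 v4 \<longleftrightarrow> (AE x in M. \<gamma> v1 v2 x * \<gamma> v3 v4 x = \<gamma> v1 v3 x * \<gamma> v2 v4 x)"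

lemma minors_swap:
  assumes "minors v1 v2 v3 v4"
  shows "minors v2 v1 v4 v3"
  using assms[unfolded minors_def] \<gamma>_sym[of v1 v2] \<gamma>_sym[of v3 v4]
  unfolding minors_def by eventually_elim (simp add: mult.commute)

lemma minors_rotate:
  assumes "minors v1 v2 v3 v4"
  shows "minors v3 v4 v1 v2"
  using assms[unfolded minors_def] \<gamma>_sym[of v1 v3] \<gamma>_sym[of v2 v4]
  unfolding minors_def by eventually_elim (simp add: mult.commute)

lemma minors_add:
  assumes "minors v v2 v3 v4" "minors v' v2 v3 v4"
  shows "minors (v + v') v2 v3 v4"
  using assms[unfolded minors_def] \<gamma>_unique[OF dens_add[OF dens_\<gamma>[of v v2] dens_\<gamma>[of v' v2]]]
    \<gamma>_unique[OF dens_add[OF dens_\<gamma>[of v v3] dens_\<gamma>[of v' v3]]]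
  unfolding minors_def by eventually_elim (simp add: distrib_right)

lemma minors_zero: "minors 0 v2 v3 v4"
  using \<gamma>_unique[OF dens_scale[OF dens_\<gamma>[of 0 v2]], of 0] \<gamma>_unique[OF dens_scale[OF dens_\<gamma>[of 0 v3]], of 0]
  unfolding minors_def by eventually_elim simp

lemma minors_T:
  assumes "g \<in> Cc" "minors v v2 v3 v4"
  shows "minors (T g v) v2 v3 v4"
  using assms(2)[unfolded minors_def] \<gamma>_T[OF assms(1), of v v2] \<gamma>_T[OF assms(1), of v v3]
  unfolding minors_def by eventually_elim (simp add: mult.assoc)

text \<open>Convergence of fields gives L^1 convergence of densities. Both errors are added into
  \<open>e\<close>, so that one subsequence converges almost everywhere for \<open>v2\<close> and
  \<open>v3\<close> together.\<close>

lemma minors_limit: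
  assumes lim: "v \<longlonglongrightarrow> u" and m: "\<And>n::nat. minors (v n) v2 v3 v4"
  shows "minors u v2 v3 v4"
proof -
  define e where "e n x = \<bar>\<gamma> (v n) v2 x - \<gamma> u v2 x\<bar> + \<bar>\<gamma> (v n) v3 x - \<gamma> u v3 x\<bar>" for n x
  have int: "integrable M (\<lambda>x. \<bar>\<gamma> (v n) w x - \<gamma> u w x\<bar>)" for n w using \<gamma>_integrable by auto
  have "(\<lambda>n. \<integral>x. norm (e n x) \<partial>M) \<longlonglongrightarrow> 0"
  proof (rule tendsto_sandwich[OF always_eventually always_eventually tendsto_const])
    show "\<forall>n. 0 \<le> (\<integral>x. norm (e n x) \<partial>M)" by (auto intro: integral_nonneg_AE)
    show "\<forall>n. (\<integral>x. norm (e n x) \<partial>M) \<le> 3 * norm (v n - u) * norm v2 + 3 * norm (v n - u) * norm v3"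
    proof
      fix n
      have "(\<integral>x. norm (e n x) \<partial>M) = (\<integral>x. \<bar>\<gamma> (v n) v2 x - \<gamma> u v2 x\<bar> \<partial>M) + (\<integral>x. \<bar>\<gamma> (v n) v3 x - \<gamma> u v3 x\<bar> \<partial>M)"
        unfolding e_def using int by simp
      then show "(\<integral>x. norm (e n x) \<partial>M) \<le> 3 * norm (v n - u) * norm v2 + 3 * norm (v n - u) * norm v3"
        using \<gamma>_diff_L1[of "v n" v2 u] \<gamma>_diff_L1[of "v n" v3 u] by simp
    qed
    have "(\<lambda>n. 3 * norm (v n - u) * norm v2 + 3 * norm (v n - u) * norm v3) \<longlonglongrightarrow>
        3 * norm (u - u) * norm v2 + 3 * norm (u - u) * norm v3" by (intro tendsto_intros lim)
    then show "(\<lambda>n. 3 * norm (v n - u) * norm v2 + 3 * norm (v n - u) * norm v3) \<longlonglongrightarrow> 0" by simp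
  qed
  then obtain r :: "nat \<Rightarrow> nat" where r: "AE x in M. (\<lambda>n. e (r n) x) \<longlonglongrightarrow> 0"
    using tendsto_L1_AE_subseq[of M e] int unfolding e_def by auto
  have "AE x in M. \<forall>n. \<gamma> (v (r n)) v2 x * \<gamma> v3 v4 x = \<gamma> (v (r n)) v3 x * \<gamma> v2 v4 x"
    using m unfolding minors_def by (simp add: AE_all_countable)
  then show ?thesis
    unfolding minors_def using r
  proof eventually_elim
    case (elim x)
    have "(\<lambda>n. \<gamma> (v (r n)) w x - \<gamma> u w x) \<longlonglongrightarrow> 0" if "w = v2 \<or> w = v3" for w
      by (rule Lim_null_comparison[OF always_eventually elim(2)]) (use that in \<open>auto simp: e_def\<close>)
    then have l: "(\<lambda>n. \<gamma> (v (r n)) v2 x) \<longlonglongrightarrow> \<gamma> u v2 x" "(\<lambda>n. \<gamma> (v (r n)) v3 x) \<longlonglongrightarrow> \<gamma> u v3 x"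
      by (auto simp: LIM_zero_iff)
    have "(\<lambda>n. \<gamma> (v (r n)) v2 x * \<gamma> v3 v4 x) \<longlonglongrightarrow> \<gamma> u v2 x * \<gamma> v3 v4 x" by (intro tendsto_mult_right l)
    moreover have "(\<lambda>n. \<gamma> (v (r n)) v2 x * \<gamma> v3 v4 x) \<longlonglongrightarrow> \<gamma> u v3 x * \<gamma> v2 v4 x"
      unfolding elim(1)[rule_format] by (intro tendsto_mult_right l)
    ultimately show ?case by (rule LIMSEQ_unique)
  qed
qed

text \<open>The identity is linear in the first slot, compatible with continuous multipliers and
  stable under limits, so it spreads from gradients to lists and then to \<open>'h\<close>.\<close>

lemma minors_extend:
  assumes "\<And>f. f \<in> C \<Longrightarrow> minors (D f) v2 v3 v4"
  shows "minors v v2 v3 v4"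
proof -
  have val: "minors (val r) v2 v3 v4" if "r \<in> reps" for r
    using that
  proof (induction r)
    case Nil
    show ?case by (simp add: val_def minors_zero)
  next
    case (Cons a r)
    then have "minors (T (fst a) (D (snd a))) v2 v3 v4" by (intro minors_T assms) simp_all
    then have "minors (gen (fst a) (snd a)) v2 v3 v4" using Cons by (simp add: T_D)
    then have "minors (gen (fst a) (snd a) + val r) v2 v3 v4" by (rule minors_add) (use Cons in simp)
    then show ?case by (simp add: val_def)
  qed
  obtain r where r: "\<And>n::nat. r n \<in> reps" "(\<lambda>n. val (r n)) \<longlonglongrightarrow> v" using dense_image_sequence[OF dense_val] by metis
  show ?thesis by (rule minors_limit[OF r(2)]) (rule val[OF r(1)])
qed

lemma minors_all:
  assumes "\<And>f1 f2 f3 f4. f1 \<in> C \<Longrightarrow> f2 \<in> C \<Longrightarrow> f3 \<in> C \<Longrightarrow> f4 \<in> C \<Longrightarrow> minors (D f1) (D f2) (D f3) (D f4)"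
  shows "minors v1 v2 v3 v4"
proof -
  have 1: "minors v1 (D f2) (D f3) (D f4)" if "f2 \<in> C" "f3 \<in> C" "f4 \<in> C" for f2 f3 f4 v1
    by (rule minors_extend) (rule assms[OF _ that])
  have 2: "minors v2 v1 (D f4) (D f3)" if "f3 \<in> C" "f4 \<in> C" for f3 f4 v1 v2
    by (rule minors_extend) (rule minors_swap[OF 1[OF _ that]])
  have 3: "minors v4 (D f3) v2 v1" if "f3 \<in> C" for f3 v1 v2 v4
    by (rule minors_extend) (rule minors_rotate[OF 2[OF that]])
  have 4: "minors v3 v4 v1 v2" for v1 v2 v3 v4
    by (rule minors_extend) (rule minors_swap[OF 3])
  show ?thesis by (rule 4)
qed

lemma minors_of_index:
  assumes idx: "index_bound C \<nu> M q" and q: "AE x in M. q x \<le> 1"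
  shows "minors v1 v2 v3 v4"
proof (rule minors_all)
  fix f1 f2 f3 f4 assume f: "f1 \<in> C" "f2 \<in> C" "f3 \<in> C" "f4 \<in> C"
  \<comment> \<open>This order puts f1, f4 into rows 0, 1 and f2, f3 into columns 2, 3, so that up
    to symmetry of the densities the minor is the desired identity.\<close>
  define f where "f i = [f1, f4, f2, f3] ! i" for i
  have fC: "\<forall>i<4. f i \<in> C" unfolding f_def using f by (auto simp: less_Suc_eq numeral_eq_Suc)
  have RN: "signed_RN_deriv M (\<nu> f g) = \<gamma> (D f) (D g)" if "f \<in> C" "g \<in> C" for f g
    unfolding signed_RN_deriv_def \<gamma>_def dens_def by (simp add: EM_indicator_D that cong: conj_cong)
  have "AE x in M. enat (gram_rank \<nu> M 4 f x) \<le> q x" using idx fC unfolding index_bound_def by blast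
  then have r: "AE x in M. gram_rank \<nu> M 4 f x \<le> 1"
    using q by eventually_elim (metis enat_ord_simps(1) one_enat_def order_trans)
  show "minors (D f1) (D f2) (D f3) (D f4)"
    unfolding minors_def using r \<gamma>_sym[of "D f4" "D f3"] \<gamma>_sym[of "D f4" "D f2"]
  proof eventually_elim
    case (elim x)
    have "signed_RN_deriv M (\<nu> (f 0) (f 2)) x * signed_RN_deriv M (\<nu> (f 1) (f 3)) x =
        signed_RN_deriv M (\<nu> (f 0) (f 3)) x * signed_RN_deriv M (\<nu> (f 1) (f 2)) x"
      using minor_of_rank_one[of "\<lambda>i j. signed_RN_deriv M (\<nu> (f i) (f j)) x"] elim(1)
      unfolding gram_rank_def by simp
    then show ?case using f elim(2,3) by (simp add: f_def RN)
  qed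
qed

end

context compact_form
begin

text \<open>For the arguments v, v, b, b the minor reads \<gamma>(v,v) \<gamma>(b,b) =
  \<gamma>(v,b)^2, and orthogonality makes the right side vanish. The zero set of \<gamma>(b,b) is
  null for the measure of \<open>b\<close>, hence for the minimal \<open>M\<close>, so that
  \<gamma>(v,v) = 0.\<close>

lemma one_dimensional_orthogonal:
  assumes dim: "has_martingale_dimension C \<nu> 1" and b: "minimal_energy_dominant C \<nu> (field_measure b)"
    and orth: "\<And>\<phi>. \<phi> \<in> Cc \<Longrightarrow> inner v (T \<phi> b) = 0"
  shows "v = 0"
proof -
  obtain M q where M: "minimal_energy_dominant C \<nu> M" and q: "pointwise_index C \<nu> M q"
    and inf: "(1::enat) = Inf {m. AE x in M. q x \<le> m}"
    using dim unfolding has_martingale_dimension_def by auto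
  interpret dominated_form E C \<nu> \<iota> M
    using M unfolding minimal_energy_dominant_def by unfold_locales auto
  \<comment> \<open>Extended naturals are well ordered, so the infimum is attained; \<infinity>
    shows that the set is not empty.\<close>
  have "\<infinity> \<in> {m. AE x in M. q x \<le> m}" by simp
  then have "Inf {m. AE x in M. q x \<le> m} \<in> {m. AE x in M. q x \<le> m}" by (rule wellorder_InfI)
  then have q1: "AE x in M. q x \<le> 1" using inf by simp
  have min: "minors v1 v2 v3 v4" for v1 v2 v3 v4
    by (rule minors_of_index[OF _ q1]) (use q in \<open>simp add: pointwise_index_def\<close>)
  have vb: "EM \<phi> v b = 0" if "\<phi> \<in> bounded_borel" for \<phi>
  proof (rule sigma_functional_eq_continuous[OF EM_functional sigma_functional_0 _ that])
    fix g :: "'a \<Rightarrow> real" assume "continuous_on UNIV g"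
    then have g: "g \<in> Cc" by (simp add: Cc_iff)
    have "EM g v b = EM g b v" by (rule EM_sym[OF Cc_bounded_borel[OF g]])
    also have "\<dots> = inner v (T g b)" using inner_T[OF g, of b v] by (simp add: inner_commute)
    finally show "EM g v b = 0" using orth[OF g] by simp
  qed
  have "dens v b (\<lambda>x. 0)"
    unfolding dens_def set_integral_eq by (simp add: vb bounded_borel_indicator)
  then have vb0: "AE x in M. \<gamma> v b x = 0" by (rule \<gamma>_unique)
  define Z where "Z = {x. \<gamma> b b x = 0}"
  have "\<gamma> b b \<in> borel_measurable borel"
    using \<gamma>_integrable[of b b] sets_M by (auto dest: borel_measurable_integrable cong: measurable_cong_sets)
  then have "\<gamma> b b -` {0} \<inter> space borel \<in> sets borel" by (rule measurable_sets) simp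
  then have Z: "Z \<in> sets borel" unfolding Z_def vimage_def by simp
  have "EM (indicator Z) b b = (\<integral>x. indicator Z x * \<gamma> b b x \<partial>M)"
    by (rule dens_integral[OF dens_\<gamma> bounded_borel_indicator[OF Z], symmetric])
  also have "(\<lambda>x. indicator Z x * \<gamma> b b x) = (\<lambda>x. 0)" unfolding Z_def by (auto simp: indicator_def)
  finally have "Z \<in> null_sets (field_measure b)" using Z by (simp add: null_sets_def field_measure)
  moreover have "energy_dominant C \<nu> (field_measure b)" using b unfolding minimal_energy_dominant_def by simp
  then have "absolutely_continuous (field_measure b) M" using M unfolding minimal_energy_dominant_def by blast
  ultimately have "Z \<in> null_sets M" unfolding absolutely_continuous_def by blast
  then have "AE x in M. x \<notin> Z" by (rule AE_not_in)
  then have "AE x in M. \<gamma> v v x = 0"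
    using min[of v v b b, unfolded minors_def] vb0 by eventually_elim (auto simp: Z_def)
  then have "(\<integral>x. 1 * \<gamma> v v x \<partial>M) = (\<integral>x. 0 \<partial>M)"
    by (intro integral_cong_AE) (use \<gamma>_integrable[of v v] in auto)
  then have "inner v v = 0" using dens_integral[OF dens_\<gamma>[of v v] bounded_borel_const[of 1]] by (simp add: EM_one)
  then show ?thesis by simp
qed

end

section \<open>Boundary quadruples in the abstract setting\<close>

text \<open>The interface between the analysis and the operator theory, free of measures.
  \<open>skew\<close> carries the orthogonality of \<open>b\<close> to gradients through the product
  rule, \<open>D_closed\<close> and \<open>sup_bound\<close> carry completeness, and
  \<open>dense\<close> carries the nullity of finite sets.\<close>

locale skew_boundary_setting = boundary_setting E C D cls S b B
  for E :: "('a \<Rightarrow> real) \<Rightarrow> ('a \<Rightarrow> real) \<Rightarrow> real" and C :: "('a \<Rightarrow> real) set"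
    and D :: "('a \<Rightarrow> real) \<Rightarrow> 'h::{real_inner, complete_space}"
    and cls :: "('a \<Rightarrow> real) \<Rightarrow> 'l::{real_inner, complete_space}"
    and S :: "'l \<Rightarrow> 'h" and b :: 'h and B :: "'a set" +
  fixes p :: 'a and c1 c2 :: real
  assumes finite_B: "finite B"
    and C_add: "f \<in> C \<Longrightarrow> g \<in> C \<Longrightarrow> (\<lambda>x. f x + g x) \<in> C"
    and C_mult: "f \<in> C \<Longrightarrow> g \<in> C \<Longrightarrow> (\<lambda>x. f x * g x) \<in> C"
    and C_const: "(\<lambda>x. c) \<in> C"
    and D_add: "f \<in> C \<Longrightarrow> g \<in> C \<Longrightarrow> D (\<lambda>x. f x + g x) = D f + D g"
    and D_scale: "f \<in> C \<Longrightarrow> D (\<lambda>x. c * f x) = c *\<^sub>R D f"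
    and D_const: "D (\<lambda>x. c) = 0"
    and D_zero: "f \<in> C \<Longrightarrow> D f = 0 \<Longrightarrow> f x = f y"
    and E_eq: "f \<in> C \<Longrightarrow> g \<in> C \<Longrightarrow> E f g = inner (D f) (D g)"
    and D_closed: "closed (D ` C)"
    and sup_bound: "f \<in> C \<Longrightarrow> \<bar>f x - f p\<bar> \<le> c1 * norm (D f)"
    and cls_add: "f \<in> C \<Longrightarrow> g \<in> C \<Longrightarrow> cls (\<lambda>x. f x + g x) = cls f + cls g"
    and cls_scale: "f \<in> C \<Longrightarrow> cls (\<lambda>x. c * f x) = c *\<^sub>R cls f"
    and cls_bound: "f \<in> C \<Longrightarrow> (\<And>x. \<bar>f x\<bar> \<le> K) \<Longrightarrow> norm (cls f) \<le> c2 * K"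
    and S_linear: "bounded_linear S"
    and S_isometry: "inner (S v) (S w) = inner v w"
    and S_surj: "surj S"
    and S_one: "S (cls (\<lambda>x. 1)) = b"
    and skew: "f \<in> C \<Longrightarrow> g \<in> C \<Longrightarrow> inner (D f) (S (cls g)) = - inner (S (cls f)) (D g)"
    and dense: "closure (cls ` CB) = UNIV"
    and separate: "q \<noteq> q' \<Longrightarrow> \<exists>f\<in>C. f q \<noteq> f q'"
begin

text \<open>The gradient pulled back through the duality map; \<open>A0\<close> is its negative on
  \<open>CB\<close>.\<close>

definition dd :: "('a \<Rightarrow> real) \<Rightarrow> 'l" where "dd f = S_inv (D f)"

section \<open>Linear calculus of functions, gradients and classes\<close>

lemma C_scale: "f \<in> C \<Longrightarrow> (\<lambda>x. c * f x) \<in> C"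
  using C_mult[OF C_const] by simp

lemma C_diff: "f \<in> C \<Longrightarrow> g \<in> C \<Longrightarrow> (\<lambda>x. f x - g x) \<in> C"
  using C_add[of f "\<lambda>x. -1 * g x"] C_scale[of g "-1"] by simp

lemma D_diff: "f \<in> C \<Longrightarrow> g \<in> C \<Longrightarrow> D (\<lambda>x. f x - g x) = D f - D g"
  using D_add[of f "\<lambda>x. -1 * g x"] C_scale[of g "-1"] D_scale[of g "-1"] by simp

lemma cls_diff: "f \<in> C \<Longrightarrow> g \<in> C \<Longrightarrow> cls (\<lambda>x. f x - g x) = cls f - cls g"
  using cls_add[of f "\<lambda>x. -1 * g x"] C_scale[of g "-1"] cls_scale[of g "-1"] by simp

lemma cls_const: "cls (\<lambda>x. c) = c *\<^sub>R cls (\<lambda>x. 1)"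
  using cls_scale[OF C_const, of c 1] by simp

lemma finite_combination:
  assumes "finite A" "\<And>q. q \<in> A \<Longrightarrow> h q \<in> C"
  shows "(\<lambda>x. \<Sum>q\<in>A. k q * h q x) \<in> C"
    and "D (\<lambda>x. \<Sum>q\<in>A. k q * h q x) = (\<Sum>q\<in>A. k q *\<^sub>R D (h q))"
    and "cls (\<lambda>x. \<Sum>q\<in>A. k q * h q x) = (\<Sum>q\<in>A. k q *\<^sub>R cls (h q))"
proof -
  have "(\<lambda>x. \<Sum>q\<in>A. k q * h q x) \<in> C \<and>
    D (\<lambda>x. \<Sum>q\<in>A. k q * h q x) = (\<Sum>q\<in>A. k q *\<^sub>R D (h q)) \<and>
    cls (\<lambda>x. \<Sum>q\<in>A. k q * h q x) = (\<Sum>q\<in>A. k q *\<^sub>R cls (h q))"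
    using assms
  proof (induction A)
    case empty
    then show ?case using C_const[of 0] D_const[of 0] cls_const[of 0] by simp
  next
    case (insert q A)
    have "h q \<in> C" using insert by simp
    with insert show ?case
      using C_scale[of "h q" "k q"] D_scale[of "h q" "k q"] cls_scale[of "h q" "k q"]
        C_add[of "\<lambda>x. k q * h q x" "\<lambda>x. \<Sum>q\<in>A. k q * h q x"]
        D_add[of "\<lambda>x. k q * h q x" "\<lambda>x. \<Sum>q\<in>A. k q * h q x"]
        cls_add[of "\<lambda>x. k q * h q x" "\<lambda>x. \<Sum>q\<in>A. k q * h q x"] by simp
  qed
  then show "(\<lambda>x. \<Sum>q\<in>A. k q * h q x) \<in> C"
    and "D (\<lambda>x. \<Sum>q\<in>A. k q * h q x) = (\<Sum>q\<in>A. k q *\<^sub>R D (h q))"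
    and "cls (\<lambda>x. \<Sum>q\<in>A. k q * h q x) = (\<Sum>q\<in>A. k q *\<^sub>R cls (h q))" by simp_all
qed

lemma CB_C: "f \<in> CB \<Longrightarrow> f \<in> C"
  unfolding CB_def by simp

lemma CB_zero: "f \<in> CB \<Longrightarrow> q \<in> B \<Longrightarrow> f q = 0"
  unfolding CB_def by simp

section \<open>The pulled back gradient and its orthogonal complement\<close>

lemma S_S_inv: "S (S_inv v) = v"
  unfolding S_inv_def using S_surj by (rule surj_f_inv_f)

lemma S_inv_eqI: "S w = v \<Longrightarrow> S_inv v = w"
proof -
  assume "S w = v"
  then have "S (S_inv v - w) = 0" by (simp add: linear_diff[OF bounded_linear.linear[OF S_linear]] S_S_inv)
  then have "inner (S_inv v - w) (S_inv v - w) = 0" using S_isometry[of "S_inv v - w" "S_inv v - w"] by simp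
  then show ?thesis by simp
qed

lemma S_simps: "S (v + w) = S v + S w" "S (c *\<^sub>R v) = c *\<^sub>R S v" "S (v - w) = S v - S w" "S (- v) = - S v" "S 0 = 0"
  by (simp_all add: linear_add[OF bounded_linear.linear[OF S_linear]] linear_scale[OF bounded_linear.linear[OF S_linear]]
    linear_diff[OF bounded_linear.linear[OF S_linear]] linear_neg[OF bounded_linear.linear[OF S_linear]] linear_0[OF bounded_linear.linear[OF S_linear]])

lemma S_dd: "S (dd f) = D f"
  unfolding dd_def by (rule S_S_inv)

lemma dd_add: "f \<in> C \<Longrightarrow> g \<in> C \<Longrightarrow> dd (\<lambda>x. f x + g x) = dd f + dd g"
  unfolding dd_def by (rule S_inv_eqI) (simp add: S_simps S_S_inv D_add)

lemma dd_diff: "f \<in> C \<Longrightarrow> g \<in> C \<Longrightarrow> dd (\<lambda>x. f x - g x) = dd f - dd g"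
  unfolding dd_def by (rule S_inv_eqI) (simp add: S_simps S_S_inv D_diff)

lemma dd_scale: "f \<in> C \<Longrightarrow> dd (\<lambda>x. c * f x) = c *\<^sub>R dd f"
  unfolding dd_def by (rule S_inv_eqI) (simp add: S_simps S_S_inv D_scale)

lemma dd_const: "dd (\<lambda>x. c) = 0"
  unfolding dd_def by (rule S_inv_eqI) (simp add: S_simps D_const)

lemma inner_dd: "inner (dd f) v = inner (D f) (S v)"
  by (simp add: S_dd flip: S_isometry)

lemma inner_dd_right: "inner v (dd f) = inner (D f) (S v)"
  using inner_dd[of f v] by (simp add: inner_commute)

lemma dd_inner_dd: "f \<in> C \<Longrightarrow> g \<in> C \<Longrightarrow> inner (dd f) (dd g) = E f g"
  by (simp add: inner_dd S_dd E_eq)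

lemma dd_zero: "f \<in> C \<Longrightarrow> dd f = 0 \<Longrightarrow> f x = f y"
  using S_dd[of f] D_zero[of f x y] by (simp add: S_simps)

lemma skew_dd: "f \<in> C \<Longrightarrow> g \<in> C \<Longrightarrow> inner (dd f) (cls g) = - inner (cls f) (dd g)"
  using skew[of f g] inner_commute[of "S (cls f)" "D g"] by (simp add: inner_dd inner_dd_right)

abbreviation one where "one \<equiv> cls (\<lambda>x. 1)"

lemma ker_perp_iff: "f \<in> ker_perp \<longleftrightarrow> (\<forall>\<phi>\<in>C. inner (dd \<phi>) f = 0)"
  unfolding ker_perp_def adjoint_kernel_def by (simp add: inner_dd inner_commute[of "S f"])

text \<open>Skewness against the constant function, whose gradient is 0. Under \<open>S\<close> this
  says that \<open>b\<close> itself is orthogonal to all gradients.\<close>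

lemma one_ker: "one \<in> ker_perp"
  unfolding ker_perp_iff using skew_dd[OF _ C_const] by (simp add: dd_const)

lemma ker_subspace: "v \<in> ker_perp \<Longrightarrow> w \<in> ker_perp \<Longrightarrow> v + w \<in> ker_perp"
  "v \<in> ker_perp \<Longrightarrow> w \<in> ker_perp \<Longrightarrow> v - w \<in> ker_perp"
  "v \<in> ker_perp \<Longrightarrow> c *\<^sub>R v \<in> ker_perp" "0 \<in> ker_perp" "v \<in> ker_perp \<Longrightarrow> - v \<in> ker_perp"
  unfolding ker_perp_iff by (simp_all add: inner_add_right inner_diff_right)

lemma D_image_subspace: "Real_Vector_Spaces.subspace (D ` C)"
proof (rule real_vector.subspaceI)
  show "0 \<in> D ` C" using C_const[of 0] D_const[of 0] by force
  fix x y c assume "x \<in> D ` C"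
  then obtain f where f: "f \<in> C" "x = D f" by auto
  show "c *\<^sub>R x \<in> D ` C" using C_scale[OF f(1), of c] D_scale[OF f(1), of c] f(2) by (intro image_eqI[of _ _ "\<lambda>x. c * f x"]) auto
  assume "y \<in> D ` C"
  then obtain g where g: "g \<in> C" "y = D g" by auto
  show "x + y \<in> D ` C" using C_add[OF f(1) g(1)] D_add[OF f(1) g(1)] f(2) g(2) by force
qed

text \<open>Projection of S v onto the closed set of gradients, pulled back by the isometry. Applied
  to perp f it produces g, applied to f - g it produces u.\<close>

lemma decomposition:
  obtains g where "g \<in> C" "v - dd g \<in> ker_perp"
proof -
  obtain y where "y \<in> D ` C" and y: "\<forall>w\<in>D ` C. inner (S v - y) w = 0"
    using orthogonal_projection_exists[OF D_image_subspace D_closed] by metis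
  then obtain g where g: "g \<in> C" "y = D g" by auto
  have "v - dd g \<in> ker_perp"
    unfolding ker_perp_iff using y by (simp add: inner_dd S_simps S_dd g(2) inner_commute)
  with g(1) show thesis by (rule that)
qed

lemma ker_dd_zero: "f \<in> C \<Longrightarrow> dd f \<in> ker_perp \<Longrightarrow> dd f = 0"
  unfolding ker_perp_iff by auto

section \<open>The adjoint operators as relations\<close>

definition adj_rel :: "'l \<Rightarrow> 'l \<Rightarrow> bool" where
  "adj_rel f a \<longleftrightarrow> (\<forall>\<phi>\<in>CB. inner f (dd \<phi>) = - inner a (cls \<phi>))"

text \<open>The sign is the one between \<open>perp\<close> and the adjoint:
  \<open>adj_rel f a\<close> is arranged so that \<open>a\<close> becomes the value of
  \<open>perp\<close> at f.\<close>

lemma adjB_iff: "(S f, a) \<in> adjB \<longleftrightarrow> adj_rel f (- a)"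
  unfolding adjB_def adjoint_op_def adj_rel_def by (auto simp: inner_dd_right inner_commute[of a])

lemma adj_rel_unique: "adj_rel f a \<Longrightarrow> adj_rel f a' \<Longrightarrow> a = a'"
proof -
  assume "adj_rel f a" "adj_rel f a'"
  then have "inner (a - a') y = 0" if "y \<in> cls ` CB" for y
    using that unfolding adj_rel_def by (auto simp: inner_diff_left)
  then have "a - a' = 0" by (rule orthogonal_to_dense[OF dense])
  then show ?thesis by simp
qed

lemma op_apply_adjB: "adj_rel f a \<Longrightarrow> op_apply adjB (S f) = - a"
  unfolding op_apply_def
proof (rule the_equality)
  assume a: "adj_rel f a"
  show "(S f, - a) \<in> adjB" using a by (simp add: adjB_iff)
  show "y = - a" if "(S f, y) \<in> adjB" for y
    using adj_rel_unique[OF a, of "- y"] that by (simp add: adjB_iff)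
qed

lemma dom_perp_iff: "f \<in> dom_perp \<longleftrightarrow> (\<exists>a. adj_rel f a)"
proof -
  have "f \<in> dom_perp \<longleftrightarrow> (\<exists>a. (S f, a) \<in> adjB)" unfolding dom_perp_def by auto
  also have "\<dots> \<longleftrightarrow> (\<exists>a. adj_rel f (- a))" by (simp add: adjB_iff)
  also have "\<dots> \<longleftrightarrow> (\<exists>a. adj_rel f a)" by (metis minus_minus)
  finally show ?thesis .
qed

lemma perp_eq: "adj_rel f a \<Longrightarrow> perp f = a"
  unfolding perp_def by (simp add: op_apply_adjB)

lemma adj_rel_perp: "f \<in> dom_perp \<Longrightarrow> adj_rel f (perp f)"
  unfolding dom_perp_iff using perp_eq by auto

text \<open>\<open>A0\<close> carries a minus sign that \<open>hat_op\<close> removes, so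
  \<open>hat_op A0\<close> is the adjoint of dd on \<open>CB\<close>, which is minus
  \<open>perp\<close>.\<close>

lemma hat_op_iff: "(f, z) \<in> hat_op A0 \<longleftrightarrow> adj_rel f (- z)"
  unfolding hat_op_def adjoint_op_def A0_def adj_rel_def
  by (force simp: inner_commute simp flip: dd_def)

lemma Domain_hat_op: "Domain (hat_op A0) = dom_perp"
proof -
  have "f \<in> Domain (hat_op A0) \<longleftrightarrow> (\<exists>z. adj_rel f (- z))" for f by (auto simp: hat_op_iff)
  also have "\<dots> f \<longleftrightarrow> f \<in> dom_perp" for f unfolding dom_perp_iff by (metis minus_minus)
  finally show ?thesis by auto
qed

lemma op_apply_hat_op: "f \<in> dom_perp \<Longrightarrow> op_apply (hat_op A0) f = - perp f"
  unfolding op_apply_def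
proof (rule the_equality)
  assume f: "f \<in> dom_perp"
  show "(f, - perp f) \<in> hat_op A0" using adj_rel_perp[OF f] by (simp add: hat_op_iff)
  show "y = - perp f" if "(f, y) \<in> hat_op A0" for y
    using adj_rel_unique[OF adj_rel_perp[OF f], of "- y"] that by (simp add: hat_op_iff)
qed

lemma dom_perp_add: "f \<in> dom_perp \<Longrightarrow> g \<in> dom_perp \<Longrightarrow> f + g \<in> dom_perp \<and> perp (f + g) = perp f + perp g"
proof -
  assume "f \<in> dom_perp" "g \<in> dom_perp"
  then have "adj_rel (f + g) (perp f + perp g)"
    using adj_rel_perp[of f] adj_rel_perp[of g] unfolding adj_rel_def by (simp add: inner_add_left)
  then show ?thesis using perp_eq dom_perp_iff by auto
qed

lemma dom_perp_scale: "f \<in> dom_perp \<Longrightarrow> c *\<^sub>R f \<in> dom_perp \<and> perp (c *\<^sub>R f) = c *\<^sub>R perp f"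
proof -
  assume "f \<in> dom_perp"
  then have "adj_rel (c *\<^sub>R f) (c *\<^sub>R perp f)"
    using adj_rel_perp[of f] unfolding adj_rel_def by simp
  then show ?thesis using perp_eq dom_perp_iff by auto
qed

section \<open>Normal parts and harmonic extensions of boundary values\<close>

lemma normal_part_eq:
  assumes "f \<in> dom_perp"
  shows "normal_part (S f) \<phi> = (if B = {} then 0 else inner f (dd \<phi>) + inner (perp f) (cls \<phi>))"
  unfolding normal_part_def op_apply_adjB[OF adj_rel_perp[OF assms]]
  by (simp add: inner_dd_right inner_commute[of "S f"])

lemma b_perp: "one \<in> dom_perp" "perp one = 0"
proof -
  have "adj_rel one 0"
    unfolding adj_rel_def using one_ker[unfolded ker_perp_iff] CB_C by (simp add: inner_commute)
  then show "one \<in> dom_perp" "perp one = 0" using perp_eq dom_perp_iff by auto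
qed

text \<open>The constant function corresponds to \<open>b\<close>, is orthogonal to gradients and
  has perp equal to 0. Hence the term with \<open>g\<close> in the Neumann data of a canonical
  representation takes the value 0.\<close>

lemma normal_part_b: "\<phi> \<in> C \<Longrightarrow> normal_part b \<phi> = 0"
  using normal_part_eq[OF b_perp(1), of \<phi>] one_ker[unfolded ker_perp_iff]
  unfolding S_one b_perp(2) by (simp add: inner_commute)

text \<open>The sup bound controls values only relative to the value at \<open>p\<close>. Comparing
  two points of \<open>B\<close> cancels that value: the limit function is constant on
  \<open>B\<close>, and subtracting the constant lands in \<open>CB\<close>.\<close>

lemma D_CB_closed:
  assumes "B \<noteq> {}"
  shows "closed (D ` CB)"
  unfolding closed_sequential_limits
proof (intro allI impI)
  fix s v assume s: "(\<forall>n. s n \<in> D ` CB) \<and> s \<longlonglongrightarrow> v"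
  then have "\<forall>n. \<exists>f. f \<in> CB \<and> s n = D f" by auto
  then obtain f where f: "\<And>n. f n \<in> CB" "\<And>n. s n = D (f n)" by metis
  have fC: "f n \<in> C" for n using f(1) CB_C by simp
  have "v \<in> D ` C" using closed_sequentially[OF D_closed, of s v] s f(2) fC by auto
  then obtain u where u: "u \<in> C" "v = D u" by auto
  obtain q0 where q0: "q0 \<in> B" using assms by auto
  have "u q = u q0" if q: "q \<in> B" for q
  proof -
    have b: "\<bar>(u q - u p) - (u q0 - u p)\<bar> \<le> 2 * c1 * norm (v - s n)" for n
    proof -
      have d: "norm (D (\<lambda>x. u x - f n x)) = norm (v - s n)" by (simp add: D_diff u fC f(2))
      have "\<bar>(u q - f n q) - (u p - f n p)\<bar> \<le> c1 * norm (v - s n)"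
        "\<bar>(u q0 - f n q0) - (u p - f n p)\<bar> \<le> c1 * norm (v - s n)"
        using sup_bound[OF C_diff[OF u(1) fC], of _ n] unfolding d by auto
      then show ?thesis using CB_zero[OF f(1) q] CB_zero[OF f(1) q0] by (simp add: abs_le_iff)
    qed
    have "(\<lambda>n. 2 * c1 * norm (v - s n)) \<longlonglongrightarrow> 2 * c1 * norm (v - v)" using s by (intro tendsto_intros) auto
    then have "\<bar>(u q - u p) - (u q0 - u p)\<bar> \<le> 2 * c1 * norm (v - v)" using b by (intro LIMSEQ_le_const) auto
    then show ?thesis by simp
  qed
  then have "(\<lambda>x. u x - u q0) \<in> CB" unfolding CB_def using C_diff[OF u(1) C_const] by simp
  moreover have "D (\<lambda>x. u x - u q0) = v" using D_diff[OF u(1) C_const] D_const u(2) by simp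
  ultimately show "v \<in> D ` CB" by force
qed

lemma D_CB_subspace: "Real_Vector_Spaces.subspace (D ` CB)"
proof (rule real_vector.subspaceI)
  have "(\<lambda>x. 0) \<in> CB" using C_const[of 0] unfolding CB_def by simp
  then show "0 \<in> D ` CB" using D_const[of 0] by force
  fix x y c assume "x \<in> D ` CB"
  then obtain f where f: "f \<in> CB" "x = D f" by auto
  have "(\<lambda>x. c * f x) \<in> CB" using f C_scale unfolding CB_def by simp
  then show "c *\<^sub>R x \<in> D ` CB" using D_scale[OF CB_C[OF f(1)], of c] f(2) by (intro image_eqI[of _ _ "\<lambda>x. c * f x"]) auto
  assume "y \<in> D ` CB"
  then obtain g where g: "g \<in> CB" "y = D g" by auto
  have "(\<lambda>x. f x + g x) \<in> CB" using f g C_add unfolding CB_def by simp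
  then show "x + y \<in> D ` CB" using D_add[OF CB_C[OF f(1)] CB_C[OF g(1)]] f(2) g(2) by force
qed

text \<open>One factor for each point of \<open>A\<close>, affine in a function separating it from
  \<open>q\<close>: it vanishes at that point and equals 1 at \<open>q\<close>.\<close>

lemma point_separating_function:
  assumes "finite A" "q \<notin> A"
  shows "\<exists>f\<in>C. f q = 1 \<and> (\<forall>x\<in>A. f x = 0)"
  using assms
proof (induction A)
  case empty
  then show ?case using C_const[of 1] by force
next
  case (insert q' A)
  then obtain f where f: "f \<in> C" "f q = 1" "\<forall>x\<in>A. f x = 0" by auto
  obtain g where g: "g \<in> C" "g q \<noteq> g q'" using separate[of q q'] insert by auto
  have "(\<lambda>x. f x * (1 / (g q - g q') * (g x - g q'))) \<in> C"
    by (intro C_mult C_scale C_diff f g C_const)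
  then show ?case using f(2,3) g(2) by (intro bexI) auto
qed

text \<open>Existence: remove from a function with the required boundary values its projection onto
  gradients of \<open>CB\<close>. Uniqueness: the difference of two candidates lies in
  \<open>CB\<close> and has energy 0, so it is constant, and it vanishes at
  \<open>q\<close>.\<close>

lemma psi:
  assumes "q \<in> B"
  shows "\<psi> q \<in> C" "\<psi> q q = 1" "\<And>x. x \<in> B \<Longrightarrow> x \<noteq> q \<Longrightarrow> \<psi> q x = 0" "\<And>\<phi>. \<phi> \<in> CB \<Longrightarrow> E (\<psi> q) \<phi> = 0"
proof -
  define Q where "Q f \<longleftrightarrow> f \<in> C \<and> f q = 1 \<and> (\<forall>x\<in>B - {q}. f x = 0) \<and> (\<forall>\<phi>\<in>CB. E f \<phi> = 0)" for f
  have Bne: "B \<noteq> {}" using assms by auto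
  obtain f0 where f0: "f0 \<in> C" "f0 q = 1" "\<forall>x\<in>B - {q}. f0 x = 0"
    using point_separating_function[of "B - {q}" q] finite_B by auto
  obtain y where "y \<in> D ` CB" and y: "\<forall>w\<in>D ` CB. inner (D f0 - y) w = 0"
    using orthogonal_projection_exists[OF D_CB_subspace D_CB_closed[OF Bne]] by metis
  then obtain g where g: "g \<in> CB" "y = D g" by auto
  have gC: "g \<in> C" using CB_C[OF g(1)] .
  have Q0: "Q (\<lambda>x. f0 x - g x)"
    unfolding Q_def
  proof (intro conjI ballI)
    show "(\<lambda>x. f0 x - g x) \<in> C" by (intro C_diff f0 gC)
    show "f0 q - g q = 1" using f0(2) CB_zero[OF g(1) assms] by simp
    show "f0 x - g x = 0" if "x \<in> B - {q}" for x using f0(3) CB_zero[OF g(1), of x] that by simp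
    show "E (\<lambda>x. f0 x - g x) \<phi> = 0" if "\<phi> \<in> CB" for \<phi>
      using y that g(2) by (simp add: E_eq[OF C_diff[OF f0(1) gC] CB_C[OF that]] D_diff[OF f0(1) gC])
  qed
  have "f = f'" if f: "Q f" and f': "Q f'" for f f'
  proof -
    have C: "f \<in> C" "f' \<in> C" using f f' unfolding Q_def by auto
    have dCB: "(\<lambda>x. f x - f' x) \<in> CB"
      unfolding CB_def
    proof (intro CollectI conjI ballI)
      show "(\<lambda>x. f x - f' x) \<in> C" by (rule C_diff[OF C])
      show "f x - f' x = 0" if "x \<in> B" for x
        using f f' that unfolding Q_def by (cases "x = q") simp_all
    qed
    have "E f (\<lambda>x. f x - f' x) = 0" "E f' (\<lambda>x. f x - f' x) = 0"
      using f f' dCB unfolding Q_def by auto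
    then have "inner (D (\<lambda>x. f x - f' x)) (D (\<lambda>x. f x - f' x)) = 0"
      using C C_diff[OF C] by (simp add: E_eq D_diff inner_diff_left)
    then have "D (\<lambda>x. f x - f' x) = 0" by simp
    then have "f x - f' x = f q - f' q" for x using D_zero[OF C_diff[OF C], of x q] by simp
    then show ?thesis using CB_zero[OF dCB assms] by (intro ext) simp
  qed
  from theI[of Q, OF Q0 this[OF _ Q0]] have "Q (THE f. Q f)" .
  then have "Q (\<psi> q)" unfolding \<psi>_def Q_def .
  then show "\<psi> q \<in> C" "\<psi> q q = 1" "\<And>x. x \<in> B \<Longrightarrow> x \<noteq> q \<Longrightarrow> \<psi> q x = 0" "\<And>\<phi>. \<phi> \<in> CB \<Longrightarrow> E (\<psi> q) \<phi> = 0"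
    unfolding Q_def by auto
qed

text \<open>The extension of values on \<open>B\<close> that is harmonic off
  \<open>B\<close>.\<close>

definition trace_ext :: "('a \<Rightarrow> real) \<Rightarrow> 'a \<Rightarrow> real" where
  "trace_ext k = (\<lambda>x. \<Sum>q\<in>B. k q * \<psi> q x)"

lemma trace_ext: "trace_ext k \<in> C" "q \<in> B \<Longrightarrow> trace_ext k q = k q"
proof -
  show "trace_ext k \<in> C" unfolding trace_ext_def by (rule finite_combination) (use finite_B psi(1) in auto)
  assume q: "q \<in> B"
  have "(\<Sum>q'\<in>B. k q' * \<psi> q' q) = (\<Sum>q'\<in>B. if q' = q then k q else 0)"
    by (rule sum.cong) (use psi(2,3) q in auto)
  then show "trace_ext k q = k q" unfolding trace_ext_def using finite_B q by simp
qed

text \<open>The defining property of \<open>\<partial>\<^sub>B\<^sup>*\<close> tests against functions vanishing on \<open>B\<close>; the normal part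
  collects the error made by testing against all of \<open>C\<close>.\<close>

lemma integration_by_parts:
  assumes f: "f \<in> dom_perp" and \<phi>: "\<phi> \<in> C"
  shows "inner f (dd \<phi>) = (\<Sum>q\<in>B. \<phi> q * normal_part (S f) (\<psi> q)) - inner (perp f) (cls \<phi>)"
proof -
  \<comment> \<open>This difference is an admissible test function in \<open>adj_rel\<close>; what
    remains is the harmonic part, which is expanded in the functions \<psi>.\<close>
  have d: "(\<lambda>x. \<phi> x - trace_ext \<phi> x) \<in> CB"
    unfolding CB_def using C_diff[OF \<phi> trace_ext(1)] trace_ext(2) by simp
  have eq0: "inner f (dd \<phi>) - inner f (dd (trace_ext \<phi>)) =
      - (inner (perp f) (cls \<phi>) - inner (perp f) (cls (trace_ext \<phi>)))"
    using adj_rel_perp[OF f, unfolded adj_rel_def, rule_format, OF d]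
    by (simp add: dd_diff[OF \<phi> trace_ext(1)] cls_diff[OF \<phi> trace_ext(1)] inner_diff_right)
  have sD: "S (dd (trace_ext \<phi>)) = (\<Sum>q\<in>B. \<phi> q *\<^sub>R D (\<psi> q))"
    unfolding S_dd trace_ext_def by (rule finite_combination) (use finite_B psi(1) in auto)
  have sc: "cls (trace_ext \<phi>) = (\<Sum>q\<in>B. \<phi> q *\<^sub>R cls (\<psi> q))"
    unfolding trace_ext_def by (rule finite_combination) (use finite_B psi(1) in auto)
  have "inner f (dd (trace_ext \<phi>)) = (\<Sum>q\<in>B. \<phi> q * inner f (dd (\<psi> q)))"
    unfolding S_isometry[symmetric, of f] sD by (simp add: inner_sum_right S_dd)
  moreover have "inner (perp f) (cls (trace_ext \<phi>)) = (\<Sum>q\<in>B. \<phi> q * inner (perp f) (cls (\<psi> q)))"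
    unfolding sc by (simp add: inner_sum_right)
  \<comment> \<open>For empty \<open>B\<close> the normal part is 0 by convention, and so are the
    extension and the sum.\<close>
  ultimately have "inner f (dd (trace_ext \<phi>)) + inner (perp f) (cls (trace_ext \<phi>)) =
      (\<Sum>q\<in>B. \<phi> q * normal_part (S f) (\<psi> q))"
    unfolding normal_part_eq[OF f] by (cases "B = {}") (simp_all add: distrib_left sum.distrib)
  with eq0 show ?thesis by simp
qed

end

lemma lookup_scaleR_real: "Poly_Mapping.lookup (c *\<^sub>R (x :: ('a, real) poly_mapping)) q = c * Poly_Mapping.lookup x q"
proof -
  have "finite {i. c *\<^sub>R Poly_Mapping.lookup x i \<noteq> 0}"
    by (rule finite_subset[OF _ finite_keys[of x]]) (auto simp: in_keys_iff)
  then show ?thesis unfolding scaleR_poly_mapping_def by simp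
qed

context skew_boundary_setting
begin

section \<open>Canonical representations\<close>

lemma z_part_eq: "z_part f g = perp f - dd g"
  unfolding z_part_def dd_def ..

text \<open>Pairing f with dd \<phi> yields the weak equation for u: w is orthogonal to gradients,
  skewness moves dd from \<phi> onto g, and the normal part of \<open>b\<close> is 0. For empty
  \<open>B\<close> every \<phi> in \<open>C\<close> may be inserted into
  \<open>adj_rel\<close>.\<close>

lemma canonical_rep_iff:
  "canonical_rep f g u w \<longleftrightarrow> f \<in> dom_perp \<and> f = cls g + dd u + w \<and> g \<in> C \<and> u \<in> C \<and>
    perp f - dd g \<in> ker_perp \<and> w \<in> ker_perp"
proof -
  have "weak_solution (perp f - dd g) (\<lambda>\<phi>. normal_part (S f) \<phi> - normal_part b (\<lambda>x. g x * \<phi> x)) u"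
    if f: "f \<in> dom_perp" and eq: "f = cls g + dd u + w" and g: "g \<in> C" and u: "u \<in> C" and w: "w \<in> ker_perp"
    unfolding weak_solution_def
  proof (intro conjI ballI u)
    fix \<phi> assume \<phi>: "\<phi> \<in> C"
    have "inner f (dd \<phi>) = inner (cls g) (dd \<phi>) + E u \<phi>"
      unfolding eq inner_add_left dd_inner_dd[OF u \<phi>]
      using w \<phi> unfolding ker_perp_iff by (simp add: inner_commute)
    then have 1: "E u \<phi> = inner f (dd \<phi>) + inner (dd g) (cls \<phi>)"
      using skew_dd[OF g \<phi>] by simp
    have 2: "B = {} \<Longrightarrow> inner f (dd \<phi>) = - inner (perp f) (cls \<phi>)"
      using adj_rel_perp[OF f] \<phi> unfolding adj_rel_def CB_def by simp
    show "E u \<phi> = normal_part (S f) \<phi> - normal_part b (\<lambda>x. g x * \<phi> x) - inner (perp f - dd g) (cls \<phi>)"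
      unfolding normal_part_b[OF C_mult[OF g \<phi>]] normal_part_eq[OF f] using 1 2 by (auto simp: inner_diff_left)
  qed
  moreover have "weak_solution z G u \<Longrightarrow> u \<in> C" for z G unfolding weak_solution_def by simp
  ultimately show ?thesis
    unfolding canonical_rep_def z_part_eq by (auto simp flip: dd_def)
qed

lemma canonical_rep_exists:
  assumes f: "f \<in> dom_perp"
  obtains g u w where "canonical_rep f g u w"
proof -
  obtain g where g: "g \<in> C" "perp f - dd g \<in> ker_perp" using decomposition by metis
  obtain u where u: "u \<in> C" "(f - cls g) - dd u \<in> ker_perp" using decomposition by metis
  show thesis
    by (rule that[of g u "f - cls g - dd u"]) (use f g u in \<open>simp add: canonical_rep_iff\<close>)
qed

text \<open>The difference of the two g has a derivative that also lies in the kernel, hence is 0,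
  so the difference is a constant c. The same argument for the u parts leaves c + w' - w =
  0.\<close>

lemma canonical_rep_unique:
  assumes r: "canonical_rep f g u w" and r': "canonical_rep f g' u' w'"
  obtains c where "g' = (\<lambda>x. g x + c)" "w' = w - c *\<^sub>R one" "z_part f g' = z_part f g"
proof -
  note r = r[unfolded canonical_rep_iff] and r' = r'[unfolded canonical_rep_iff]
  have C: "g \<in> C" "g' \<in> C" "u \<in> C" "u' \<in> C" using r r' by auto
  have "perp f - dd g \<in> ker_perp" "perp f - dd g' \<in> ker_perp" using r r' by metis+
  then have "(perp f - dd g) - (perp f - dd g') \<in> ker_perp" by (rule ker_subspace(2))
  then have "dd (\<lambda>x. g' x - g x) \<in> ker_perp" by (simp add: dd_diff C)
  then have z: "dd (\<lambda>x. g' x - g x) = 0" by (rule ker_dd_zero[OF C_diff[OF C(2,1)]])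
  define c where "c = g' p - g p"
  have "g' x - g x = c" for x unfolding c_def by (rule dd_zero[OF C_diff[OF C(2,1)] z])
  then have g': "g' = (\<lambda>x. g x + c)" by (simp add: fun_eq_iff algebra_simps)
  have cg: "cls g' = cls g + c *\<^sub>R one" unfolding g' using cls_add[OF C(1) C_const] cls_const[of c] by simp
  have "f = cls g + dd u + w" "f = cls g' + dd u' + w'" using r r' by auto
  then have eq: "dd u - dd u' = c *\<^sub>R one + w' - w" unfolding cg by (simp add: algebra_simps)
  have "c *\<^sub>R one + w' - w \<in> ker_perp" using r r' by (intro ker_subspace one_ker) auto
  then have "dd (\<lambda>x. u x - u' x) \<in> ker_perp" by (simp add: dd_diff C eq)
  then have "dd (\<lambda>x. u x - u' x) = 0" by (rule ker_dd_zero[OF C_diff[OF C(3,4)]])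
  then have "c *\<^sub>R one + w' - w = 0" by (simp add: dd_diff C eq)
  then have "w' = w - c *\<^sub>R one" by (simp add: algebra_simps)
  moreover have "z_part f g' = z_part f g" using z by (simp add: z_part_eq dd_diff C)
  ultimately show thesis using g' by (intro that)
qed

section \<open>The space of boundary data and its projection\<close>

lemma lookup_on_B: "Poly_Mapping.lookup (on_B F) q = (if q \<in> B then F q else 0)"
proof -
  have "finite {q. (if q \<in> B then F q else 0) \<noteq> 0}" by (rule finite_subset[OF _ finite_B]) auto
  then show ?thesis unfolding on_B_def by simp
qed

lemma on_B_add: "on_B (\<lambda>q. F q + G q) = on_B F + on_B G"
  by (rule poly_mapping_eqI) (simp add: lookup_on_B lookup_add)

lemma on_B_scale: "on_B (\<lambda>q. c * F q) = c *\<^sub>R on_B F"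
  by (rule poly_mapping_eqI) (simp add: lookup_on_B lookup_scaleR_real)

lemma keys_on_B: "Poly_Mapping.keys (on_B F) \<subseteq> B"
  by (auto simp: in_keys_iff lookup_on_B split: if_splits)

lemma ip_add_left: "ip (X + Y) Z = ip X Z + ip Y Z"
  unfolding ip_def by (simp add: lookup_add distrib_right sum.distrib inner_add_left)

lemma ip_scale_left: "ip (c *\<^sub>R X) Z = c * ip X Z"
  unfolding ip_def by (simp add: lookup_scaleR_real sum_distrib_left distrib_left mult.assoc)

lemma ip_sym: "ip X Y = ip Y X"
  unfolding ip_def by (simp add: mult.commute inner_commute)

lemma ip_diff_left: "ip (X - Y) Z = ip X Z - ip Y Z"
  using ip_add_left[of X "(-1) *\<^sub>R Y"] ip_scale_left[of "-1" Y] by simp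

lemma ip_scale_right: "ip Z (c *\<^sub>R X) = c * ip Z X"
  by (simp add: ip_sym[of Z] ip_scale_left)

lemma ip_diff_right: "ip Z (X - Y) = ip Z X - ip Z Y"
  by (simp add: ip_sym[of Z] ip_diff_left)

lemma H_tilde_iff: "X \<in> H_tilde \<longleftrightarrow> Poly_Mapping.keys (fst X) \<subseteq> B \<and> snd X \<in> ker_perp"
  unfolding H_tilde_def by (cases X) simp

lemma keys_subset_iff: "Poly_Mapping.keys (x :: ('a, real) poly_mapping) \<subseteq> B \<longleftrightarrow> (\<forall>q. q \<notin> B \<longrightarrow> Poly_Mapping.lookup x q = 0)"
  by (auto simp: in_keys_iff)

lemma H_tilde_subspace: "X \<in> H_tilde \<Longrightarrow> Y \<in> H_tilde \<Longrightarrow> X + Y \<in> H_tilde"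
  "X \<in> H_tilde \<Longrightarrow> c *\<^sub>R X \<in> H_tilde" "0 \<in> H_tilde"
  unfolding H_tilde_iff keys_subset_iff by (simp_all add: lookup_add lookup_scaleR_real ker_subspace)

lemma H_tilde_diff: "X \<in> H_tilde \<Longrightarrow> Y \<in> H_tilde \<Longrightarrow> X - Y \<in> H_tilde"
  using H_tilde_subspace(1)[of X "(-1) *\<^sub>R Y"] H_tilde_subspace(2)[of Y "-1"] by simp

lemma ip_nonneg: "0 \<le> ip X X"
  unfolding ip_def by (intro add_nonneg_nonneg sum_nonneg) auto

lemma ip_definite:
  assumes "X \<in> H_tilde" "ip X X = 0"
  shows "X = 0"
proof -
  have s: "0 \<le> (\<Sum>q\<in>B. Poly_Mapping.lookup (fst X) q * Poly_Mapping.lookup (fst X) q)" by (intro sum_nonneg) auto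
  have i: "0 \<le> inner (snd X) (snd X)" by simp
  have "(\<Sum>q\<in>B. Poly_Mapping.lookup (fst X) q * Poly_Mapping.lookup (fst X) q) = 0" "inner (snd X) (snd X) = 0"
    using assms(2) s i unfolding ip_def by linarith+
  moreover from this(1) have "\<forall>q\<in>B. Poly_Mapping.lookup (fst X) q * Poly_Mapping.lookup (fst X) q = 0"
    using finite_B by (subst (asm) sum_nonneg_eq_0_iff) auto
  then have "fst X = 0" using assms(1) unfolding H_tilde_iff keys_subset_iff by (intro poly_mapping_eqI) auto
  ultimately show ?thesis by (simp add: prod_eq_iff)
qed

definition unit_vec :: "('a, real) poly_mapping \<times> 'l" where "unit_vec = (on_B (\<lambda>q. 1), - one)"

lemma unit_vec_H_tilde: "unit_vec \<in> H_tilde"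
  unfolding H_tilde_iff unit_vec_def by (simp add: keys_on_B ker_subspace one_ker)

lemma ip_unit_vec: "ip X unit_vec = (\<Sum>q\<in>B. Poly_Mapping.lookup (fst X) q) - inner (snd X) one"
  unfolding ip_def unit_vec_def by (simp add: lookup_on_B)

lemma H_iff: "X \<in> H \<longleftrightarrow> X \<in> H_tilde \<and> ip X unit_vec = 0"
  unfolding H_def unit_vec_def[symmetric]
  by (auto simp: real_vector.span_singleton ip_scale_right intro: real_vector.span_base)

lemma H_subspace: "X \<in> H \<Longrightarrow> Y \<in> H \<Longrightarrow> X + Y \<in> H" "X \<in> H \<Longrightarrow> c *\<^sub>R X \<in> H" "0 \<in> H"
  "X \<in> H \<Longrightarrow> Y \<in> H \<Longrightarrow> X - Y \<in> H"
  unfolding H_iff using ip_scale_left[of 0 0 unit_vec]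
  by (simp_all add: H_tilde_subspace H_tilde_diff ip_add_left ip_scale_left ip_diff_left)

text \<open>If \<open>unit_vec\<close> vanishes, the quotient is \<open>0 / 0 = 0\<close> and \<open>P\<close> is the identity.\<close>

lemma P_eq:
  assumes X: "X \<in> H_tilde"
  shows "P X = X - (ip X unit_vec / ip unit_vec unit_vec) *\<^sub>R unit_vec"
  unfolding P_def
proof (rule the_equality)
  let ?Y = "X - (ip X unit_vec / ip unit_vec unit_vec) *\<^sub>R unit_vec"
  have "ip ?Y unit_vec = 0"
  proof (cases "ip unit_vec unit_vec = 0")
    case True
    then have "unit_vec = 0" by (rule ip_definite[OF unit_vec_H_tilde])
    then show ?thesis using ip_scale_right[of _ 0 0] by simp
  qed (simp add: ip_diff_left ip_scale_left)
  then have Y: "?Y \<in> H" unfolding H_iff by (simp add: H_tilde_diff H_tilde_subspace X unit_vec_H_tilde)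
  have Y': "ip (X - ?Y) L = 0" if "L \<in> H" for L
    using that ip_sym[of unit_vec L] unfolding H_iff by (simp add: ip_scale_left)
  show "?Y \<in> H \<and> (\<forall>L\<in>H. ip (X - ?Y) L = 0)" using Y Y' by simp
  fix K assume K: "K \<in> H \<and> (\<forall>L\<in>H. ip (X - K) L = 0)"
  then have d: "K - ?Y \<in> H" using Y H_subspace(4) by blast
  have "ip (X - K) (K - ?Y) = 0" "ip (X - ?Y) (K - ?Y) = 0" using K Y' d by auto
  then have "ip (K - ?Y) (K - ?Y) = 0" by (simp add: ip_diff_left)
  then have "K - ?Y = 0" using d unfolding H_iff by (intro ip_definite) auto
  then show "K = ?Y" by simp
qed

lemma P_H: "X \<in> H \<Longrightarrow> P X = X"
  unfolding H_iff using P_eq[of X] by simp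

lemma P_linear: "X \<in> H_tilde \<Longrightarrow> Y \<in> H_tilde \<Longrightarrow> P (X + Y) = P X + P Y"
  "X \<in> H_tilde \<Longrightarrow> P (c *\<^sub>R X) = c *\<^sub>R P X"
  by (simp_all add: P_eq H_tilde_subspace ip_add_left ip_scale_left add_divide_distrib
    scaleR_left_distrib scaleR_right_diff_distrib)

lemma P_in_H: "X \<in> H_tilde \<Longrightarrow> P X \<in> H"
proof -
  assume X: "X \<in> H_tilde"
  have "ip (P X) unit_vec = 0"
  proof (cases "ip unit_vec unit_vec = 0")
    case True
    then have "unit_vec = 0" by (rule ip_definite[OF unit_vec_H_tilde])
    then show ?thesis using ip_scale_right[of _ 0 0] by simp
  qed (simp add: P_eq[OF X] ip_diff_left ip_scale_left)
  then show ?thesis unfolding H_iff P_eq[OF X] by (simp add: H_tilde_diff H_tilde_subspace X unit_vec_H_tilde)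
qed

lemma ip_P:
  assumes X: "X \<in> H_tilde" and Y: "Y \<in> H_tilde"
  shows "ip (P X) (P Y) = ip X Y - ip X unit_vec * ip Y unit_vec / ip unit_vec unit_vec"
proof (cases "ip unit_vec unit_vec = 0")
  \<comment> \<open>Division by 0 yields 0, so neither side is corrected.\<close>
  case True
  then show ?thesis by (simp add: P_eq X Y)
next
  case False
  then show ?thesis
    by (simp add: P_eq X Y ip_diff_left ip_diff_right ip_scale_left ip_scale_right ip_sym[of unit_vec Y] field_simps)
qed

text \<open>One family for both boundary maps: s = 1 belongs to \<open>G_minus\<close> and s = -1 to
  \<open>G_plus\<close>.\<close>

definition boundary_data :: "real \<Rightarrow> 'l \<Rightarrow> ('a \<Rightarrow> real) \<Rightarrow> 'l \<Rightarrow> ('a, real) poly_mapping \<times> 'l" where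
  "boundary_data s f g w = (on_B g + s *\<^sub>R normal_values (S f), w + s *\<^sub>R z_part f g)"

definition boundary_map :: "real \<Rightarrow> 'l \<Rightarrow> ('a, real) poly_mapping \<times> 'l" where
  "boundary_map s f = (THE F. \<exists>g u w. canonical_rep f g u w \<and> F = (1 / sqrt 2) *\<^sub>R P (boundary_data s f g w))"

lemma G_minus_eq: "G_minus = boundary_map 1" and G_plus_eq: "G_plus = boundary_map (-1)"
  unfolding G_minus_def[abs_def] G_plus_def[abs_def] boundary_map_def[abs_def] boundary_data_def by simp_all

lemma canonical_repD:
  assumes "canonical_rep f g u w"
  shows "f \<in> dom_perp" "f = cls g + dd u + w" "g \<in> C" "u \<in> C" "z_part f g \<in> ker_perp" "w \<in> ker_perp"
    "perp f = dd g + z_part f g"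
proof -
  show "f \<in> dom_perp" using assms unfolding canonical_rep_iff z_part_eq by (elim conjE)
  show "g \<in> C" using assms unfolding canonical_rep_iff z_part_eq by (elim conjE)
  show "u \<in> C" using assms unfolding canonical_rep_iff z_part_eq by (elim conjE)
  show "z_part f g \<in> ker_perp" using assms unfolding canonical_rep_iff z_part_eq by (elim conjE)
  show "w \<in> ker_perp" using assms unfolding canonical_rep_iff z_part_eq by (elim conjE)
  show "f = cls g + dd u + w" using assms unfolding canonical_rep_iff by (elim conjE)
  show "perp f = dd g + z_part f g" by (simp add: z_part_eq)
qed

lemma boundary_data_H_tilde: "canonical_rep f g u w \<Longrightarrow> boundary_data s f g w \<in> H_tilde"
  using canonical_repD(5,6)[of f g u w] unfolding boundary_data_def H_tilde_iff normal_values_def keys_subset_iff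
  by (simp add: lookup_add lookup_scaleR_real lookup_on_B ker_subspace)

text \<open>Two representations of f differ by a constant c, which changes the data by c times
  \<open>unit_vec\<close>; the projection removes this, so exactly one value meets the definite
  description.\<close>

lemma boundary_map_eq:
  assumes r: "canonical_rep f g u w"
  shows "boundary_map s f = (1 / sqrt 2) *\<^sub>R P (boundary_data s f g w)"
  unfolding boundary_map_def
proof (rule the_equality)
  show "\<exists>g' u w'. canonical_rep f g' u w' \<and> (1 / sqrt 2) *\<^sub>R P (boundary_data s f g w) = (1 / sqrt 2) *\<^sub>R P (boundary_data s f g' w')"
    using r by (intro exI[of _ g] exI[of _ u] exI[of _ w] conjI refl)
  fix F assume "\<exists>g' u' w'. canonical_rep f g' u' w' \<and> F = (1 / sqrt 2) *\<^sub>R P (boundary_data s f g' w')"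
  then obtain g' u' w' where r': "canonical_rep f g' u' w'" and F: "F = (1 / sqrt 2) *\<^sub>R P (boundary_data s f g' w')"
    by (elim exE conjE)
  obtain c where c: "g' = (\<lambda>x. g x + c)" "w' = w - c *\<^sub>R one" "z_part f g' = z_part f g"
    by (rule canonical_rep_unique[OF r r'])
  have "on_B g' = on_B g + c *\<^sub>R on_B (\<lambda>q. 1)"
    unfolding c(1) on_B_add using on_B_scale[of c "\<lambda>q. 1"] by simp
  then have d: "boundary_data s f g' w' = boundary_data s f g w + c *\<^sub>R unit_vec"
    unfolding boundary_data_def c(2,3) unit_vec_def by (simp add: algebra_simps)
  have "P unit_vec = 0"
  proof (cases "ip unit_vec unit_vec = 0")
    case True
    then have "unit_vec = 0" by (rule ip_definite[OF unit_vec_H_tilde])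
    then show ?thesis using P_linear(2)[OF H_tilde_subspace(3), of 0] by simp
  qed (simp add: P_eq unit_vec_H_tilde)
  then show "F = (1 / sqrt 2) *\<^sub>R P (boundary_data s f g w)"
    unfolding F d by (simp add: P_linear boundary_data_H_tilde[OF r] H_tilde_subspace unit_vec_H_tilde)
qed

lemma boundary_map_H: "f \<in> dom_perp \<Longrightarrow> boundary_map s f \<in> H"
proof -
  assume "f \<in> dom_perp"
  then obtain g u w where "canonical_rep f g u w" by (rule canonical_rep_exists)
  then show ?thesis using boundary_map_eq P_in_H boundary_data_H_tilde H_subspace(2) by simp
qed

lemma canonical_rep_add:
  assumes r: "canonical_rep f g u w" and r': "canonical_rep f' g' u' w'"
  shows "canonical_rep (f + f') (\<lambda>x. g x + g' x) (\<lambda>x. u x + u' x) (w + w')"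
    "boundary_data s (f + f') (\<lambda>x. g x + g' x) (w + w') = boundary_data s f g w + boundary_data s f' g' w'"
proof -
  note d = canonical_repD[OF r] and d' = canonical_repD[OF r']
  have p: "f + f' \<in> dom_perp" "perp (f + f') = perp f + perp f'" using dom_perp_add[OF d(1) d'(1)] by auto
  have z: "z_part (f + f') (\<lambda>x. g x + g' x) = z_part f g + z_part f' g'"
    using d d' p(2) by (simp add: z_part_eq dd_add)
  have "f + f' = (cls g + dd u + w) + (cls g' + dd u' + w')" using d(2) d'(2) by metis
  then have "f + f' = cls (\<lambda>x. g x + g' x) + dd (\<lambda>x. u x + u' x) + (w + w')"
    using d(3,4) d'(3,4) by (simp add: cls_add dd_add)
  then show "canonical_rep (f + f') (\<lambda>x. g x + g' x) (\<lambda>x. u x + u' x) (w + w')"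
    unfolding canonical_rep_iff z_part_eq[symmetric] z
    using p d d' by (auto intro: C_add ker_subspace)
  have "normal_part (S (f + f')) \<phi> = normal_part (S f) \<phi> + normal_part (S f') \<phi>" for \<phi>
    unfolding normal_part_eq[OF p(1)] normal_part_eq[OF d(1)] normal_part_eq[OF d'(1)] p(2)
    by (simp add: inner_add_left)
  then have "normal_values (S (f + f')) = normal_values (S f) + normal_values (S f')"
    unfolding normal_values_def by (simp add: on_B_add)
  then show "boundary_data s (f + f') (\<lambda>x. g x + g' x) (w + w') = boundary_data s f g w + boundary_data s f' g' w'"
    unfolding boundary_data_def z on_B_add by (simp add: scaleR_right_distrib)
qed

lemma canonical_rep_scale:
  assumes r: "canonical_rep f g u w"
  shows "canonical_rep (c *\<^sub>R f) (\<lambda>x. c * g x) (\<lambda>x. c * u x) (c *\<^sub>R w)"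
    "boundary_data s (c *\<^sub>R f) (\<lambda>x. c * g x) (c *\<^sub>R w) = c *\<^sub>R boundary_data s f g w"
proof -
  note d = canonical_repD[OF r]
  have p: "c *\<^sub>R f \<in> dom_perp" "perp (c *\<^sub>R f) = c *\<^sub>R perp f" using dom_perp_scale[OF d(1)] by auto
  have z: "z_part (c *\<^sub>R f) (\<lambda>x. c * g x) = c *\<^sub>R z_part f g"
    using d p(2) by (simp add: z_part_eq dd_scale scaleR_right_diff_distrib)
  have "c *\<^sub>R f = c *\<^sub>R (cls g + dd u + w)" using d(2) by metis
  then have "c *\<^sub>R f = cls (\<lambda>x. c * g x) + dd (\<lambda>x. c * u x) + c *\<^sub>R w"
    using d(3,4) by (simp add: cls_scale dd_scale scaleR_right_distrib)
  then show "canonical_rep (c *\<^sub>R f) (\<lambda>x. c * g x) (\<lambda>x. c * u x) (c *\<^sub>R w)"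
    unfolding canonical_rep_iff z_part_eq[symmetric] z
    using p d by (auto intro: C_scale ker_subspace)
  have "normal_part (S (c *\<^sub>R f)) \<phi> = c * normal_part (S f) \<phi>" for \<phi>
    unfolding normal_part_eq[OF p(1)] normal_part_eq[OF d(1)] p(2) by (simp add: distrib_left)
  then have "normal_values (S (c *\<^sub>R f)) = c *\<^sub>R normal_values (S f)"
    unfolding normal_values_def by (simp add: on_B_scale)
  then show "boundary_data s (c *\<^sub>R f) (\<lambda>x. c * g x) (c *\<^sub>R w) = c *\<^sub>R boundary_data s f g w"
    unfolding boundary_data_def z on_B_scale by (simp add: scaleR_right_distrib mult.commute)
qed

lemma boundary_map_add: "f \<in> dom_perp \<Longrightarrow> f' \<in> dom_perp \<Longrightarrow> boundary_map s (f + f') = boundary_map s f + boundary_map s f'"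
proof -
  assume "f \<in> dom_perp" "f' \<in> dom_perp"
  then obtain g u w g' u' w' where r: "canonical_rep f g u w" and r': "canonical_rep f' g' u' w'"
    by (metis canonical_rep_exists)
  show ?thesis
    unfolding boundary_map_eq[OF r] boundary_map_eq[OF r'] boundary_map_eq[OF canonical_rep_add(1)[OF r r']] canonical_rep_add(2)[OF r r']
    by (simp add: P_linear boundary_data_H_tilde[OF r] boundary_data_H_tilde[OF r'] scaleR_right_distrib)
qed

lemma boundary_map_scale: "f \<in> dom_perp \<Longrightarrow> boundary_map s (c *\<^sub>R f) = c *\<^sub>R boundary_map s f"
proof -
  assume "f \<in> dom_perp"
  then obtain g u w where r: "canonical_rep f g u w" by (rule canonical_rep_exists)
  show ?thesis
    unfolding boundary_map_eq[OF r] boundary_map_eq[OF canonical_rep_scale(1)[OF r]] canonical_rep_scale(2)[OF r]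
    by (simp add: P_linear boundary_data_H_tilde[OF r] mult.commute)
qed

text \<open>Testing the integration by parts formula with the constant function shows that the total flux
  through \<open>B\<close> equals the mean of \<open>z\<close>, so the two vectors of boundary data have the same component
  along \<open>unit_vec\<close> and the projection does not affect the difference of their forms.\<close>

lemma flux:
  assumes r: "canonical_rep f g u w"
  shows "(\<Sum>q\<in>B. normal_part (S f) (\<psi> q)) = inner (z_part f g) one"
proof -
  note d = canonical_repD[OF r]
  have "inner f (dd (\<lambda>x. 1)) = (\<Sum>q\<in>B. 1 * normal_part (S f) (\<psi> q)) - inner (perp f) one"
    by (rule integration_by_parts[OF d(1) C_const])
  moreover have "inner (dd g) one = 0" using one_ker d(3) unfolding ker_perp_iff by simp
  ultimately show ?thesis unfolding d(7) by (simp add: dd_const inner_add_left)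
qed

text \<open>The flux identity cancels the terms containing s, so the component along
  \<open>unit_vec\<close> is the same for both signs.\<close>

lemma ip_data_unit_vec:
  assumes r: "canonical_rep f g u w"
  shows "ip (boundary_data s f g w) unit_vec = (\<Sum>q\<in>B. g q) - inner w one"
  unfolding ip_unit_vec boundary_data_def normal_values_def
  using flux[OF r] by (simp add: lookup_add lookup_scaleR_real lookup_on_B sum.distrib inner_add_left flip: sum_distrib_left)

text \<open>Each function is integrated by parts against the g of the other. The terms pairing one g
  with perp of the other or with z cancel by symmetry and skewness. What is left are products of a
  value part with a flux part, that is, a polarised difference of squares.\<close>

lemma Green_formula:
  assumes f1: "f1 \<in> dom_perp" and f2: "f2 \<in> dom_perp"
  shows "inner (- perp f1) f2 + inner f1 (- perp f2) = ip (boundary_map (-1) f1) (boundary_map (-1) f2) - ip (boundary_map 1 f1) (boundary_map 1 f2)"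
proof -
  obtain g1 u1 w1 where r1: "canonical_rep f1 g1 u1 w1" using f1 by (rule canonical_rep_exists)
  obtain g2 u2 w2 where r2: "canonical_rep f2 g2 u2 w2" using f2 by (rule canonical_rep_exists)
  note d1 = canonical_repD[OF r1] and d2 = canonical_repD[OF r2]
  define z1 where "z1 = z_part f1 g1"
  define z2 where "z2 = z_part f2 g2"
  define n1 where "n1 q = normal_part (S f1) (\<psi> q)" for q
  define n2 where "n2 q = normal_part (S f2) (\<psi> q)" for q
  have z: "z1 \<in> ker_perp" "z2 \<in> ker_perp" unfolding z1_def z2_def using d1 d2 by auto
  have orth: "inner (dd \<phi>) v = 0" "inner v (dd \<phi>) = 0" if "v \<in> ker_perp" "\<phi> \<in> C" for v \<phi>
    using that unfolding ker_perp_iff by (auto simp: inner_commute)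
  have ibp1: "inner f1 (dd \<phi>) = (\<Sum>q\<in>B. \<phi> q * n1 q) - inner (perp f1) (cls \<phi>)" if "\<phi> \<in> C" for \<phi>
    unfolding n1_def by (rule integration_by_parts[OF f1 that])
  have ibp2: "inner f2 (dd \<phi>) = (\<Sum>q\<in>B. \<phi> q * n2 q) - inner (perp f2) (cls \<phi>)" if "\<phi> \<in> C" for \<phi>
    unfolding n2_def by (rule integration_by_parts[OF f2 that])
  have a1: "perp f1 = dd g1 + z1" and a2: "perp f2 = dd g2 + z2"
    unfolding z1_def z2_def using d1(7) d2(7) by auto
  have f1e: "f1 = cls g1 + dd u1 + w1" and f2e: "f2 = cls g2 + dd u2 + w2" using d1(2) d2(2) by auto
  have 1: "inner (perp f1) f2 = (\<Sum>q\<in>B. g1 q * n2 q) - inner (perp f2) (cls g1) + inner z1 (cls g2) + inner z1 w2"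
  proof -
    have "inner z1 f2 = inner z1 (cls g2) + inner z1 w2"
      unfolding f2e using orth z d2 by (simp add: inner_add_right)
    then show ?thesis
      using ibp2[OF d1(3)] unfolding a1 by (simp add: inner_add_left inner_commute[of "dd g1"])
  qed
  have 2: "inner f1 (perp f2) = inner (perp f2) (cls g1) + inner (dd g2) (dd u1) + inner z2 w1"
  proof -
    have "inner f1 (perp f2) = inner (perp f2) f1" by (rule inner_commute)
    also have "\<dots> = inner (perp f2) (cls g1) + inner (perp f2) (dd u1) + inner (perp f2) w1"
      by (subst f1e) (simp only: inner_add_right)
    finally have "inner f1 (perp f2) = inner (perp f2) (cls g1) + inner (perp f2) (dd u1) + inner (perp f2) w1" .
    moreover have "inner (perp f2) (dd u1) = inner (dd g2) (dd u1)"
      unfolding a2 inner_add_left using orth(2)[OF z(2) d1(4)] by simp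
    moreover have "inner (perp f2) w1 = inner z2 w1"
      unfolding a2 inner_add_left using orth(1)[OF d1(6) d2(3)] by simp
    ultimately show ?thesis by simp
  qed
  have 3: "inner (dd g2) (dd u1) = (\<Sum>q\<in>B. g2 q * n1 q) - inner z1 (cls g2)"
  proof -
    have "inner f1 (dd g2) = inner (cls g1) (dd g2) + inner (dd g2) (dd u1)"
      unfolding f1e inner_add_left using orth(2)[OF d1(6) d2(3)] inner_commute[of "dd u1"] by simp
    moreover have "inner (dd g1) (cls g2) = - inner (cls g1) (dd g2)" by (rule skew_dd[OF d1(3) d2(3)])
    ultimately show ?thesis using ibp1[OF d2(3)] unfolding a1 by (simp add: inner_add_left)
  qed
  have boundary_data: "ip (boundary_data s f1 g1 w1) (boundary_data s f2 g2 w2) = (\<Sum>q\<in>B. (g1 q + s * n1 q) * (g2 q + s * n2 q)) +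
      inner (w1 + s *\<^sub>R z1) (w2 + s *\<^sub>R z2)" for s
    unfolding ip_def boundary_data_def normal_values_def z1_def z2_def n1_def n2_def
    by (simp add: lookup_add lookup_scaleR_real lookup_on_B)
  \<comment> \<open>(a - n)(a' - n') - (a + n)(a' + n') = -2 (a n' + n a'), for the values on
    \<open>B\<close> and for the pairs w, z.\<close>
  have diff: "ip (boundary_data (-1) f1 g1 w1) (boundary_data (-1) f2 g2 w2) - ip (boundary_data 1 f1 g1 w1) (boundary_data 1 f2 g2 w2) =
      -2 * ((\<Sum>q\<in>B. g1 q * n2 q) + (\<Sum>q\<in>B. g2 q * n1 q) + inner z1 w2 + inner z2 w1)"
    unfolding boundary_data
    by (simp add: algebra_simps sum.distrib sum_subtractf inner_commute[of w1 z2])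
  \<comment> \<open>The two normalising factors produce the 1/2 that turns -2 into -1.\<close>
  have h: "1 / sqrt 2 * (1 / sqrt 2 * x) = x / 2" for x :: real by simp
  have G: "ip (boundary_map s f1) (boundary_map s f2) = ip (P (boundary_data s f1 g1 w1)) (P (boundary_data s f2 g2 w2)) / 2" for s
    unfolding boundary_map_eq[OF r1] boundary_map_eq[OF r2] ip_scale_left ip_scale_right h ..
  have "ip (boundary_map (-1) f1) (boundary_map (-1) f2) - ip (boundary_map 1 f1) (boundary_map 1 f2) =
      (ip (boundary_data (-1) f1 g1 w1) (boundary_data (-1) f2 g2 w2) - ip (boundary_data 1 f1 g1 w1) (boundary_data 1 f2 g2 w2)) / 2"
    unfolding G ip_P[OF boundary_data_H_tilde[OF r1] boundary_data_H_tilde[OF r2]] ip_data_unit_vec[OF r1] ip_data_unit_vec[OF r2]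
    by (simp add: diff_divide_distrib)
  also have "\<dots> = - (inner (perp f1) f2 + inner f1 (perp f2))"
    unfolding diff 1 2 3 by simp
  finally show ?thesis by simp
qed

text \<open>Sum and difference of X and Y prescribe the trace and the flux on \<open>B\<close> and
  the parts w and z. Membership in \<open>H\<close> makes the total flux equal to the pairing of z
  with 1, which is the solvability condition of the Neumann problem for u.\<close>

lemma joint_surjectivity:
  assumes X: "X \<in> H" and Y: "Y \<in> H"
  obtains f where "f \<in> dom_perp" "boundary_map 1 f = X" "boundary_map (-1) f = Y"
proof -
  \<comment> \<open>The data must equal sqrt 2 times X and sqrt 2 times Y, so trace and flux are
    half the sum and half the difference of these.\<close>
  define A where "A q = (Poly_Mapping.lookup (fst X) q + Poly_Mapping.lookup (fst Y) q) / sqrt 2" for q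
  define N where "N q = (Poly_Mapping.lookup (fst X) q - Poly_Mapping.lookup (fst Y) q) / sqrt 2" for q
  define w where "w = (1 / sqrt 2) *\<^sub>R (snd X + snd Y)"
  define z where "z = (1 / sqrt 2) *\<^sub>R (snd X - snd Y)"
  have XY: "Poly_Mapping.keys (fst X) \<subseteq> B" "snd X \<in> ker_perp" "Poly_Mapping.keys (fst Y) \<subseteq> B" "snd Y \<in> ker_perp"
    "(\<Sum>q\<in>B. Poly_Mapping.lookup (fst X) q) = inner (snd X) one"
    "(\<Sum>q\<in>B. Poly_Mapping.lookup (fst Y) q) = inner (snd Y) one"
    using X Y unfolding H_iff H_tilde_iff ip_unit_vec by auto
  have wz: "w \<in> ker_perp" "z \<in> ker_perp" unfolding w_def z_def using XY by (auto intro: ker_subspace)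
  have sumN: "(\<Sum>q\<in>B. N q) = inner z one"
    unfolding N_def z_def using XY by (simp add: sum_subtractf inner_diff_left flip: sum_divide_distrib)
  define g where "g = trace_ext A"
  have g: "g \<in> C" "\<And>q. q \<in> B \<Longrightarrow> g q = A q" unfolding g_def using trace_ext by auto
  \<comment> \<open>The functional that E(u, .) has to equal: boundary flux minus the source
    z.\<close>
  define L where "L \<phi> = (\<Sum>q\<in>B. \<phi> q * N q) - inner z (cls \<phi>)" for \<phi>
  have L_add: "L (\<lambda>x. \<phi> x + \<phi>' x) = L \<phi> + L \<phi>'" if "\<phi> \<in> C" "\<phi>' \<in> C" for \<phi> \<phi>'
    unfolding L_def using that by (simp add: cls_add distrib_right sum.distrib inner_add_right)
  have L_scale: "L (\<lambda>x. c * \<phi> x) = c * L \<phi>" if "\<phi> \<in> C" for \<phi> c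
    unfolding L_def using that by (simp add: cls_scale sum_distrib_left mult.assoc right_diff_distrib)
  have L_const: "L (\<lambda>x. c) = 0" for c
    unfolding L_def cls_const[of c] using sumN by (simp flip: sum_distrib_left)
  have L_diff: "L (\<lambda>x. \<phi> x - \<phi>' x) = L \<phi> - L \<phi>'" if "\<phi> \<in> C" "\<phi>' \<in> C" for \<phi> \<phi>'
    using L_add[OF that(1) C_scale[OF that(2)], of "-1"] L_scale[OF that(2), of "-1"] by simp
  \<comment> \<open>The expression in parentheses bounds \<open>L\<close> by the sup norm;
    \<open>c1\<close> converts the sup norm into the energy norm once the value at \<open>p\<close>
    is subtracted, a constant on which \<open>L\<close> vanishes.\<close>
  define K where "K = ((\<Sum>q\<in>B. \<bar>N q\<bar>) + norm z * c2) * c1"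
  have L_bound: "\<bar>L \<phi>\<bar> \<le> K * norm (D \<phi>)" if \<phi>: "\<phi> \<in> C" for \<phi>
  proof -
    define \<phi>' where "\<phi>' = (\<lambda>x. \<phi> x - \<phi> p)"
    have \<phi>': "\<phi>' \<in> C" "L \<phi>' = L \<phi>" "\<And>x. \<bar>\<phi>' x\<bar> \<le> c1 * norm (D \<phi>)"
      unfolding \<phi>'_def using C_diff[OF \<phi> C_const] L_diff[OF \<phi> C_const] L_const sup_bound[OF \<phi>] by simp_all
    have "\<bar>\<Sum>q\<in>B. \<phi>' q * N q\<bar> \<le> (\<Sum>q\<in>B. \<bar>N q\<bar> * (c1 * norm (D \<phi>)))"
      by (rule order_trans[OF sum_abs]) (auto intro!: sum_mono mult_left_mono \<phi>'(3) simp: abs_mult mult.commute[of _ "N _"])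
    moreover have "\<bar>inner z (cls \<phi>')\<bar> \<le> norm z * (c2 * (c1 * norm (D \<phi>)))"
      by (rule order_trans[OF Cauchy_Schwarz_ineq2]) (intro mult_left_mono cls_bound \<phi>' norm_ge_zero)
    ultimately have "\<bar>L \<phi>'\<bar> \<le> (\<Sum>q\<in>B. \<bar>N q\<bar> * (c1 * norm (D \<phi>))) + norm z * (c2 * (c1 * norm (D \<phi>)))"
      unfolding L_def by linarith
    also have "\<dots> = K * norm (D \<phi>)" unfolding K_def by (simp add: algebra_simps sum_distrib_left sum_distrib_right)
    finally show ?thesis unfolding \<phi>'(2) .
  qed
  \<comment> \<open>By its bound \<open>L\<close> vanishes on functions with gradient 0, so it
    descends to gradients and any preimage may be chosen.\<close>
  define l where "l v = L (SOME \<phi>. \<phi> \<in> C \<and> D \<phi> = v)" for v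
  have l: "l (D \<phi>) = L \<phi>" if \<phi>: "\<phi> \<in> C" for \<phi>
  proof -
    define \<phi>' where "\<phi>' = (SOME \<phi>'. \<phi>' \<in> C \<and> D \<phi>' = D \<phi>)"
    have \<phi>': "\<phi>' \<in> C \<and> D \<phi>' = D \<phi>" unfolding \<phi>'_def by (rule someI[of _ \<phi>]) (simp add: \<phi>)
    then have "\<bar>L (\<lambda>x. \<phi>' x - \<phi> x)\<bar> \<le> K * norm (D (\<lambda>x. \<phi>' x - \<phi> x))" using \<phi> by (intro L_bound C_diff) auto
    then show ?thesis using \<phi> \<phi>' unfolding l_def \<phi>'_def[symmetric] by (simp add: D_diff L_diff)
  qed
  have "\<exists>v\<in>D ` C. \<forall>v'\<in>D ` C. inner v v' = l v'"
  proof (rule riesz_on_subspace[OF D_image_subspace D_closed, of l K])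
    fix x y c assume "x \<in> D ` C"
    then obtain \<phi> where \<phi>: "\<phi> \<in> C" "x = D \<phi>" by auto
    show "\<bar>l x\<bar> \<le> K * norm x" using L_bound[OF \<phi>(1)] l[OF \<phi>(1)] \<phi>(2) by simp
    show "l (c *\<^sub>R x) = c * l x"
      using l[OF C_scale[OF \<phi>(1)], of c] l[OF \<phi>(1)] L_scale[OF \<phi>(1)] D_scale[OF \<phi>(1)] \<phi>(2) by simp
    assume "y \<in> D ` C"
    then obtain \<phi>' where \<phi>': "\<phi>' \<in> C" "y = D \<phi>'" by auto
    show "l (x + y) = l x + l y"
      using l[OF C_add[OF \<phi>(1) \<phi>'(1)]] l[OF \<phi>(1)] l[OF \<phi>'(1)] L_add[OF \<phi>(1) \<phi>'(1)] D_add[OF \<phi>(1) \<phi>'(1)] \<phi>(2) \<phi>'(2) by simp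
  qed
  then obtain u where u: "u \<in> C" "\<And>\<phi>. \<phi> \<in> C \<Longrightarrow> inner (D u) (D \<phi>) = L \<phi>" using l by auto
  define f where "f = cls g + dd u + w"
  have key: "inner f (dd \<phi>) = (\<Sum>q\<in>B. \<phi> q * N q) - inner (dd g + z) (cls \<phi>)" if \<phi>: "\<phi> \<in> C" for \<phi>
  proof -
    have "inner w (dd \<phi>) = 0" using wz \<phi> unfolding ker_perp_iff by (simp add: inner_commute)
    moreover have "inner (dd u) (dd \<phi>) = L \<phi>" using u(2)[OF \<phi>] by (simp add: inner_dd S_dd)
    ultimately show ?thesis
      unfolding f_def using skew_dd[OF g(1) \<phi>] by (simp add: inner_add_left L_def)
  qed
  have rel: "adj_rel f (dd g + z)"
    unfolding adj_rel_def using key[OF CB_C] CB_zero by simp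
  then have f: "f \<in> dom_perp" "perp f = dd g + z" using perp_eq dom_perp_iff by auto
  have r: "canonical_rep f g u w"
    unfolding canonical_rep_iff using f wz g u f_def by simp
  have zz: "z_part f g = z" unfolding z_part_eq f(2) by simp
  \<comment> \<open>Testing \<open>key\<close> with \<psi> q picks out the flux at q.\<close>
  have n: "normal_part (S f) (\<psi> q) = N q" if q: "q \<in> B" for q
  proof -
    have "(\<Sum>q'\<in>B. \<psi> q q' * N q') = (\<Sum>q'\<in>B. if q' = q then N q else 0)"
      by (rule sum.cong) (use psi(2,3)[OF q] in auto)
    then have "(\<Sum>q'\<in>B. \<psi> q q' * N q') = N q" using finite_B q by simp
    then show ?thesis
      unfolding normal_part_eq[OF f(1)] f(2) using key[OF psi(1)[OF q]] q by auto
  qed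
  have two: "a / sqrt 2 + a / sqrt 2 = sqrt 2 * a" for a :: real
    by (simp add: field_simps)
  have two': "(1 / sqrt 2) *\<^sub>R v + (1 / sqrt 2) *\<^sub>R v = sqrt 2 *\<^sub>R v" for v :: 'l
    using two[of 1] by (simp flip: scaleR_left_distrib)
  have 1: "boundary_data 1 f g w = sqrt 2 *\<^sub>R X"
  proof (rule prod_eqI)
    show "fst (boundary_data 1 f g w) = fst (sqrt 2 *\<^sub>R X)"
    proof (rule poly_mapping_eqI)
      fix q show "Poly_Mapping.lookup (fst (boundary_data 1 f g w)) q = Poly_Mapping.lookup (fst (sqrt 2 *\<^sub>R X)) q"
        using XY(1) g(2)[of q] n[of q] two[of "Poly_Mapping.lookup (fst X) q"]
        by (cases "q \<in> B") (auto simp: boundary_data_def normal_values_def lookup_add lookup_on_B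
          lookup_scaleR_real keys_subset_iff A_def N_def add_divide_distrib diff_divide_distrib)
    qed
    show "snd (boundary_data 1 f g w) = snd (sqrt 2 *\<^sub>R X)"
      using two'[of "snd X"] by (simp add: boundary_data_def zz w_def z_def algebra_simps)
  qed
  have 2: "boundary_data (-1) f g w = sqrt 2 *\<^sub>R Y"
  proof (rule prod_eqI)
    show "fst (boundary_data (-1) f g w) = fst (sqrt 2 *\<^sub>R Y)"
    proof (rule poly_mapping_eqI)
      fix q show "Poly_Mapping.lookup (fst (boundary_data (-1) f g w)) q = Poly_Mapping.lookup (fst (sqrt 2 *\<^sub>R Y)) q"
        using XY(3) g(2)[of q] n[of q] two[of "Poly_Mapping.lookup (fst Y) q"]
        by (cases "q \<in> B") (auto simp: boundary_data_def normal_values_def lookup_minus lookup_on_B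
          lookup_scaleR_real keys_subset_iff A_def N_def add_divide_distrib diff_divide_distrib)
    qed
    show "snd (boundary_data (-1) f g w) = snd (sqrt 2 *\<^sub>R Y)"
      using two'[of "snd Y"] by (simp add: boundary_data_def zz w_def z_def algebra_simps)
  qed
  show thesis
  proof (rule that[OF f(1)])
    show "boundary_map 1 f = X" unfolding boundary_map_eq[OF r] 1 using X by (simp add: P_H H_subspace)
    show "boundary_map (-1) f = Y" unfolding boundary_map_eq[OF r] 2 using Y by (simp add: P_H H_subspace)
  qed
qed

text \<open>For single-valuedness: if two functions have the same class, skewness makes their
  derivatives agree when tested on \<open>CB\<close>, whose classes are dense.\<close>

lemma A0_facts: "densely_defined_op A0" "skew_symmetric_op A0"
proof -
  have mem: "(x, x') \<in> A0 \<longleftrightarrow> (\<exists>f\<in>CB. x = cls f \<and> x' = - dd f)" for x x'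
    unfolding A0_def dd_def by auto
  show sk: "skew_symmetric_op A0"
    unfolding skew_symmetric_op_def mem using skew_dd CB_C by (fastforce simp: mem)
  have sub: "Real_Vector_Spaces.subspace A0"
  proof (rule real_vector.subspaceI)
    have "(\<lambda>x. 0) \<in> CB" using C_const[of 0] unfolding CB_def by simp
    then show "0 \<in> A0" using dd_const[of 0] cls_const[of 0] by (force simp: mem zero_prod_def)
    fix x y :: "'l \<times> 'l" and c assume "x \<in> A0"
    then obtain f where f: "f \<in> CB" "x = (cls f, - dd f)" by (cases x) (auto simp: mem)
    have "(\<lambda>x. c * f x) \<in> CB" using f C_scale unfolding CB_def by simp
    moreover have "c *\<^sub>R x = (cls (\<lambda>x. c * f x), - dd (\<lambda>x. c * f x))"
      using f by (simp add: cls_scale[OF CB_C] dd_scale[OF CB_C])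
    ultimately show "c *\<^sub>R x \<in> A0" using mem by auto
    assume "y \<in> A0"
    then obtain g where g: "g \<in> CB" "y = (cls g, - dd g)" by (cases y) (auto simp: mem)
    have "(\<lambda>x. f x + g x) \<in> CB" using f g C_add unfolding CB_def by simp
    moreover have "x + y = (cls (\<lambda>x. f x + g x), - dd (\<lambda>x. f x + g x))"
      using f g by (simp add: cls_add[OF CB_C CB_C] dd_add[OF CB_C CB_C])
    ultimately show "x + y \<in> A0" using mem by auto
  qed
  have "single_valued A0"
    unfolding single_valued_def
  proof (intro allI impI)
    fix x y z assume "(x, y) \<in> A0" "(x, z) \<in> A0"
    then obtain f g where f: "f \<in> CB" "x = cls f" "y = - dd f" and g: "g \<in> CB" "x = cls g" "z = - dd g"
      by (auto simp: mem)
    have "inner (y - z) v = 0" if "v \<in> cls ` CB" for v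
    proof -
      obtain h where h: "h \<in> CB" "v = cls h" using \<open>v \<in> cls ` CB\<close> by auto
      show ?thesis using skew_dd[OF CB_C[OF f(1)] CB_C[OF h(1)]] skew_dd[OF CB_C[OF g(1)] CB_C[OF h(1)]] f g h
        by (simp add: inner_diff_left)
    qed
    then have "y - z = 0" by (rule orthogonal_to_dense[OF dense])
    then show "y = z" by simp
  qed
  moreover have "x \<in> Domain A0 \<longleftrightarrow> x \<in> cls ` CB" for x
    unfolding Domain_iff mem by auto
  then have "Domain A0 = cls ` CB" by auto
  ultimately show "densely_defined_op A0"
    unfolding densely_defined_op_def using sub dense by simp
qed

theorem boundary_quadruple: "boundary_quadruple A0 H ip H ip G_minus G_plus"
proof -
  have sub: "Real_Vector_Spaces.subspace H" by (rule real_vector.subspaceI) (auto intro: H_subspace)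
  have pre: "pre_hilbert H ip"
    unfolding pre_hilbert_def
  proof (intro conjI ballI allI impI)
    show "0 < ip x x" if "x \<in> H" "x \<noteq> 0" for x
      using that ip_definite[of x] ip_nonneg[of x] unfolding H_iff by (auto simp: less_le)
    show "ip x y = ip y x" for x y by (rule ip_sym)
  qed (simp_all add: sub ip_add_left ip_scale_left)
  have lin: "linear_between dom_perp (boundary_map s)" for s
    unfolding linear_between_def using boundary_map_add boundary_map_scale by simp
  have H0: "0 \<in> H" by (rule H_subspace)
  have dp: "f - f' \<in> dom_perp" "boundary_map s (f - f') = boundary_map s f - boundary_map s f'" if "f \<in> dom_perp" "f' \<in> dom_perp" for f f' s
    using dom_perp_add[OF that(1), of "(-1) *\<^sub>R f'"] dom_perp_scale[OF that(2), of "-1"]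
      boundary_map_add[OF that(1), of "(-1) *\<^sub>R f'" s] boundary_map_scale[OF that(2), of s "-1"] by simp_all
  have ker: "{x + y |x y. x \<in> dom_perp \<and> boundary_map (-1) x = 0 \<and> y \<in> dom_perp \<and> boundary_map 1 y = 0} = dom_perp" (is "?L = _")
  proof
    show "?L \<subseteq> dom_perp" using dom_perp_add by auto
    show "dom_perp \<subseteq> ?L"
    proof
      fix f assume f: "f \<in> dom_perp"
      \<comment> \<open>y carries the whole of G_+ f and lies in the kernel of G_-, so f - y lies in
        the kernel of G_+.\<close>
      obtain y where y: "y \<in> dom_perp" "boundary_map 1 y = 0" "boundary_map (-1) y = boundary_map (-1) f"
        using joint_surjectivity[OF H0 boundary_map_H[OF f]] by metis
      have "f = (f - y) + y" "f - y \<in> dom_perp" "boundary_map (-1) (f - y) = 0" using dp[OF f y(1)] y(3) by simp_all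
      then show "f \<in> ?L" using y(1,2) by blast
    qed
  qed
  have surj: "boundary_map 1 ` dom_perp = H" "boundary_map (-1) ` dom_perp = H"
  proof -
    show "boundary_map 1 ` dom_perp = H"
    proof
      show "H \<subseteq> boundary_map 1 ` dom_perp"
      proof
        fix X assume "X \<in> H"
        then obtain f where "f \<in> dom_perp" "boundary_map 1 f = X" using joint_surjectivity[OF _ H0] by metis
        then show "X \<in> boundary_map 1 ` dom_perp" by auto
      qed
    qed (use boundary_map_H in auto)
    show "boundary_map (-1) ` dom_perp = H"
    proof
      show "H \<subseteq> boundary_map (-1) ` dom_perp"
      proof
        fix X assume "X \<in> H"
        then obtain f where "f \<in> dom_perp" "boundary_map (-1) f = X" using joint_surjectivity[OF H0] by metis
        then show "X \<in> boundary_map (-1) ` dom_perp" by auto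
      qed
    qed (use boundary_map_H in auto)
  qed
  show ?thesis
    unfolding boundary_quadruple_def Domain_hat_op G_minus_eq G_plus_eq
  proof (intro conjI ballI)
    fix f1 f2 assume "f1 \<in> dom_perp" "f2 \<in> dom_perp"
    then show "inner (op_apply (hat_op A0) f1) f2 + inner f1 (op_apply (hat_op A0) f2) =
        ip (boundary_map (-1) f1) (boundary_map (-1) f2) - ip (boundary_map 1 f1) (boundary_map 1 f2)"
      by (simp only: op_apply_hat_op Green_formula)
  qed (use A0_facts pre lin ker surj in simp_all)
qed

end

section \<open>The duality map\<close>

locale one_dimensional_form = complete_compact_form E C \<nu> \<iota> p
  for E :: "('a::metric_space \<Rightarrow> real) \<Rightarrow> ('a \<Rightarrow> real) \<Rightarrow> real" and C :: "('a \<Rightarrow> real) set"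
    and \<nu> :: "('a \<Rightarrow> real) \<Rightarrow> ('a \<Rightarrow> real) \<Rightarrow> 'a set \<Rightarrow> real"
    and \<iota> :: "('a \<times> 'a \<Rightarrow> real) \<Rightarrow> 'h::{real_inner, complete_space}" and p :: 'a +
  fixes b :: 'h and cls :: "('a \<Rightarrow> real) \<Rightarrow> 'l::{real_inner, complete_space}"
  assumes b_ker: "b \<in> adjoint_kernel C D"
    and b_minimal: "minimal_energy_dominant C \<nu> (field_measure b)"
    and L2: "L2_space (field_measure b) cls"
    and dim: "has_martingale_dimension C \<nu> 1"
begin

section \<open>Square integrable functions for the measure of b\<close>

lemma measurable_field_measure: "f \<in> borel_measurable (field_measure b) \<longleftrightarrow> (f :: 'a \<Rightarrow> real) \<in> borel_measurable borel"
  using field_measure(1)[of b] by (simp cong: measurable_cong_sets)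

lemma bounded_borel_L2: "f \<in> bounded_borel \<Longrightarrow> f \<in> L2_functions (field_measure b)"
proof -
  assume f: "f \<in> bounded_borel"
  obtain K where K: "\<And>x. \<bar>f x * f x\<bar> \<le> K" using bounded_borelE[OF bounded_borel_mult[OF f f]] by metis
  have "integrable (field_measure b) (\<lambda>x. f x * f x)"
    by (rule finite_measure.integrable_const_bound[OF field_measure(4), of _ K])
      (use K bounded_borel_measurable[OF f] in \<open>auto simp: measurable_field_measure\<close>)
  then show ?thesis
    unfolding L2_functions_def using bounded_borel_measurable[OF f] by (simp add: measurable_field_measure)
qed

lemma cls_add: "f \<in> L2_functions (field_measure b) \<Longrightarrow> g \<in> L2_functions (field_measure b) \<Longrightarrow>
    cls (\<lambda>x. f x + g x) = cls f + cls g"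
  and cls_scale: "f \<in> L2_functions (field_measure b) \<Longrightarrow> cls (\<lambda>x. c * f x) = c *\<^sub>R cls f"
  and cls_inner: "f \<in> L2_functions (field_measure b) \<Longrightarrow> g \<in> L2_functions (field_measure b) \<Longrightarrow>
    inner (cls f) (cls g) = (\<integral>x. f x * g x \<partial>field_measure b)"
  and cls_surj: "cls ` L2_functions (field_measure b) = UNIV"
  using L2 unfolding L2_space_def by simp_all

lemma L2_scale: "f \<in> L2_functions (field_measure b) \<Longrightarrow> (\<lambda>x. c * f x) \<in> L2_functions (field_measure b)"
proof -
  assume f: "f \<in> L2_functions (field_measure b)"
  have "integrable (field_measure b) (\<lambda>x. (c * c) * (f x * f x))"
    using f unfolding L2_functions_def by (intro integrable_mult_right) simp
  then show ?thesis using f unfolding L2_functions_def by (auto simp: ac_simps intro!: borel_measurable_times)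
qed

text \<open>Only \<open>g\<close> is bounded here, since truncation compares an arbitrary square
  integrable \<open>f\<close> with bounded functions.\<close>

lemma cls_diff:
  assumes f: "f \<in> L2_functions (field_measure b)" and g: "g \<in> bounded_borel"
    and d: "(\<lambda>x. f x - g x) \<in> L2_functions (field_measure b)"
  shows "(norm (cls f - cls g))\<^sup>2 = (\<integral>x. (f x - g x) * (f x - g x) \<partial>field_measure b)"
proof -
  have "cls (\<lambda>x. f x + (-1) * g x) = cls f + cls (\<lambda>x. (-1) * g x)"
    by (rule cls_add[OF f L2_scale[OF bounded_borel_L2[OF g]]])
  also have "cls (\<lambda>x. (-1) * g x) = - cls g" using cls_scale[OF bounded_borel_L2[OF g], of "-1"] by simp
  finally have "cls f - cls g = cls (\<lambda>x. f x - g x)" by simp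
  then show ?thesis using cls_inner[OF d d] by (simp add: power2_norm_eq_inner)
qed

lemma cls_diff_bounded:
  assumes "f \<in> bounded_borel" "g \<in> bounded_borel"
  shows "(norm (cls f - cls g))\<^sup>2 = EM (\<lambda>x. (f x - g x) * (f x - g x)) b b"
  using cls_diff[OF bounded_borel_L2[OF assms(1)] assms(2) bounded_borel_L2[OF bounded_borel_diff[OF assms]]]
    field_measure(5)[OF bounded_borel_mult[OF bounded_borel_diff[OF assms] bounded_borel_diff[OF assms]], of b] by simp

lemma cls_inner_bounded:
  assumes "f \<in> bounded_borel" "g \<in> bounded_borel"
  shows "inner (cls f) (cls g) = EM (\<lambda>x. f x * g x) b b"
  using cls_inner[OF bounded_borel_L2[OF assms(1)] bounded_borel_L2[OF assms(2)]]
    field_measure(5)[OF bounded_borel_mult[OF assms], of b] by simp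

lemma EM_square_bound:
  assumes f: "f \<in> bounded_borel" "\<And>x. \<bar>f x\<bar> \<le> K"
  shows "EM (\<lambda>x. f x * f x) b b \<le> (norm b * K)\<^sup>2"
proof -
  have "EM (\<lambda>x. f x * f x) b b \<le> EM (\<lambda>x. (K * K) * 1) b b"
  proof (rule EM_mono)
    show "f x * f x \<le> (K * K) * 1" for x
      using mult_mono[OF f(2)[of x] f(2)[of x]] order_trans[OF abs_ge_zero f(2)[of x]] by (simp flip: abs_mult)
  qed (intro bounded_borel_mult f bounded_borel_const)+
  also have "\<dots> = (K * K) * EM (\<lambda>x. 1) b b" by (rule sigma_functional_cmult[OF EM_functional bounded_borel_const])
  also have "\<dots> = (norm b * K)\<^sup>2" by (simp add: EM_one power2_norm_eq_inner power_mult_distrib) (simp add: power2_eq_square)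
  finally show ?thesis .
qed

lemma cls_bound:
  assumes f: "f \<in> bounded_borel" "\<And>x. \<bar>f x\<bar> \<le> K"
  shows "norm (cls f) \<le> norm b * K"
proof (rule power2_le_imp_le)
  show "(norm (cls f))\<^sup>2 \<le> (norm b * K)\<^sup>2"
    using EM_square_bound[OF f] cls_inner_bounded[OF f(1) f(1)] by (simp add: power2_norm_eq_inner)
  show "0 \<le> norm b * K" using order_trans[OF abs_ge_zero f(2)] by simp
qed

lemma norm_tendsto_zeroI: "(\<lambda>n::nat. (norm (v n - u))\<^sup>2) \<longlonglongrightarrow> 0 \<Longrightarrow> v \<longlonglongrightarrow> u"
  using tendsto_real_sqrt[of "\<lambda>n. (norm (v n - u))\<^sup>2" 0 sequentially] by (simp add: tendsto_norm_zero_iff LIM_zero_iff)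

lemma cls_tendsto:
  assumes s: "\<And>n. s n \<in> bounded_borel" "\<And>n x. \<bar>s n x\<bar> \<le> K" "\<And>x. (\<lambda>n. s n x) \<longlonglongrightarrow> f x"
  shows "(\<lambda>n. cls (s n)) \<longlonglongrightarrow> cls f"
proof (rule norm_tendsto_zeroI)
  have f: "f \<in> bounded_borel" by (rule bounded_borel_lim[of s K f]) (use s bounded_borel_measurable[OF s(1)] in auto)
  have fK: "\<bar>f x\<bar> \<le> K" for x by (rule LIMSEQ_le_const2[OF tendsto_rabs[OF s(3)]]) (use s(2) in auto)
  have "(\<lambda>n. EM (\<lambda>x. (s n x - f x) * (s n x - f x)) b b) \<longlonglongrightarrow> EM (\<lambda>x. 0) b b"
  proof (rule sigma_functional_lim[OF EM_functional, of "\<lambda>n x. (s n x - f x) * (s n x - f x)" "(2 * K) * (2 * K)"])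
    show "(\<lambda>x. (s n x - f x) * (s n x - f x)) \<in> borel_measurable borel" for n
      by (rule bounded_borel_measurable) (intro bounded_borel_mult bounded_borel_diff s f)
    show "\<bar>(s n x - f x) * (s n x - f x)\<bar> \<le> (2 * K) * (2 * K)" for n x
    proof -
      have "\<bar>s n x - f x\<bar> \<le> 2 * K" using s(2)[of n x] fK[of x] by linarith
      then show ?thesis unfolding abs_mult using order_trans[OF abs_ge_zero] by (intro mult_mono) auto
    qed
    have "(\<lambda>n. (s n x - f x) * (s n x - f x)) \<longlonglongrightarrow> (f x - f x) * (f x - f x)" for x
      by (intro tendsto_mult tendsto_diff tendsto_const s)
    then show "(\<lambda>n. (s n x - f x) * (s n x - f x)) \<longlonglongrightarrow> 0" for x by simp
  qed
  then show "(\<lambda>n. (norm (cls (s n) - cls f))\<^sup>2) \<longlonglongrightarrow> 0"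
    by (simp add: cls_diff_bounded[OF s(1) f] sigma_functional_zero[OF EM_functional])
qed

text \<open>Soft thresholding of a uniform approximation is a combination of normal contractions and
  makes it vanish on \<open>B\<close>.\<close>

lemma approximation_vanishing_on:
  assumes \<phi>: "\<phi> \<in> Cc" "\<And>x. x \<in> B \<Longrightarrow> \<phi> x = 0" and e: "0 < e"
  shows "\<exists>g\<in>C. (\<forall>x\<in>B. g x = 0) \<and> (\<forall>x. \<bar>\<phi> x - g x\<bar> \<le> 2 * e)"
proof -
  obtain g0 where g0: "g0 \<in> C" "\<And>x. \<bar>\<phi> x - g0 x\<bar> < e" using uniformly_dense[OF \<phi>(1) e] by auto
  have unit: "(\<lambda>x. max (min (u x) 1) 0) \<in> C" if "u \<in> C" for u
    using admissible that unfolding admissible_form_def by simp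
  define g where "g x = g0 x - e * max (min ((1 / e) * g0 x) 1) 0 + e * max (min ((- 1 / e) * g0 x) 1) 0" for x
  have "g \<in> C"
    unfolding g_def[abs_def] by (intro C_add C_diff C_scale unit g0)
  moreover have s: "g x = (if g0 x > e then g0 x - e else if g0 x < - e then g0 x + e else 0)" for x
    using e unfolding g_def by (auto simp: max_def min_def field_simps)
  \<comment> \<open>On \<open>B\<close> the approximation is smaller than the threshold e and is cut
    to 0; elsewhere approximation error and threshold add up to at most 2 e.\<close>
  have "g x = 0" if "x \<in> B" for x
    using g0(2)[of x] \<phi>(2)[OF that] unfolding s by (simp add: abs_less_iff)
  moreover have "\<bar>\<phi> x - g x\<bar> \<le> 2 * e" for x
    using g0(2)[of x] e unfolding s by (auto simp: abs_less_iff abs_le_iff)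
  ultimately show ?thesis by auto
qed

text \<open>Density is built in layers: continuous functions vanishing on \<open>B\<close> by soft
  thresholding, all continuous functions because \<open>B\<close> is null, bounded Borel functions
  by bounded limits, and the rest by truncation.\<close>

lemma cls_dense:
  assumes B: "finite B"
  shows "closure (cls ` {f \<in> C. \<forall>x\<in>B. f x = 0}) = UNIV" (is "closure ?S = UNIV")
proof -
  have van: "cls \<phi> \<in> closure ?S" if \<phi>: "\<phi> \<in> Cc" "\<And>x. x \<in> B \<Longrightarrow> \<phi> x = 0" for \<phi>
    unfolding closure_approachable
  proof (intro allI impI)
    fix e :: real assume e: "0 < e"
    \<comment> \<open>The L^2 norm is at most \<open>norm b\<close> times the sup norm, and the
      approximation costs 2 d; adding 1 avoids division by 0.\<close>
    define d where "d = e / (2 * (norm b + 1))"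
    have d: "0 < d" using e unfolding d_def by (simp add: add_nonneg_pos)
    obtain g where g: "g \<in> C" "\<forall>x\<in>B. g x = 0" "\<And>x. \<bar>\<phi> x - g x\<bar> \<le> 2 * d"
      using approximation_vanishing_on[OF \<phi> d, where B = B] by auto
    have bb: "\<phi> \<in> bounded_borel" "g \<in> bounded_borel" using Cc_bounded_borel \<phi> C_Cc[OF g(1)] by auto
    have "(norm (cls \<phi> - cls g))\<^sup>2 \<le> (norm b * (2 * d))\<^sup>2"
      unfolding cls_diff_bounded[OF bb] by (rule EM_square_bound[OF bounded_borel_diff[OF bb] g(3)])
    then have "norm (cls \<phi> - cls g) \<le> norm b * (2 * d)" by (rule power2_le_imp_le) (use d in simp)
    also have "\<dots> < (norm b + 1) * (2 * d)" using d by (intro mult_strict_right_mono) auto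
    also have "\<dots> = e" unfolding d_def using norm_ge_zero[of b] by (simp add: field_simps add_nonneg_eq_0_iff)
    finally show "\<exists>y\<in>?S. dist y (cls \<phi>) < e"
      using g(1,2) by (intro bexI[of _ "cls g"]) (auto simp: dist_norm norm_minus_commute)
  qed
  have EM_B: "EM (indicator B) b b = 0"
    using B
  proof (induction B)
    case empty
    then show ?case using sigma_functional_zero[OF EM_functional] by (simp add: indicator_def[abs_def])
  next
    case (insert q A)
    have "(indicator (insert q A) :: 'a \<Rightarrow> real) = (\<lambda>x. indicator {q} x + indicator A x)"
      using insert(2) by (auto simp: indicator_def fun_eq_iff)
    then have "EM (indicator (insert q A)) b b = EM (indicator {q}) b b + EM (indicator A) b b"
      using insert(1) finite_imp_closed[of A]
      by (simp add: sigma_functional_add[OF EM_functional] bounded_borel_indicator borel_closed)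
    then show ?case using insert EM_point by simp
  qed
  have cont: "cls \<phi> \<in> closure ?S" if \<phi>: "\<phi> \<in> Cc" for \<phi>
  proof (cases "B = {}")
    case True
    then show ?thesis using van[OF \<phi>] by simp
  next
    case False
    have clB: "closed B" by (rule finite_imp_closed[OF B])
    have IB: "indicator B \<in> bounded_borel" by (intro bounded_borel_indicator borel_closed clB)
    obtain K where K: "\<And>x. \<bar>\<phi> x\<bar> \<le> K" "0 \<le> K" using Cc_bounded[OF \<phi>] by metis
    \<comment> \<open>Cutoffs of \<phi> that vanish on \<open>B\<close>; their limit differs from
      \<phi> only on the null set \<open>B\<close>.\<close>
    define s where "s n x = \<phi> x * min 1 (real n * infdist x B)" for n x
    define f where "f x = \<phi> x - \<phi> x * indicator B x" for x
    have sC: "s n \<in> Cc" for n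
      using \<phi> unfolding s_def Cc_iff by (auto intro!: continuous_intros)
    have sK: "\<bar>s n x\<bar> \<le> K" for n x
      using mult_mono[OF K(1)[of x], of "\<bar>min 1 (real n * infdist x B)\<bar>" 1] K(2)
      unfolding s_def abs_mult by (auto simp: infdist_nonneg)
    have slim: "(\<lambda>n. s n x) \<longlonglongrightarrow> f x" for x
    proof (cases "x \<in> B")
      case True
      then show ?thesis by (simp add: s_def f_def)
    next
      case notin: False
      have pos: "infdist x B > 0" by (rule infdist_pos_not_in_closed[OF clB False notin])
      obtain N :: nat where N: "real N * infdist x B > 1" using reals_Archimedean3[OF pos] by metis
      have "s n x = f x" if "n \<ge> N" for n
      proof -
        have "min 1 (real n * infdist x B) = 1"
          using N mult_right_mono[of "real N" "real n" "infdist x B"] that pos by linarith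
        then show ?thesis using notin unfolding s_def f_def by simp
      qed
      then have "\<forall>\<^sub>F n in sequentially. s n x = f x" unfolding eventually_sequentially by auto
      then show ?thesis by (rule tendsto_eventually)
    qed
    have "cls (s n) \<in> closure ?S" for n
      by (rule van[OF sC]) (simp add: s_def)
    then have fV: "cls f \<in> closure ?S"
      by (rule closed_sequentially[OF closed_closure _ cls_tendsto[OF Cc_bounded_borel[OF sC] sK slim]])
    have \<phi>b: "\<phi> \<in> bounded_borel" by (rule Cc_bounded_borel[OF \<phi>])
    have fb: "f \<in> bounded_borel" unfolding f_def[abs_def] by (intro bounded_borel_diff bounded_borel_mult \<phi>b IB)
    have "(norm (cls \<phi> - cls f))\<^sup>2 = EM (\<lambda>x. (\<phi> x - f x) * (\<phi> x - f x)) b b" by (rule cls_diff_bounded[OF \<phi>b fb])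
    also have "\<dots> \<le> EM (\<lambda>x. (K * K) * indicator B x) b b"
    proof (rule EM_mono)
      show "(\<lambda>x. (\<phi> x - f x) * (\<phi> x - f x)) \<in> bounded_borel" by (intro bounded_borel_mult bounded_borel_diff \<phi>b fb)
      show "(\<lambda>x. (K * K) * indicator B x) \<in> bounded_borel" by (intro bounded_borel_cmult IB)
      show "(\<phi> x - f x) * (\<phi> x - f x) \<le> (K * K) * indicator B x" for x
        using mult_mono[OF K(1)[of x] K(1)[of x]] K(2) by (auto simp: f_def indicator_def simp flip: abs_mult)
    qed
    also have "\<dots> = (K * K) * EM (indicator B) b b" by (rule sigma_functional_cmult[OF EM_functional IB])
    finally have "cls \<phi> = cls f" using EM_B by simp
    then show ?thesis using fV by simp
  qed
  have bor: "cls f \<in> closure ?S" if "f \<in> bounded_borel" for f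
    using that
  proof (induction rule: bounded_borel_induct)
    case (continuous f K)
    then show ?case by (intro cont) (simp add: Cc_iff)
  next
    case (lim s f K)
    have l: "(\<lambda>n. cls (s n)) \<longlonglongrightarrow> cls f"
      by (rule cls_tendsto[of s K f]) (use lim in \<open>auto intro: bounded_borelI\<close>)
    show ?case by (rule closed_sequentially[OF closed_closure lim.IH l])
  qed
  have "cls f \<in> closure ?S" if f: "f \<in> L2_functions (field_measure b)" for f
  proof -
    \<comment> \<open>Large values are discarded, so that the squared error is dominated by
      f^2.\<close>
    define s where "s n x = f x * indicator {x. \<bar>f x\<bar> \<le> real n} x" for n :: nat and x
    have fm: "f \<in> borel_measurable borel" and fi: "integrable (field_measure b) (\<lambda>x. f x * f x)"
      using f unfolding L2_functions_def by (auto simp: measurable_field_measure)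
    have sm: "s n \<in> borel_measurable borel" for n
    proof -
      have "(\<lambda>x. \<bar>f x\<bar>) \<in> borel_measurable borel" using fm by simp
      then have "(\<lambda>x. \<bar>f x\<bar>) -` {..real n} \<inter> space borel \<in> sets borel" by (rule measurable_sets) simp
      then have "{x. \<bar>f x\<bar> \<le> real n} \<in> sets borel" by (simp add: vimage_def)
      then show ?thesis unfolding s_def[abs_def] using fm by (intro borel_measurable_times borel_measurable_indicator)
    qed
    have sb: "s n \<in> bounded_borel" for n
      by (rule bounded_borelI[OF sm, of _ "real n"]) (auto simp: s_def indicator_def)
    have bound: "\<bar>(f x - s n x) * (f x - s n x)\<bar> \<le> f x * f x" for n x
      unfolding s_def by (auto simp: indicator_def)
    have d: "(\<lambda>x. f x - s n x) \<in> L2_functions (field_measure b)" for n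
      unfolding L2_functions_def
    proof (intro CollectI conjI)
      show "(\<lambda>x. f x - s n x) \<in> borel_measurable (field_measure b)"
        using fm sm by (simp add: measurable_field_measure)
      show "integrable (field_measure b) (\<lambda>x. (f x - s n x) * (f x - s n x))"
        by (rule Bochner_Integration.integrable_bound[OF fi]) (use fm sm bound in \<open>auto simp: measurable_field_measure\<close>)
    qed
    have "(\<lambda>n. \<integral>x. (f x - s n x) * (f x - s n x) \<partial>field_measure b) \<longlonglongrightarrow> (\<integral>x. 0 \<partial>field_measure b)"
    proof (rule integral_dominated_convergence[where w = "\<lambda>x. f x * f x"])
      have "(\<lambda>n. (f x - s n x) * (f x - s n x)) \<longlonglongrightarrow> 0" for x
      proof (rule tendsto_eventually)
        obtain N :: nat where "\<bar>f x\<bar> \<le> real N" using real_arch_simple by metis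
        then have "(f x - s n x) * (f x - s n x) = 0" if "n \<ge> N" for n
          using that by (simp add: s_def indicator_def)
        then show "\<forall>\<^sub>F n in sequentially. (f x - s n x) * (f x - s n x) = 0"
          unfolding eventually_sequentially by auto
      qed
      then show "AE x in field_measure b. (\<lambda>n. (f x - s n x) * (f x - s n x)) \<longlonglongrightarrow> 0" by simp
    qed (use fm sm fi bound in \<open>auto simp: measurable_field_measure\<close>)
    then have "(\<lambda>n. (norm (cls (s n) - cls f))\<^sup>2) \<longlonglongrightarrow> 0"
      by (simp add: cls_diff[OF f sb d, symmetric] norm_minus_commute)
    then have l: "(\<lambda>n. cls (s n)) \<longlonglongrightarrow> cls f" by (rule norm_tendsto_zeroI)
    show ?thesis by (rule closed_sequentially[OF closed_closure bor[OF sb] l])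
  qed
  then have "cls ` L2_functions (field_measure b) \<subseteq> closure ?S" by (rule image_subsetI)
  then show ?thesis unfolding cls_surj by (rule subset_antisym[OF subset_UNIV])
qed

lemma Cc_dense: "closure (cls ` Cc) = UNIV"
proof -
  have "closure (cls ` {f \<in> C. \<forall>x\<in>{}. f x = 0}) \<subseteq> closure (cls ` Cc)"
    by (intro closure_mono image_mono) (use C_Cc in auto)
  then show ?thesis using cls_dense[of "{}"] by auto
qed

section \<open>The isometry and its range\<close>

definition S :: "'l \<Rightarrow> 'h" where "S = star C \<iota> cls b"

text \<open>For continuous g the squared norm of g b is the integral of g^2 against the measure of
  \<open>b\<close>, so the map is isometric on a dense set and extends uniquely.\<close>

lemma S:
  shows "bounded_linear S" and "\<And>F. norm (S F) = norm F" and "\<And>g. g \<in> Cc \<Longrightarrow> S (cls g) = T g b"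
proof -
  define Q where "Q U \<longleftrightarrow> bounded_linear U \<and> (\<forall>F. norm (U F) = norm F) \<and> (\<forall>g\<in>Cc. U (cls g) = action C \<iota> g b)"
    for U :: "'l \<Rightarrow> 'h"
  have nT: "norm (T g b) = norm (cls g)" if g: "g \<in> Cc" for g
  proof -
    have "inner (T g b) (T g b) = inner (cls g) (cls g)"
      by (simp add: inner_T_T[OF g g] cls_inner_bounded[OF Cc_bounded_borel[OF g] Cc_bounded_borel[OF g]])
    then show ?thesis by (simp add: norm_eq_sqrt_inner)
  qed
  have "\<exists>U. bounded_linear U \<and> (\<forall>g\<in>Cc. U (cls g) = T g b) \<and> (\<forall>F. norm (U F) \<le> 1 * norm F)"
  proof (rule linear_extension_from_representatives[where pl = "\<lambda>g h x. g x + h x" and sc = "\<lambda>c g x. c * g x"])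
    fix g h :: "'a \<Rightarrow> real" and c assume g: "g \<in> Cc"
    show "(\<lambda>x. c * g x) \<in> Cc \<and> cls (\<lambda>x. c * g x) = c *\<^sub>R cls g \<and> T (\<lambda>x. c * g x) b = c *\<^sub>R T g b"
      using g by (simp add: Cc_simps T_cmult cls_scale bounded_borel_L2 Cc_bounded_borel)
    show "norm (T g b) \<le> 1 * norm (cls g)" using nT[OF g] by simp
    assume h: "h \<in> Cc"
    show "(\<lambda>x. g x + h x) \<in> Cc \<and> cls (\<lambda>x. g x + h x) = cls g + cls h \<and> T (\<lambda>x. g x + h x) b = T g b + T h b"
      using g h by (simp add: Cc_simps T_add cls_add bounded_borel_L2 Cc_bounded_borel)
  qed (rule Cc_dense)
  then obtain U where U: "bounded_linear U" "\<And>g. g \<in> Cc \<Longrightarrow> U (cls g) = T g b" by auto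
  have "norm (U F) = norm F" for F
  proof -
    obtain g where g: "\<And>n::nat. g n \<in> Cc" "(\<lambda>n. cls (g n)) \<longlonglongrightarrow> F" using dense_image_sequence[OF Cc_dense] by metis
    have "(\<lambda>n. norm (U (cls (g n)))) \<longlonglongrightarrow> norm (U F)"
      by (intro tendsto_norm bounded_linear.tendsto[OF U(1)] g)
    moreover have "(\<lambda>n. norm (U (cls (g n)))) \<longlonglongrightarrow> norm F"
      unfolding U(2)[OF g(1)] nT[OF g(1)] by (intro tendsto_norm g)
    ultimately show ?thesis by (rule LIMSEQ_unique)
  qed
  then have QU: "Q U" unfolding Q_def using U by (simp add: T_def)
  have "V = U" if "Q V" for V
  proof (intro ext)
    show "V F = U F" for F
    proof (rule bounded_linear_eq_dense[of V U cls Cc, OF _ _ Cc_dense])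
      show "bounded_linear V" "bounded_linear U" using that QU unfolding Q_def by simp_all
      show "V (cls g) = U (cls g)" if "g \<in> Cc" for g
        using \<open>Q V\<close> QU that unfolding Q_def by simp
    qed
  qed
  then have "S = U" unfolding S_def star_def Q_def[symmetric] using QU by (intro the_equality)
  then have "Q S" using QU by simp
  then show "bounded_linear S" "\<And>F. norm (S F) = norm F" "\<And>g. g \<in> Cc \<Longrightarrow> S (cls g) = T g b"
    unfolding Q_def T_def by simp_all
qed

lemma S_linear: "linear S"
  using S(1) by (rule bounded_linear.linear)

lemma S_isometry: "inner (S v) (S w) = inner v w"
proof -
  have "(norm (S (v + w)))\<^sup>2 = (norm (v + w))\<^sup>2" by (simp add: S(2))
  moreover have "(norm (S v))\<^sup>2 = (norm v)\<^sup>2" "(norm (S w))\<^sup>2 = (norm w)\<^sup>2" by (simp_all add: S(2))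
  ultimately show ?thesis
    unfolding linear_add[OF S_linear] power2_norm_eq_inner by (simp add: inner_add_left inner_add_right inner_commute)
qed

text \<open>The range of an isometry on a complete space is closed. A vector outside would leave a
  nonzero remainder orthogonal to all \<phi> b, which dimension one excludes.\<close>

lemma S_surj: "surj S"
proof -
  have sub: "Real_Vector_Spaces.subspace (range S)"
    by (rule linear_subspace_image[OF S_linear]) simp
  have "closed (range S)"
    unfolding closed_sequential_limits
  proof (intro allI impI)
    fix s v assume s: "(\<forall>n. s n \<in> range S) \<and> s \<longlonglongrightarrow> v"
    then have "\<forall>n. \<exists>x. s n = S x" by auto
    then obtain x where x: "\<And>n. s n = S (x n)" by metis
    have "dist (x m) (x n) = dist (s m) (s n)" for m n
      unfolding dist_norm x using S(2)[of "x m - x n"] by (simp add: linear_diff[OF S_linear])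
    moreover have "Cauchy s" using s by (auto intro: LIMSEQ_imp_Cauchy)
    ultimately have "Cauchy x" unfolding Cauchy_def by simp
    then obtain u where u: "x \<longlonglongrightarrow> u" using Cauchy_convergent_iff convergent_def by metis
    have "s = (\<lambda>n. S (x n))" using x by (simp add: fun_eq_iff)
    then have "s \<longlonglongrightarrow> S u" using bounded_linear.tendsto[OF S(1) u] by simp
    then have "v = S u" using s LIMSEQ_unique by auto
    then show "v \<in> range S" by simp
  qed
  then have "\<exists>y\<in>range S. \<forall>w\<in>range S. inner (v - y) w = 0" for v by (rule orthogonal_projection_exists[OF sub])
  then have "v \<in> range S" for v
  proof -
    obtain y where y: "y \<in> range S" "\<And>w. w \<in> range S \<Longrightarrow> inner (v - y) w = 0"
      using \<open>\<And>v. \<exists>y\<in>range S. \<forall>w\<in>range S. inner (v - y) w = 0\<close>[of v] by auto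
    have "v - y = 0"
    proof (rule one_dimensional_orthogonal[OF dim b_minimal])
      fix \<phi> :: "'a \<Rightarrow> real" assume "\<phi> \<in> Cc"
      then show "inner (v - y) (T \<phi> b) = 0" using y(2)[OF rangeI[of S "cls \<phi>"]] S(3)[of \<phi>] by simp
    qed
    then show ?thesis using y(1) by simp
  qed
  then show ?thesis by auto
qed

text \<open>\<open>b\<close> is orthogonal to the gradient of f g, which splits by the product rule;
  in each summand the factor is moved across the scalar product.\<close>

lemma skew:
  assumes f: "f \<in> C" and g: "g \<in> C"
  shows "inner (D f) (S (cls g)) = - inner (S (cls f)) (D g)"
proof -
  have sw: "inner (D u) (T w b) = inner (T w (D u)) b" if "w \<in> C" for u w
  proof -
    have w: "w \<in> Cc" using C_Cc[OF that] .
    have "inner (D u) (T w b) = EM w b (D u)" using inner_T[OF w, of b "D u"] by (simp add: inner_commute)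
    also have "\<dots> = EM w (D u) b" by (rule EM_sym[OF Cc_bounded_borel[OF w]])
    finally show ?thesis using inner_T[OF w, of "D u" b] by simp
  qed
  have "inner b (D (\<lambda>x. f x * g x)) = 0" using b_ker C_mult[OF f g] unfolding adjoint_kernel_def by simp
  then have "inner (T f (D g)) b + inner (T g (D f)) b = 0"
    unfolding Leibniz[OF f g] by (simp add: inner_add_right inner_commute)
  then show ?thesis
    unfolding S(3)[OF C_Cc[OF f]] S(3)[OF C_Cc[OF g]] using sw[OF g, of f] sw[OF f, of g]
    by (simp add: inner_commute)
qed

lemma C_L2: "f \<in> C \<Longrightarrow> f \<in> L2_functions (field_measure b)"
  by (intro bounded_borel_L2 Cc_bounded_borel C_Cc)

text \<open>The sup constant comes from completeness; the L^2 constant is the square root of the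
  total mass of the measure of \<open>b\<close>.\<close>

lemma skew_boundary_setting:
  assumes B: "finite B"
  shows "skew_boundary_setting E C D cls S b B p c_sup (norm b)"
proof (rule skew_boundary_setting.intro)
  show "closure (cls ` boundary_setting.CB C B) = UNIV"
    unfolding boundary_setting.CB_def by (rule cls_dense[OF B])
  show "S (cls (\<lambda>x. 1)) = b" using S(3)[OF Cc_simps(1), of 1] by (simp add: T_const)
  show "norm (cls f) \<le> norm b * K" if "f \<in> C" "\<And>x. \<bar>f x\<bar> \<le> K" for f K
    by (rule cls_bound[OF Cc_bounded_borel[OF C_Cc[OF that(1)]] that(2)])
qed (use B in \<open>simp_all add: C_add C_mult C_const D_add D_scale D_const E_eq D_closed sup_bound cls_add cls_scale C_L2
  S(1) S_isometry S_surj skew separate\<close>, rule D_zero)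

end

theorem theorem9p2:
  fixes E :: "('a::metric_space \<Rightarrow> real) \<Rightarrow> ('a \<Rightarrow> real) \<Rightarrow> real"
    and C :: "('a \<Rightarrow> real) set"
    and \<nu> :: "('a \<Rightarrow> real) \<Rightarrow> ('a \<Rightarrow> real) \<Rightarrow> 'a set \<Rightarrow> real"
    and \<iota> :: "('a \<times> 'a \<Rightarrow> real) \<Rightarrow> 'h::{real_inner, complete_space}"
    and b :: 'h
    and cls :: "('a \<Rightarrow> real) \<Rightarrow> 'l::{real_inner, complete_space}"
    and B :: "'a set" and p :: 'a
    and D :: "('a \<Rightarrow> real) \<Rightarrow> 'h" and S :: "'l \<Rightarrow> 'h" and \<nu>b :: "'a measure"
  assumes "locally_compact_space (euclidean :: 'a topology)"
    and "separable_space (euclidean :: 'a topology)"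
    and "admissible_form E C"
    and "energy_measures E C \<nu>"
    and "first_order_space C \<nu> \<iota>"
    and "D = gradient \<iota>"
    and "has_martingale_dimension C \<nu> 1"
    and "finite B" and "p \<notin> B"
    and "complete_form E C \<iota> p"
    and "b \<in> adjoint_kernel C D"
    and "\<nu>b = as_measure (field_energy_measure C \<nu> \<iota> b b)"
    and "minimal_energy_dominant C \<nu> \<nu>b"
    and "L2_space \<nu>b cls"
    and "S = star C \<iota> cls b"
  shows "boundary_quadruple (boundary_setting.A0 C D cls S B)
           (boundary_setting.H C D cls S B) (boundary_setting.ip B)
           (boundary_setting.H C D cls S B) (boundary_setting.ip B)
           (boundary_setting.G_minus E C D cls S b B)
           (boundary_setting.G_plus E C D cls S b B)"
proof -
  \<comment> \<open>Completeness puts 1 into \<open>C\<close>, and with it the space is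
    compact.\<close>
  have one: "(\<lambda>x. 1) \<in> C" using assms(10) unfolding complete_form_def by simp
  interpret F: compact_form E C \<nu> \<iota>
    using assms(3,4,5) one by unfold_locales
  have \<nu>b: "\<nu>b = F.field_measure b" using assms(12) unfolding F.field_measure_def .
  interpret F: one_dimensional_form E C \<nu> \<iota> p b cls
    using assms(7,10,11,13,14) unfolding \<nu>b assms(6) by unfold_locales
  have S: "S = F.S" unfolding F.S_def assms(15) ..
  have "skew_boundary_setting E C D cls S b B p F.c_sup (norm b)"
    unfolding S assms(6) by (rule F.skew_boundary_setting[OF assms(8)])
  then show ?thesis by (rule skew_boundary_setting.boundary_quadruple)
qed

end
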